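(* Let $G$ be a Gromov hyperbolic group such that its boundary at infinity $\partial_\infty G$ (equipped with a visual metric) is a Sierpiński carpet, and let $\mathcal{S}$ be the collection of peripheral circles of $\partial_\infty G$. Then $\mathcal{S}$ consists of uniform quasicircles, the elements of $\mathcal{S}$ are uniformly relatively separated, and they occur on all locations and scales.
   Context: A finitely generated group $G$ is Gromov hyperbolic if its Cayley graph $X$ with respect to a finite symmetric generating set is a Gromov hyperbolic metric space; $\partial_\infty G:=\partial_\infty X$ is its Gromov boundary. A visual metric on $\partial_\infty G$ is a metric $d$ for which there are a basepoint $p\in X$ and constants $C\ge1$, $\Lambda>1$ with $C^{-1}\Lambda^{-(a|b)_p}\le d(a,b)\le C\Lambda^{-(a|b)_p}$ for all $a,b\in\partial_\infty G$, where $(a|b)_p$ is the Gromov product. Fix any visual metric $d$. A Sierpiński carpet is a space homeomorphic to the standard Sierpiński carpet (obtained from the unit square by repeatedly subdividing squares into nine equal subsquares and removing the open middle one). A peripheral circle of a carpet $T$ is a subset $S\subseteq T$ homeomorphic to a circle such that $T\setminus S$ is connected. For a metric carpet $(T,d)$ with collection $\mathcal{S}$ of peripheral circles: (1) $\mathcal{S}$ consists of uniform quasicircles if there is a single homeomorphism $\eta:[0,\infty)\to[0,\infty)$ such that each $S\in\mathcal{S}$ is the image of the unit circle $\partial\mathbb{D}$ under an $\eta$-quasisymmetric homeomorphism $\partial\mathbb{D}\to S$. Equivalently: there are $N\in\mathbb{N}$ and $k\ge1$ such that each $S\in\mathcal{S}$ is $N$-doubling (every ball of radius $r$ in $S$ is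 covered by at most $N$ balls of radius $r/2$) and for all distinct $x,y\in S$ one of the subarcs $\gamma$ of $S$ with endpoints $x,y$ satisfies $\operatorname{diam}(\gamma)\le k\,d(x,y)$. (A homeomorphism $f:(X,d_X)\to(Y,d_Y)$ is $\eta$-quasisymmetric if $\frac{d_Y(f(x),f(y))}{d_Y(f(x),f(z))}\le\eta\big(\frac{d_X(x,y)}{d_X(x,z)}\big)$ for all $x,y,z\in X$, $x\neq z$.) (2) $\mathcal{S}$ is uniformly relatively separated if there is $s>0$ with $\operatorname{dist}(S,S')\ge s\min\{\operatorname{diam}(S),\operatorname{diam}(S')\}$ for all distinct $S,S'\in\mathcal{S}$. (3) The peripheral circles occur on all locations and scales if there is $c>0$ such that for every $x\in T$ and every $0<r\le\operatorname{diam}(T)$ there is $S\in\mathcal{S}$ with $S\subseteq B(x,r)$ and $\operatorname{diam}(S)\ge cr$, where $B(x,r)$ is the open ball. *)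

theory Defs
  imports "HOL-Analysis.Analysis" "HOL-Algebra.Generated_Groups"
begin

section \<open>Cayley graphs\<close>

definition symmetric_generating_set :: "('a, 'b) monoid_scheme \<Rightarrow> 'a set \<Rightarrow> bool" where
  "symmetric_generating_set G A \<longleftrightarrow>
     A \<subseteq> carrier G \<and> (\<forall>a\<in>A. inv\<^bsub>G\<^esub> a \<in> A) \<and> generate G A = carrier G"

definition cayley_edges :: "('a, 'b) monoid_scheme \<Rightarrow> 'a set \<Rightarrow> ('a \<times> 'a) set" where
  "cayley_edges G A = {(g, g \<otimes>\<^bsub>G\<^esub> a) | g a. g \<in> carrier G \<and> a \<in> A}"

definition word_dist :: "('a, 'b) monoid_scheme \<Rightarrow> 'a set \<Rightarrow> 'a \<Rightarrow> 'a \<Rightarrow> nat" where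
  "word_dist G A g h = (LEAST n. (g, h) \<in> cayley_edges G A ^^ n)"

text \<open>
  The Cayley graph is the geometric realization in which every edge is isometric to the unit
  interval.  A point is given by its barycentric coordinates: a nonnegative function of total
  mass 1 supported on a vertex or on the two endpoints of an edge.  (A generator and its inverse
  give the same unoriented edge, and the generator 1, if present, contributes no loop.)
\<close>

definition cayley_simplices :: "('a, 'b) monoid_scheme \<Rightarrow> 'a set \<Rightarrow> 'a set set" where
  "cayley_simplices G A =
     {{g} | g. g \<in> carrier G} \<union> {{g, h} | g h. (g, h) \<in> cayley_edges G A}"

definition supp :: "('a \<Rightarrow> real) \<Rightarrow> 'a set" where
  "supp x = {v. x v \<noteq> 0}"

definition cayley_points :: "('a, 'b) monoid_scheme \<Rightarrow> 'a set \<Rightarrow> ('a \<Rightarrow> real) set" where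
  "cayley_points G A =
     {x. supp x \<in> cayley_simplices G A \<and> (\<forall>v. 0 \<le> x v) \<and> (\<Sum>v\<in>supp x. x v) = 1}"

text \<open>
  Two points on a common closed edge are joined by a segment of that edge, and half the
  \<open>\<ell>\<^sup>1\<close>-norm of the difference is its length.  Otherwise a shortest path leaves the
  edge of \<open>x\<close> through an endpoint \<open>g\<close>, which is at distance \<open>1 - x g\<close> from \<open>x\<close>, and enters the
  edge of \<open>y\<close> through an endpoint \<open>h\<close>.  The value 0 off the Cayley graph is forced by
  \<open>Metric_space\<close>, which asks for symmetry and nonnegativity on the whole type.
\<close>

definition cayley_dist ::
    "('a, 'b) monoid_scheme \<Rightarrow> 'a set \<Rightarrow> ('a \<Rightarrow> real) \<Rightarrow> ('a \<Rightarrow> real) \<Rightarrow> real" where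
  "cayley_dist G A x y =
     (if x \<notin> cayley_points G A \<or> y \<notin> cayley_points G A then 0
      else if supp x \<union> supp y \<in> cayley_simplices G A
      then (\<Sum>v\<in>supp x \<union> supp y. \<bar>x v - y v\<bar>) / 2
      else Min {(1 - x g) + real (word_dist G A g h) + (1 - y h) | g h. g \<in> supp x \<and> h \<in> supp y})"

definition cayley_graph :: "('a, 'b) monoid_scheme \<Rightarrow> 'a set \<Rightarrow> ('a \<Rightarrow> real) metric" where
  "cayley_graph G A = metric (cayley_points G A, cayley_dist G A)"


text \<open>
  \<open>metric\<close> is unspecified on pairs that are not metric spaces, so the following is needed for
  \<open>cayley_graph\<close> to mean what it should.
\<close>

context
  fixes G :: "('a, 'b) monoid_scheme" (structure) and A :: "'a set"
  assumes G: "group G" and A: "symmetric_generating_set G A"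
begin

interpretation group G by (rule G)

lemma cayley_edges_carrier: "(g, h) \<in> cayley_edges G A \<Longrightarrow> g \<in> carrier G \<and> h \<in> carrier G"
  using A by (auto simp: cayley_edges_def symmetric_generating_set_def)

lemma cayley_edges_sym: "(g, h) \<in> cayley_edges G A \<Longrightarrow> (h, g) \<in> cayley_edges G A"
proof -
  assume "(g, h) \<in> cayley_edges G A"
  then obtain a where a: "g \<in> carrier G" "a \<in> A" "h = g \<otimes> a"
    by (auto simp: cayley_edges_def)
  have ac: "a \<in> carrier G" "inv a \<in> A"
    using a A by (auto simp: symmetric_generating_set_def)
  have "g = h \<otimes> inv a"
    using a ac by (simp add: m_assoc)
  then show ?thesis
    using a ac by (auto simp: cayley_edges_def)
qed

lemma cayley_walk_sym: "(g, h) \<in> cayley_edges G A ^^ n \<Longrightarrow> (h, g) \<in> cayley_edges G A ^^ n"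
proof (induction n arbitrary: h)
  case (Suc n)
  then obtain k where "(g, k) \<in> cayley_edges G A ^^ n" "(k, h) \<in> cayley_edges G A"
    by auto
  then show ?case
    using Suc.IH cayley_edges_sym relpow_Suc_I2 by metis
qed auto

lemma cayley_walk_exists:
  assumes "g \<in> carrier G" "h \<in> carrier G"
  shows "\<exists>n. (g, h) \<in> cayley_edges G A ^^ n"
proof -
  have *: "\<forall>g\<in>carrier G. (g, g \<otimes> k) \<in> (cayley_edges G A)\<^sup>*" if "k \<in> generate G A" for k
    using that
  proof induction
    case one
    then show ?case by simp
  next
    case (incl a)
    then show ?case by (auto simp: cayley_edges_def)
  next
    case (inv a)
    then have "inv a \<in> A" using A by (auto simp: symmetric_generating_set_def)
    then show ?case by (auto simp: cayley_edges_def)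
  next
    case (eng a b)
    have ab: "a \<in> carrier G" "b \<in> carrier G"
      using eng.hyps A by (auto simp: symmetric_generating_set_def)
    show ?case
    proof
      fix g assume g: "g \<in> carrier G"
      have "(g, g \<otimes> a) \<in> (cayley_edges G A)\<^sup>*" "(g \<otimes> a, g \<otimes> a \<otimes> b) \<in> (cayley_edges G A)\<^sup>*"
        using eng.IH g ab by auto
      then show "(g, g \<otimes> (a \<otimes> b)) \<in> (cayley_edges G A)\<^sup>*"
        using g ab by (simp add: m_assoc)
    qed
  qed
  have "inv g \<otimes> h \<in> generate G A"
    using assms A by (simp add: symmetric_generating_set_def)
  from bspec[OF *[OF this] assms(1)] have "(g, h) \<in> (cayley_edges G A)\<^sup>*"
    using assms by (simp flip: m_assoc)
  then show ?thesis
    by (simp add: rtrancl_power)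
qed

lemma word_dist_walk:
  assumes "g \<in> carrier G" "h \<in> carrier G"
  shows "(g, h) \<in> cayley_edges G A ^^ word_dist G A g h"
  unfolding word_dist_def using cayley_walk_exists[OF assms] by (rule LeastI_ex)

lemma word_dist_le: "(g, h) \<in> cayley_edges G A ^^ n \<Longrightarrow> word_dist G A g h \<le> n"
  unfolding word_dist_def by (rule Least_le)

lemma word_dist_commute: "word_dist G A g h = word_dist G A h g"
  unfolding word_dist_def by (rule arg_cong[where f = Least]) (auto intro: cayley_walk_sym)

lemma word_dist_triangle:
  assumes "g \<in> carrier G" "h \<in> carrier G" "k \<in> carrier G"
  shows "word_dist G A g k \<le> word_dist G A g h + word_dist G A h k"
  using word_dist_walk[OF assms(1,2)] word_dist_walk[OF assms(2,3)]
  by (intro word_dist_le) (auto simp: relpow_add)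

lemma word_dist_refl [simp]: "word_dist G A g g = 0"
  using word_dist_le[of g g 0] by simp

lemma word_dist_eq_0: "g \<in> carrier G \<Longrightarrow> h \<in> carrier G \<Longrightarrow> word_dist G A g h = 0 \<Longrightarrow> g = h"
  using word_dist_walk[of g h] by auto

lemma word_dist_simplex:
  assumes "e \<in> cayley_simplices G A" "g \<in> e" "h \<in> e" "g \<noteq> h"
  shows "word_dist G A g h = 1" "e = {g, h}"
proof -
  have c: "g \<in> carrier G" "h \<in> carrier G" "(g, h) \<in> cayley_edges G A"
    using assms cayley_edges_carrier cayley_edges_sym by (auto simp: cayley_simplices_def)
  have "word_dist G A g h \<le> 1"
    using c(3) by (intro word_dist_le) simp
  moreover have "word_dist G A g h \<noteq> 0"
    using word_dist_eq_0 c assms(4) by blast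
  ultimately show "word_dist G A g h = 1" by simp
  show "e = {g, h}"
    using assms by (auto simp: cayley_simplices_def)
qed

lemma cayley_simplex_subset:
  assumes "e \<in> cayley_simplices G A" "f \<subseteq> e" "f \<noteq> {}"
  shows "f \<in> cayley_simplices G A"
proof (cases "\<exists>g. f = {g}")
  case True
  then show ?thesis
    using assms cayley_edges_carrier by (fastforce simp: cayley_simplices_def)
next
  case False
  then obtain g h where gh: "g \<in> f" "h \<in> f" "g \<noteq> h"
    using assms(3) by blast
  then have "e = {g, h}"
    using word_dist_simplex(2)[OF assms(1)] assms(2) by blast
  then have "f = e" using gh assms(2) by blast
  then show ?thesis using assms(1) by simp
qed

lemma cayley_simplex_finite:
  assumes "e \<in> cayley_simplices G A"
  shows "finite e" "e \<noteq> {}" "e \<subseteq> carrier G"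
  using assms cayley_edges_carrier by (auto simp: cayley_simplices_def)

lemma cayley_pointsD:
  assumes "x \<in> cayley_points G A"
  shows "supp x \<in> cayley_simplices G A" "finite (supp x)" "supp x \<noteq> {}" "supp x \<subseteq> carrier G"
    "0 \<le> x v" "x v \<le> 1" "(\<Sum>v\<in>supp x. x v) = 1"
    "g \<in> supp x \<Longrightarrow> h \<in> supp x \<Longrightarrow> g \<noteq> h \<Longrightarrow> x g + x h = 1"
    "v \<notin> supp x \<Longrightarrow> x v = 0"
proof -
  show 1: "supp x \<in> cayley_simplices G A" and 2: "(\<Sum>v\<in>supp x. x v) = 1" and 3: "0 \<le> x v" for v
    using assms by (auto simp: cayley_points_def)
  show 4: "finite (supp x)" "supp x \<noteq> {}" "supp x \<subseteq> carrier G"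
    using cayley_simplex_finite[OF 1] by auto
  show 5: "v \<notin> supp x \<Longrightarrow> x v = 0" for v
    by (simp add: supp_def)
  have "x v \<le> (\<Sum>v\<in>supp x. x v)" if "v \<in> supp x"
    using that 3 4 by (intro member_le_sum) auto
  then show "x v \<le> 1"
    using 2 5 by fastforce
  assume "g \<in> supp x" "h \<in> supp x" "g \<noteq> h"
  moreover from this have "supp x = {g, h}"
    using word_dist_simplex(2)[OF 1] by blast
  ultimately show "x g + x h = 1"
    using 2 by simp
qed

lemma cayley_points_edge_sum:
  assumes "x \<in> cayley_points G A" "supp x \<subseteq> {g, h}" "g \<noteq> h"
  shows "x g + x h = 1"
proof -
  have "(\<Sum>v\<in>{g, h}. x v) = (\<Sum>v\<in>supp x. x v)"
    using assms(2) by (intro sum.mono_neutral_right) (auto simp: supp_def)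
  then show ?thesis using cayley_pointsD(7)[OF assms(1)] assms(3) by simp
qed

lemma cayley_dist_edge:
  assumes x: "x \<in> cayley_points G A" and y: "y \<in> cayley_points G A"
    and e: "e \<in> cayley_simplices G A" "supp x \<subseteq> e" "supp y \<subseteq> e" and g: "g \<in> e"
  shows "cayley_dist G A x y = \<bar>x g - y g\<bar>"
proof -
  have f: "supp x \<union> supp y \<in> cayley_simplices G A"
    using cayley_simplex_subset[OF e(1)] e(2,3) cayley_pointsD(3)[OF x] by simp
  have eq: "(\<Sum>v\<in>supp x \<union> supp y. \<bar>x v - y v\<bar>) = (\<Sum>v\<in>e. \<bar>x v - y v\<bar>)"
    using e cayley_simplex_finite[OF e(1)]
    by (intro sum.mono_neutral_left) (auto simp: supp_def)
  have "(\<Sum>v\<in>e. \<bar>x v - y v\<bar>) = 2 * \<bar>x g - y g\<bar>"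
  proof (cases "e = {g}")
    case True
    then have "supp x = {g}" "supp y = {g}"
      using e cayley_pointsD(3)[OF x] cayley_pointsD(3)[OF y] by auto
    then show ?thesis
      using True cayley_pointsD(7)[OF x] cayley_pointsD(7)[OF y] by simp
  next
    case False
    then obtain h where h: "h \<in> e" "h \<noteq> g" using g by blast
    then have "e = {g, h}" using word_dist_simplex(2)[OF e(1) g] by blast
    then show ?thesis
      using cayley_points_edge_sum[OF x, of g h] cayley_points_edge_sum[OF y, of g h] e h by auto
  qed
  then show ?thesis
    unfolding cayley_dist_def using x y f eq by simp
qed

lemma cayley_dist_far:
  assumes x: "x \<in> cayley_points G A" and y: "y \<in> cayley_points G A"
    and f: "supp x \<union> supp y \<notin> cayley_simplices G A"
  shows "\<exists>g\<in>supp x. \<exists>h\<in>supp y.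
    cayley_dist G A x y = (1 - x g) + real (word_dist G A g h) + (1 - y h)"
    and "g \<in> supp x \<Longrightarrow> h \<in> supp y \<Longrightarrow>
    cayley_dist G A x y \<le> (1 - x g) + real (word_dist G A g h) + (1 - y h)"
proof -
  let ?S = "{(1 - x g) + real (word_dist G A g h) + (1 - y h) | g h. g \<in> supp x \<and> h \<in> supp y}"
  have S: "?S = (\<lambda>(g, h). (1 - x g) + real (word_dist G A g h) + (1 - y h)) ` (supp x \<times> supp y)"
    by force
  have fin: "finite ?S" "?S \<noteq> {}"
    using cayley_pointsD(2,3)[OF x] cayley_pointsD(2,3)[OF y] unfolding S by auto
  have d: "cayley_dist G A x y = Min ?S"
    unfolding cayley_dist_def using x y f by simp
  show "\<exists>g\<in>supp x. \<exists>h\<in>supp y.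
    cayley_dist G A x y = (1 - x g) + real (word_dist G A g h) + (1 - y h)"
    using Min_in[OF fin] unfolding d by blast
  show "cayley_dist G A x y \<le> (1 - x g) + real (word_dist G A g h) + (1 - y h)"
    if "g \<in> supp x" "h \<in> supp y"
    unfolding d using that by (intro Min_le fin(1)) blast
qed

lemma cayley_dist_le:
  assumes x: "x \<in> cayley_points G A" and y: "y \<in> cayley_points G A"
    and g: "g \<in> supp x" and h: "h \<in> supp y"
  shows "cayley_dist G A x y \<le> (1 - x g) + real (word_dist G A g h) + (1 - y h)"
proof (cases "supp x \<union> supp y \<in> cayley_simplices G A")
  case False
  then show ?thesis using cayley_dist_far(2)[OF x y] g h by blast
next
  case True
  have d: "cayley_dist G A x y = \<bar>x g - y g\<bar>"
    using cayley_dist_edge[OF x y True] g by blast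
  note b = cayley_pointsD(5,6)[OF x, of g] cayley_pointsD(5,6)[OF y, of g]
    cayley_pointsD(6)[OF x, of g] cayley_pointsD(6)[OF y, of h]
  show ?thesis
  proof (cases "g = h")
    case True
    then show ?thesis using d b by simp
  next
    case False
    then have "word_dist G A g h = 1"
      using word_dist_simplex(1)[OF True] g h by blast
    then show ?thesis using d b by simp
  qed
qed

lemma cayley_dist_commute: "cayley_dist G A x y = cayley_dist G A y x"
proof -
  have "{(1 - x g) + real (word_dist G A g h) + (1 - y h) | g h. g \<in> supp x \<and> h \<in> supp y} =
        {(1 - y h) + real (word_dist G A h g) + (1 - x g) | h g. h \<in> supp y \<and> g \<in> supp x}"
    by (subst (2) word_dist_commute) (auto simp: algebra_simps; blast)
  moreover have "(\<Sum>v\<in>supp x \<union> supp y. \<bar>x v - y v\<bar>) = (\<Sum>v\<in>supp y \<union> supp x. \<bar>y v - x v\<bar>)"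
    by (simp add: Un_commute abs_minus_commute)
  ultimately show ?thesis
    by (simp add: cayley_dist_def Un_commute)
qed

lemma cayley_dist_nonneg: "0 \<le> cayley_dist G A x y"
proof (cases "x \<in> cayley_points G A \<and> y \<in> cayley_points G A")
  case True
  then have x: "x \<in> cayley_points G A" and y: "y \<in> cayley_points G A" by auto
  show ?thesis
  proof (cases "supp x \<union> supp y \<in> cayley_simplices G A")
    case True
    then show ?thesis
      unfolding cayley_dist_def by (auto intro: sum_nonneg)
  next
    case False
    then obtain g h where "cayley_dist G A x y = (1 - x g) + real (word_dist G A g h) + (1 - y h)"
      using cayley_dist_far(1)[OF x y] by blast
    then show ?thesis
      using cayley_pointsD(6)[OF x, of g] cayley_pointsD(6)[OF y, of h] by simp
  qed
qed (auto simp: cayley_dist_def)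

lemma cayley_dist_eq_0:
  assumes x: "x \<in> cayley_points G A" and y: "y \<in> cayley_points G A"
  shows "cayley_dist G A x y = 0 \<longleftrightarrow> x = y"
proof
  assume "x = y"
  then show "cayley_dist G A x y = 0"
    using cayley_pointsD(1)[OF x] by (simp add: cayley_dist_def)
next
  assume 0: "cayley_dist G A x y = 0"
  show "x = y"
  proof (cases "supp x \<union> supp y \<in> cayley_simplices G A")
    case True
    show ?thesis
    proof
      fix v
      show "x v = y v"
      proof (cases "v \<in> supp x \<union> supp y")
        case v: True
        then show ?thesis
          using cayley_dist_edge[OF x y True _ _ v] 0 by simp
      qed (auto simp: supp_def)
    qed
  next
    case False
    then obtain g h where gh: "g \<in> supp x" "h \<in> supp y"
      "cayley_dist G A x y = (1 - x g) + real (word_dist G A g h) + (1 - y h)"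
      using cayley_dist_far(1)[OF x y] by blast
    then have 1: "x g = 1" "y h = 1" "word_dist G A g h = 0"
      using 0 cayley_pointsD(6)[OF x, of g] cayley_pointsD(6)[OF y, of h] by auto
    then have "g = h"
      using gh word_dist_eq_0 cayley_pointsD(4)[OF x] cayley_pointsD(4)[OF y] by blast
    have "supp x \<subseteq> {g}"
      using cayley_pointsD(8)[OF x gh(1)] 1 by (auto simp: supp_def)
    moreover have "supp y \<subseteq> {g}"
      using cayley_pointsD(8)[OF y gh(2)] 1 \<open>g = h\<close> by (auto simp: supp_def)
    ultimately have "supp x \<union> supp y = supp x"
      using gh by auto
    then show ?thesis
      using False cayley_pointsD(1)[OF x] by simp
  qed
qed

lemma cayley_dist_triangle_aux:
  assumes x: "x \<in> cayley_points G A" and y: "y \<in> cayley_points G A" and z: "z \<in> cayley_points G A"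
    and e: "supp x \<union> supp y \<in> cayley_simplices G A"
    and f: "supp y \<union> supp z \<notin> cayley_simplices G A"
  shows "cayley_dist G A x z \<le> cayley_dist G A x y + cayley_dist G A y z"
proof -
  obtain h k where hk: "h \<in> supp y" "k \<in> supp z"
    "cayley_dist G A y z = (1 - y h) + real (word_dist G A h k) + (1 - z k)"
    using cayley_dist_far(1)[OF y z f] by blast
  have d: "cayley_dist G A x y = \<bar>x h - y h\<bar>"
    using cayley_dist_edge[OF x y e] hk(1) by blast
  show ?thesis
  proof (cases "h \<in> supp x")
    case True
    then show ?thesis
      using cayley_dist_le[OF x z _ hk(2), of h] hk(3) d by linarith
  next
    case False
    obtain g where g: "g \<in> supp x"
      using cayley_pointsD(3)[OF x] by blast
    then have gh: "g \<noteq> h" using False by blast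
    have 1: "word_dist G A g h = 1" "supp x \<union> supp y = {g, h}"
      using word_dist_simplex[OF e _ _ gh] g hk(1) by auto
    have "x h = 0" using False by (simp add: supp_def)
    moreover have "x g + x h = 1"
      using cayley_points_edge_sum[OF x _ gh] 1 by auto
    moreover have "word_dist G A g k \<le> 1 + word_dist G A h k"
      using word_dist_triangle[of g h k] 1 g hk cayley_pointsD(4)[OF x] cayley_pointsD(4)[OF y]
        cayley_pointsD(4)[OF z] by auto
    ultimately show ?thesis
      using cayley_dist_le[OF x z g hk(2)] hk(3) d cayley_pointsD(5)[OF y, of h] by simp
  qed
qed

lemma cayley_dist_triangle:
  assumes x: "x \<in> cayley_points G A" and y: "y \<in> cayley_points G A" and z: "z \<in> cayley_points G A"
  shows "cayley_dist G A x z \<le> cayley_dist G A x y + cayley_dist G A y z"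
proof -
  consider (ef) "supp x \<union> supp y \<in> cayley_simplices G A" "supp y \<union> supp z \<in> cayley_simplices G A"
    | (e) "supp x \<union> supp y \<in> cayley_simplices G A" "supp y \<union> supp z \<notin> cayley_simplices G A"
    | (f) "supp x \<union> supp y \<notin> cayley_simplices G A" "supp y \<union> supp z \<in> cayley_simplices G A"
    | (n) "supp x \<union> supp y \<notin> cayley_simplices G A" "supp y \<union> supp z \<notin> cayley_simplices G A"
    by blast
  then show ?thesis
  proof cases
    case e
    then show ?thesis by (rule cayley_dist_triangle_aux[OF x y z])
  next
    case f
    then show ?thesis
      using cayley_dist_triangle_aux[OF z y x] cayley_dist_commute
      by (simp add: Un_commute add.commute)
  next
    case n
    obtain g h where gh: "g \<in> supp x" "h \<in> supp y"
      "cayley_dist G A x y = (1 - x g) + real (word_dist G A g h) + (1 - y h)"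
      using cayley_dist_far(1)[OF x y n(1)] by blast
    obtain h' k where hk: "h' \<in> supp y" "k \<in> supp z"
      "cayley_dist G A y z = (1 - y h') + real (word_dist G A h' k) + (1 - z k)"
      using cayley_dist_far(1)[OF y z n(2)] by blast
    have c: "g \<in> carrier G" "h \<in> carrier G" "h' \<in> carrier G" "k \<in> carrier G"
      using gh hk cayley_pointsD(4)[OF x] cayley_pointsD(4)[OF y] cayley_pointsD(4)[OF z] by auto
    have "real (word_dist G A h h') \<le> (1 - y h) + (1 - y h')"
    proof (cases "h = h'")
      case True
      then show ?thesis using cayley_pointsD(6)[OF y, of h] by simp
    next
      case False
      then show ?thesis
        using word_dist_simplex(1)[OF cayley_pointsD(1)[OF y] gh(2) hk(1)]
          cayley_pointsD(8)[OF y gh(2) hk(1)] by simp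
    qed
    moreover have "word_dist G A g k \<le> word_dist G A g h + word_dist G A h h' + word_dist G A h' k"
      using word_dist_triangle[of g h h'] word_dist_triangle[of g h' k] c by linarith
    then have "real (word_dist G A g k) \<le>
        real (word_dist G A g h) + real (word_dist G A h h') + real (word_dist G A h' k)"
      by linarith
    ultimately show ?thesis
      using cayley_dist_le[OF x z gh(1) hk(2)] gh(3) hk(3) by linarith
  next
    case ef
    show ?thesis
    proof (cases "\<exists>v. supp y = {v}")
      case False
      have "e = supp y" if "e \<in> cayley_simplices G A" "supp y \<subseteq> e" for e
      proof -
        obtain g h where "g \<in> supp y" "h \<in> supp y" "g \<noteq> h"
          using False cayley_pointsD(3)[OF y] by blast
        then show ?thesis using word_dist_simplex(2)[OF that(1)] that(2) by blast
      qed
      from this[OF ef(1)] this[OF ef(2)] have s: "supp x \<subseteq> supp y" "supp z \<subseteq> supp y" by auto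
      obtain g where g: "g \<in> supp y" using cayley_pointsD(3)[OF y] by blast
      note e = cayley_pointsD(1)[OF y]
      show ?thesis
        using cayley_dist_edge[OF x y e s(1) _ g] cayley_dist_edge[OF y z e _ s(2) g]
          cayley_dist_edge[OF x z e s g] by simp
    next
      case True
      then obtain v where v: "supp y = {v}" by blast
      then have yv: "y v = 1" using cayley_pointsD(7)[OF y] by simp
      have dx: "cayley_dist G A x y = 1 - x v"
        using cayley_dist_edge[OF x y ef(1), of v] v yv cayley_pointsD(6)[OF x, of v] by (simp add: subset_insertI)
      have dz: "cayley_dist G A y z = 1 - z v"
        using cayley_dist_edge[OF y z ef(2), of v] v yv cayley_pointsD(6)[OF z, of v] by (simp add: subset_insertI)
      have star: "\<exists>g\<in>supp u. 1 - u g + real (word_dist G A g v) \<le> 1 - u v"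
        if u: "u \<in> cayley_points G A" and e: "supp u \<union> {v} \<in> cayley_simplices G A" for u
      proof (cases "v \<in> supp u")
        case True
        then show ?thesis by force
      next
        case False
        obtain g where g: "g \<in> supp u" using cayley_pointsD(3)[OF u] by blast
        then have gv: "g \<noteq> v" using False by blast
        have 1: "word_dist G A g v = 1" "supp u \<union> {v} = {g, v}"
          using word_dist_simplex[OF e _ _ gv] g by auto
        have "u v = 0" using False by (simp add: supp_def)
        then have "u g = 1"
          using cayley_points_edge_sum[OF u _ gv] 1 by auto
        then show ?thesis using 1 g \<open>u v = 0\<close> by force
      qed
      obtain g where g: "g \<in> supp x" "1 - x g + real (word_dist G A g v) \<le> 1 - x v"
        using star[OF x] ef(1) v by auto
      obtain k where k: "k \<in> supp z" "1 - z k + real (word_dist G A k v) \<le> 1 - z v"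
        using star[OF z] ef(2) v by (auto simp: Un_commute)
      have "word_dist G A g k \<le> word_dist G A g v + word_dist G A k v"
        using word_dist_triangle[of g v k] g(1) k(1) v word_dist_commute[of k v]
          cayley_pointsD(4)[OF x] cayley_pointsD(4)[OF y] cayley_pointsD(4)[OF z] by auto
      then have "real (word_dist G A g k) \<le> real (word_dist G A g v) + real (word_dist G A k v)"
        by linarith
      then show ?thesis
        using cayley_dist_le[OF x z g(1) k(1)] g(2) k(2) dx dz by linarith
    qed
  qed
qed

lemma Metric_space_cayley: "Metric_space (cayley_points G A) (cayley_dist G A)"
  by unfold_locales
    (use cayley_dist_nonneg cayley_dist_commute cayley_dist_eq_0 cayley_dist_triangle in blast)+

lemma mspace_cayley_graph: "mspace (cayley_graph G A) = cayley_points G A"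
  and mdist_cayley_graph: "mdist (cayley_graph G A) = cayley_dist G A"
  using Metric_space.mspace_metric[OF Metric_space_cayley]
    Metric_space.mdist_metric[OF Metric_space_cayley]
  by (simp_all add: cayley_graph_def)

end


section \<open>Gromov hyperbolicity, the boundary at infinity, visual metrics\<close>

definition gromov_product :: "'a metric \<Rightarrow> 'a \<Rightarrow> 'a \<Rightarrow> 'a \<Rightarrow> real" where
  "gromov_product X p x y = (mdist X x p + mdist X y p - mdist X x y) / 2"

definition gromov_hyperbolic :: "'a metric \<Rightarrow> bool" where
  "gromov_hyperbolic X \<longleftrightarrow>
     (\<exists>\<delta>\<ge>0. \<forall>p\<in>mspace X. \<forall>x\<in>mspace X. \<forall>y\<in>mspace X. \<forall>z\<in>mspace X.
        gromov_product X p x z \<ge> min (gromov_product X p x y) (gromov_product X p y z) - \<delta>)"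

text \<open>Neither of the next two notions depends on the basepoint, so it is quantified universally.\<close>

definition converges_to_infinity :: "'a metric \<Rightarrow> (nat \<Rightarrow> 'a) \<Rightarrow> bool" where
  "converges_to_infinity X u \<longleftrightarrow>
     range u \<subseteq> mspace X \<and>
     (\<forall>p\<in>mspace X. filterlim (\<lambda>(i, j). gromov_product X p (u i) (u j)) at_top
                     (sequentially \<times>\<^sub>F sequentially))"

definition equivalent_at_infinity :: "'a metric \<Rightarrow> (nat \<Rightarrow> 'a) \<Rightarrow> (nat \<Rightarrow> 'a) \<Rightarrow> bool" where
  "equivalent_at_infinity X u v \<longleftrightarrow>
     (\<forall>p\<in>mspace X. filterlim (\<lambda>i. gromov_product X p (u i) (v i)) at_top sequentially)"

definition gromov_boundary :: "'a metric \<Rightarrow> (nat \<Rightarrow> 'a) set set" where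
  "gromov_boundary X =
     {u. converges_to_infinity X u} //
     {(u, v). converges_to_infinity X u \<and> converges_to_infinity X v \<and> equivalent_at_infinity X u v}"

definition boundary_gromov_product ::
    "'a metric \<Rightarrow> 'a \<Rightarrow> (nat \<Rightarrow> 'a) set \<Rightarrow> (nat \<Rightarrow> 'a) set \<Rightarrow> ereal" where
  "boundary_gromov_product X p a b =
     (SUP (u, v)\<in>a \<times> b.
        Liminf (sequentially \<times>\<^sub>F sequentially) (\<lambda>(i, j). ereal (gromov_product X p (u i) (v j))))"

text \<open>\<open>exp_minus \<Lambda> t\<close> is \<open>\<Lambda>\<close> to the power \<open>-t\<close>, with value 0 at \<open>t = \<infinity>\<close>, i.e. when \<open>a = b\<close>.\<close>

definition exp_minus :: "real \<Rightarrow> ereal \<Rightarrow> real" where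
  "exp_minus \<Lambda> t = (if t = \<infinity> then 0 else \<Lambda> powr (- real_of_ereal t))"

definition visual_metric :: "'a metric \<Rightarrow> (nat \<Rightarrow> 'a) set metric \<Rightarrow> bool" where
  "visual_metric X d \<longleftrightarrow>
     mspace d = gromov_boundary X \<and>
     (\<exists>p\<in>mspace X. \<exists>C\<ge>1. \<exists>\<Lambda>>1. \<forall>a\<in>gromov_boundary X. \<forall>b\<in>gromov_boundary X.
        inverse C * exp_minus \<Lambda> (boundary_gromov_product X p a b) \<le> mdist d a b \<and>
        mdist d a b \<le> C * exp_minus \<Lambda> (boundary_gromov_product X p a b))"


section \<open>Sierpinski carpets and peripheral circles\<close>

text \<open>Lower left corners of the closed squares of side \<open>1 / 3 ^ n\<close> that are left after \<open>n\<close> steps.\<close>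

primrec carpet_corners :: "nat \<Rightarrow> (real \<times> real) set" where
  "carpet_corners 0 = {(0, 0)}"
| "carpet_corners (Suc n) =
     {(x + real i / 3 ^ Suc n, y + real j / 3 ^ Suc n) | x y i j.
        (x, y) \<in> carpet_corners n \<and> i < 3 \<and> j < 3 \<and> (i, j) \<noteq> (1, 1)}"

definition standard_carpet :: "(real \<times> real) set" where
  "standard_carpet = (\<Inter>n. \<Union>(x, y)\<in>carpet_corners n. {x..x + 1 / 3 ^ n} \<times> {y..y + 1 / 3 ^ n})"

definition sierpinski_carpet :: "'a topology \<Rightarrow> bool" where
  "sierpinski_carpet T \<longleftrightarrow> T homeomorphic_space top_of_set standard_carpet"

definition peripheral_circles :: "'a topology \<Rightarrow> 'a set set" where
  "peripheral_circles T =
     {S. S \<subseteq> topspace T \<and>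
         subtopology T S homeomorphic_space top_of_set (sphere (0::complex) 1) \<and>
         connectedin T (topspace T - S)}"


section \<open>Metric properties of families of subsets\<close>

definition homeo_halfline :: "(real \<Rightarrow> real) \<Rightarrow> bool" where
  "homeo_halfline \<eta> \<longleftrightarrow> homeomorphic_map (top_of_set {0..}) (top_of_set {0..}) \<eta>"

definition quasisymmetric :: "(real \<Rightarrow> real) \<Rightarrow> 'a metric \<Rightarrow> 'b metric \<Rightarrow> ('a \<Rightarrow> 'b) \<Rightarrow> bool" where
  "quasisymmetric \<eta> X Y f \<longleftrightarrow>
     homeomorphic_map (mtopology_of X) (mtopology_of Y) f \<and>
     (\<forall>x\<in>mspace X. \<forall>y\<in>mspace X. \<forall>z\<in>mspace X. x \<noteq> z \<longrightarrow>
        mdist Y (f x) (f y) / mdist Y (f x) (f z) \<le> \<eta> (mdist X x y / mdist X x z))"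

definition uniform_quasicircles :: "'a metric \<Rightarrow> 'a set set \<Rightarrow> bool" where
  "uniform_quasicircles X \<S> \<longleftrightarrow>
     (\<exists>\<eta>. homeo_halfline \<eta> \<and>
        (\<forall>S\<in>\<S>. \<exists>f. quasisymmetric \<eta> (submetric euclidean_metric (sphere (0::complex) 1))
                                     (submetric X S) f))"

text \<open>Meaningful for nonempty bounded sets only (as are all subsets of a metric carpet).\<close>

definition mdiam :: "'a metric \<Rightarrow> 'a set \<Rightarrow> real" where
  "mdiam X S = (SUP (x, y)\<in>S \<times> S. mdist X x y)"

definition msetdist :: "'a metric \<Rightarrow> 'a set \<Rightarrow> 'a set \<Rightarrow> real" where
  "msetdist X S S' = (INF (x, y)\<in>S \<times> S'. mdist X x y)"

definition uniformly_relatively_separated :: "'a metric \<Rightarrow> 'a set set \<Rightarrow> bool" where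
  "uniformly_relatively_separated X \<S> \<longleftrightarrow>
     (\<exists>s>0. \<forall>S\<in>\<S>. \<forall>S'\<in>\<S>. S \<noteq> S' \<longrightarrow> msetdist X S S' \<ge> s * min (mdiam X S) (mdiam X S'))"

definition occur_on_all_locations_and_scales :: "'a metric \<Rightarrow> 'a set set \<Rightarrow> bool" where
  "occur_on_all_locations_and_scales X \<S> \<longleftrightarrow>
     (\<exists>c>0. \<forall>x\<in>mspace X. \<forall>r. 0 < r \<and> r \<le> mdiam X (mspace X) \<longrightarrow>
        (\<exists>S\<in>\<S>. S \<subseteq> mball_of X x r \<and> mdiam X S \<ge> c * r))"

end

theory Submission
  imports Defs
begin

text \<open>
  Let \<open>x\<close> be a boundary point and \<open>q\<close> a group element close to the point at distance \<open>t\<close> from the identity on a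
  geodesic towards \<open>x\<close>. The Gromov products of boundary points near \<open>x\<close> based at \<open>q\<close> and at the identity
  differ by \<open>t\<close> up to a bounded error, so the homeomorphism of the boundary induced by \<open>q\<^sup>-\<^sup>1\<close>
  blows up the ball of radius \<open>r = \<Lambda>\<^sup>-\<^sup>t\<close> around \<open>x\<close> to unit size, distorting ratios of distances by
  at most a constant factor. Homeomorphisms permute the peripheral circles, which correspond to the boundary squares of the
  standard carpet: they are pairwise disjoint, only finitely many of them exceed a given diameter, and every
  nonempty open set contains one. Hence bounded turning, relative separation and occurrence hold at unit size by
  compactness, and at every location and scale by blowing up.

  A doubling circle of bounded turning is a quasicircle by a construction of Tukia and Vaisala. Every arc is
  subdivided into a fixed number of subarcs of comparable diameter, the two extreme ones having exactly one
  sixth of the diameter of the whole arc, so that neighbouring pieces stay comparable across parents. Matching these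
  pieces with equal subintervals parametrizes the circle quasisymmetrically.
\<close>

section \<open>Quasisymmetric parametrization of circles with bounded turning\<close>

text \<open>A blow-up is bi-Lipschitz only on the ball it enlarges, so it must also be known that
  points outside that ball do not come back near the image of the centre. Without this, neither a
  connected set nor a whole circle found at unit size could be pulled back into the ball. At unit
  size compactness alone is not enough either: the constants are minima over circles, and they are
  positive because only finitely many circles have definite diameter. For the parametrization the
  obstacle is that one gauge has to serve all circles, so it is built from the turning constant
  \<open>k\<close> and the doubling number \<open>N\<close> only. A circle is unrolled to a
  1-periodic pseudometric on the line: arcs become intervals, and subdivisions become increasing
  sequences. If the ratio of neighbouring pieces with different parents were controlled only up to a
  factor, that factor would accumulate from level to level; equal proportions at both ends avoid
  this. The end pieces also serve as collars which keep the complementary arc large when bounded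
  turning is used to separate the cut points.\<close>

locale circle_pseudometric =
  fixes \<rho> :: "real \<Rightarrow> real \<Rightarrow> real"
  assumes commute: "\<rho> s t = \<rho> t s"
    and triangle: "\<rho> s u \<le> \<rho> s t + \<rho> t u"
    and nonneg: "0 \<le> \<rho> s t"
    and zero_iff: "\<rho> s t = 0 \<longleftrightarrow> s - t \<in> \<int>"
    and cont: "continuous_on UNIV (\<lambda>(s, t). \<rho> s t)"
begin

text \<open>The endpoints are parameters on the universal cover of the circle, so an interval of
  length at least 1 runs through the whole circle.\<close>

definition arc_diam :: "real \<Rightarrow> real \<Rightarrow> real" where
  "arc_diam s t = (SUP (u, v)\<in>{s..t} \<times> {s..t}. \<rho> u v)"

lemma shift_int: "i \<in> \<int> \<Longrightarrow> \<rho> (s + i) t = \<rho> s t" "i \<in> \<int> \<Longrightarrow> \<rho> s (t + i) = \<rho> s t"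
proof -
  show *: "\<rho> (s + i) t = \<rho> s t" if "i \<in> \<int>" for s t i
  proof -
    have "\<rho> (s + i) s = 0" "\<rho> s (s + i) = 0" using that by (auto simp: zero_iff)
    then show ?thesis using triangle[of s t "s + i"] triangle[of "s + i" t s] by simp
  qed
  then show "\<rho> s (t + i) = \<rho> s t" if "i \<in> \<int>"
    using that commute by metis
qed

lemma bdd: "bdd_above ((\<lambda>(u, v). \<rho> u v) ` ({s..t} \<times> {s..t}))"
  using compact_continuous_image[OF continuous_on_subset[OF cont] compact_Times[OF compact_Icc compact_Icc]]
  by (intro bounded_imp_bdd_above compact_imp_bounded) auto

lemma le_arc_diam: "u \<in> {s..t} \<Longrightarrow> v \<in> {s..t} \<Longrightarrow> \<rho> u v \<le> arc_diam s t"
  unfolding arc_diam_def using cSUP_upper[OF _ bdd, of "(u, v)"] by auto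

lemma arc_diam_le:
  "s \<le> t \<Longrightarrow> (\<And>u v. u \<in> {s..t} \<Longrightarrow> v \<in> {s..t} \<Longrightarrow> \<rho> u v \<le> b) \<Longrightarrow> arc_diam s t \<le> b"
  unfolding arc_diam_def by (rule cSUP_least) auto

lemma arc_diam_mono: "s' \<le> s \<Longrightarrow> s \<le> t \<Longrightarrow> t \<le> t' \<Longrightarrow> arc_diam s t \<le> arc_diam s' t'"
  by (rule arc_diam_le) (auto intro!: le_arc_diam)

lemma rho_self [simp]: "\<rho> s s = 0"
  by (simp add: zero_iff)

lemma arc_diam_self [simp]: "arc_diam s s = 0"
  by (simp add: arc_diam_def)

lemma arc_diam_nonneg: "s \<le> t \<Longrightarrow> 0 \<le> arc_diam s t"
  using le_arc_diam[of s s t s] by simp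

lemma arc_diam_pos: "s < t \<Longrightarrow> 0 < arc_diam s t"
proof -
  assume "s < t"
  \<comment> \<open>Capping the step at 1/2 keeps \<open>u - s\<close> strictly between 0 and 1, so
    \<open>u\<close> and \<open>s\<close> are different points of the circle even if the interval
    winds around it.\<close>
  define u where "u = min t (s + 1/2)"
  have "0 < u - s" "u - s < 1" using \<open>s < t\<close> by (auto simp: u_def)
  then have "u - s \<notin> \<int>" by (auto elim!: Ints_cases)
  then have "0 < \<rho> u s" using zero_iff nonneg by (metis less_eq_real_def)
  also have "\<dots> \<le> arc_diam s t" using \<open>s < t\<close> by (intro le_arc_diam) (auto simp: u_def)
  finally show ?thesis .
qed

lemma arc_diam_add: "s \<le> t \<Longrightarrow> t \<le> u \<Longrightarrow> arc_diam s u \<le> arc_diam s t + arc_diam t u"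
proof -
  assume st: "s \<le> t" "t \<le> u"
  have *: "\<rho> a b \<le> arc_diam s t + arc_diam t u" if "a \<in> {s..u}" "b \<in> {s..u}" "a \<le> b" for a b
  proof -
    consider "b \<le> t" | "t \<le> a" | "a \<le> t" "t \<le> b" by linarith
    then show ?thesis
    proof cases
      case 1
      then show ?thesis using that st le_arc_diam[of a s t b] arc_diam_nonneg[of t u] by simp
    next
      case 2
      then show ?thesis using that st le_arc_diam[of a t u b] arc_diam_nonneg[of s t] by simp
    next
      case 3
      then show ?thesis
        using that st le_arc_diam[of a s t t] le_arc_diam[of t t u b] triangle[of a b t] by simp
    qed
  qed
  then show ?thesis
    using st commute by (intro arc_diam_le) (auto, metis linorder_le_cases)
qed

lemma arc_diam_shift: "i \<in> \<int> \<Longrightarrow> arc_diam (s + i) (t + i) = arc_diam s t"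
proof -
  assume i: "i \<in> \<int>"
  have *: "arc_diam (s + i) (t + i) \<le> arc_diam s t" if "s \<le> t" "i \<in> \<int>" for s t i
  proof (rule arc_diam_le)
    fix u v assume "u \<in> {s + i..t + i}" "v \<in> {s + i..t + i}"
    then have "\<rho> (u - i) (v - i) \<le> arc_diam s t" by (intro le_arc_diam) auto
    then show "\<rho> u v \<le> arc_diam s t"
      using shift_int[of "-i"] that(2) by simp
  qed (use that in simp)
  show ?thesis
  proof (cases "s \<le> t")
    case True
    then show ?thesis using *[OF True i] *[of "s + i" "t + i" "-i"] i by (intro antisym) auto
  next
    case False
    then show ?thesis by (simp add: arc_diam_def)
  qed
qed

lemma le_arc_diam_all: "\<rho> s t \<le> arc_diam 0 1"
proof -
  have "\<rho> (frac s) (frac t) \<le> arc_diam 0 1"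
    by (intro le_arc_diam) (auto simp: less_imp_le frac_lt_1)
  moreover have "\<rho> (frac s) (frac t) = \<rho> (frac s + of_int \<lfloor>s\<rfloor>) (frac t + of_int \<lfloor>t\<rfloor>)"
    by (simp add: shift_int)
  ultimately show ?thesis by (simp add: frac_def)
qed

lemma arc_diam_le_all: "s \<le> t \<Longrightarrow> arc_diam s t \<le> arc_diam 0 1"
  using le_arc_diam_all by (intro arc_diam_le)

text \<open>This is continuity of \<open>\<rho>\<close> at a point of the diagonal. Combined with
  subadditivity and monotonicity it makes \<open>arc_diam\<close> continuous in either endpoint,
  which the cuts below rely on.\<close>

lemma arc_diam_small:
  assumes "e > 0"
  shows "\<exists>\<delta>>0. \<forall>u v. x - \<delta> < u \<and> u \<le> v \<and> v < x + \<delta> \<longrightarrow> arc_diam u v < e"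
proof -
  have "0 < e / 2" using assms by simp
  then have "\<exists>\<delta>>0. \<forall>p. dist p (x, x) < \<delta> \<longrightarrow> dist ((\<lambda>(s, t). \<rho> s t) p) ((\<lambda>(s, t). \<rho> s t) (x, x)) < e / 2"
    using cont unfolding continuous_on_iff by blast
  then obtain \<delta> where \<delta>: "\<delta> > 0" "\<And>p. dist p (x, x) < \<delta> \<Longrightarrow> dist ((\<lambda>(s, t). \<rho> s t) p) 0 < e / 2"
    by auto
  have *: "\<rho> a b < e / 2" if "\<bar>a - x\<bar> < \<delta> / 2" "\<bar>b - x\<bar> < \<delta> / 2" for a b
  proof -
    have "dist (a, b) (x, x) \<le> \<bar>a - x\<bar> + \<bar>b - x\<bar>"
      by (simp add: dist_Pair_Pair dist_real_def sqrt_sum_squares_le_sum_abs)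
    then show ?thesis using \<delta>(2)[of "(a, b)"] that by auto
  qed
  have "arc_diam u v < e" if "x - \<delta>/2 < u" "u \<le> v" "v < x + \<delta>/2" for u v
  proof -
    have "\<rho> a b \<le> e / 2" if "a \<in> {u..v}" "b \<in> {u..v}" for a b
      using that \<open>x - \<delta>/2 < u\<close> \<open>v < x + \<delta>/2\<close>
      by (intro less_imp_le *) (simp_all only: abs_less_iff atLeastAtMost_iff, linarith+)
    then have "arc_diam u v \<le> e / 2" using \<open>u \<le> v\<close> by (intro arc_diam_le) auto
    then show ?thesis using assms by simp
  qed
  then show ?thesis using \<delta>(1) by (intro exI[of _ "\<delta>/2"]) auto
qed

lemma continuous_arc_diam_right: "continuous_on {s..} (arc_diam s)"
  unfolding continuous_on_iff
proof (intro ballI allI impI)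
  fix x e :: real assume x: "x \<in> {s..}" and "0 < e"
  obtain \<delta> where \<delta>: "\<delta> > 0" "\<And>u v. x - \<delta> < u \<Longrightarrow> u \<le> v \<Longrightarrow> v < x + \<delta> \<Longrightarrow> arc_diam u v < e"
    using arc_diam_small[OF \<open>0 < e\<close>] by metis
  have "dist (arc_diam s y) (arc_diam s x) < e" if "y \<in> {s..}" "dist y x < \<delta>" for y
  proof (cases "y \<le> x")
    case True
    then show ?thesis
      using arc_diam_add[of s y x] arc_diam_mono[of s s y x] \<delta>(2)[of y x] that x \<delta>(1) by (simp add: dist_real_def)
  next
    case False
    then show ?thesis
      using arc_diam_add[of s x y] arc_diam_mono[of s s x y] \<delta>(2)[of x y] that x \<delta>(1) by (simp add: dist_real_def)
  qed
  then show "\<exists>d>0. \<forall>x'\<in>{s..}. dist x' x < d \<longrightarrow> dist (arc_diam s x') (arc_diam s x) < e"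
    using \<delta>(1) by blast
qed

lemma continuous_arc_diam_left: "continuous_on {..t} (\<lambda>s. arc_diam s t)"
  unfolding continuous_on_iff
proof (intro ballI allI impI)
  fix x e :: real assume x: "x \<in> {..t}" and "0 < e"
  obtain \<delta> where \<delta>: "\<delta> > 0" "\<And>u v. x - \<delta> < u \<Longrightarrow> u \<le> v \<Longrightarrow> v < x + \<delta> \<Longrightarrow> arc_diam u v < e"
    using arc_diam_small[OF \<open>0 < e\<close>] by metis
  have "dist (arc_diam y t) (arc_diam x t) < e" if "y \<in> {..t}" "dist y x < \<delta>" for y
  proof (cases "y \<le> x")
    case True
    then show ?thesis
      using arc_diam_add[of y x t] arc_diam_mono[of y x t t] \<delta>(2)[of y x] that x \<delta>(1) by (simp add: dist_real_def)
  next
    case False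
    then show ?thesis
      using arc_diam_add[of x y t] arc_diam_mono[of x y t t] \<delta>(2)[of x y] that x \<delta>(1) by (simp add: dist_real_def)
  qed
  then show "\<exists>d>0. \<forall>x'\<in>{..t}. dist x' x < d \<longrightarrow> dist (arc_diam x' t) (arc_diam x t) < e"
    using \<delta>(1) by blast
qed

section \<open>Cutting an arc into subarcs of prescribed diameter\<close>

lemma cut_right:
  assumes "s < t" "0 < e" "e < arc_diam s t"
  obtains u where "s < u" "u < t" "arc_diam s u = e"
proof -
  have "\<exists>u\<ge>s. u \<le> t \<and> arc_diam s u = e"
    using assms continuous_on_subset[OF continuous_arc_diam_right]
    by (intro IVT') auto
  then obtain u where u: "s \<le> u" "u \<le> t" "arc_diam s u = e" by blast
  then have "u \<noteq> s" "u \<noteq> t" using assms by auto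
  then show ?thesis using that[of u] u by auto
qed

lemma cut_left:
  assumes "s < t" "0 < e" "e < arc_diam s t"
  obtains u where "s < u" "u < t" "arc_diam u t = e"
proof -
  have "\<exists>u\<ge>s. u \<le> t \<and> arc_diam u t = e"
    using assms continuous_on_subset[OF continuous_arc_diam_left]
    by (intro IVT2') auto
  then obtain u where u: "s \<le> u" "u \<le> t" "arc_diam u t = e" by blast
  then have "u \<noteq> s" "u \<noteq> t" using assms by auto
  then show ?thesis using that[of u] u by auto
qed

text \<open>A relation, so that a subdivision into \<open>n\<close> consecutive subarcs is
  membership in the \<open>n\<close>-th relational power, and concatenation and refinement become
  composition.\<close>

definition arcs :: "real \<Rightarrow> real \<Rightarrow> (real \<times> real) set" where
  "arcs a b = {(s, t). s < t \<and> a \<le> arc_diam s t \<and> arc_diam s t \<le> b}"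

text \<open>By continuity the first subarc can be given diameter exactly \<open>a/2\<close>, and
  subadditivity leaves at least \<open>a/2\<close> for the second.\<close>

lemma arcs_refine:
  assumes "(s, t) \<in> arcs a b" "0 < a"
  shows "(s, t) \<in> arcs (a/2) b ^^ 2"
proof -
  have st: "s < t" "a \<le> arc_diam s t" "arc_diam s t \<le> b" using assms by (auto simp: arcs_def)
  then obtain u where u: "s < u" "u < t" "arc_diam s u = a/2"
    using cut_right[of s t "a/2"] assms(2) by auto
  have "a/2 \<le> arc_diam u t"
    using arc_diam_add[of s u t] u st by simp
  moreover have "arc_diam u t \<le> b" "arc_diam s u \<le> b"
    using arc_diam_mono[of s u t t] arc_diam_mono[of s s u t] u st by auto
  ultimately have "(s, u) \<in> arcs (a/2) b" "(u, t) \<in> arcs (a/2) b"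
    using u by (auto simp: arcs_def)
  then show ?thesis by (auto simp: numeral_2_eq_2)
qed

lemma arcs_mono: "a' \<le> a \<Longrightarrow> b \<le> b' \<Longrightarrow> arcs a b \<subseteq> arcs a' b'"
  by (auto simp: arcs_def)

lemma relpow_mono': "R \<subseteq> S \<Longrightarrow> R ^^ n \<subseteq> S ^^ n" for R S :: "('a \<times> 'a) set"
proof (induction n)
  case (Suc n)
  then have "R ^^ n O R \<subseteq> S ^^ n O S" by (intro relcomp_mono)
  then show ?case by simp
qed simp

lemma relpow_Suc_cases: "0 < n \<Longrightarrow> (x, z) \<in> R ^^ n \<Longrightarrow> \<exists>y. (x, y) \<in> R \<and> (y, z) \<in> R ^^ (n - 1)"
  using relpow_Suc_D2[of x z "n - 1" R] by auto

text \<open>Padding: links are added one at a time by halving the first link, and each halving costs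
  a factor 2 in the lower bound.\<close>

lemma arcs_relpow_extend:
  assumes "(s, t) \<in> arcs a b ^^ j" "0 < j" "0 < a"
  shows "(s, t) \<in> arcs (a / 2 ^ i) b ^^ (j + i)"
proof (induction i)
  case 0
  then show ?case using assms by simp
next
  case (Suc i)
  let ?a = "a / 2 ^ i"
  obtain u where u: "(s, u) \<in> arcs ?a b" "(u, t) \<in> arcs ?a b ^^ (j + i - 1)"
    using relpow_Suc_cases[OF _ Suc] assms(2) by auto
  have "(s, u) \<in> arcs (?a/2) b ^^ 2"
    using arcs_refine[OF u(1)] assms(3) by simp
  moreover have "0 < ?a" using assms(3) by simp
  then have "?a/2 \<le> ?a" by (metis half_gt_zero less_imp_le field_sum_of_halves less_add_same_cancel1)
  then have "(u, t) \<in> arcs (?a/2) b ^^ (j + i - 1)"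
    using relpow_mono'[OF arcs_mono] u(2) by blast
  ultimately have "(s, t) \<in> arcs (?a/2) b ^^ (2 + (j + i - 1))"
    by (auto simp only: relpow_add)
  moreover have "2 + (j + i - 1) = j + Suc i" "?a/2 = a / 2 ^ Suc i" using assms(2) by simp_all
  ultimately show ?case by (simp only:)
qed

lemma arcs_relpow_fun:
  assumes "\<forall>i<n. (f i, f (Suc i)) \<in> arcs a b" "i < j" "j \<le> n"
  shows "f i < f j" "a \<le> arc_diam (f i) (f j)"
proof -
  have *: "f i \<le> f j" if "i \<le> j" "j \<le> n" for i j
    using that(1,2)
  proof (induction rule: dec_induct)
    case (step m)
    then show ?case using assms(1)[rule_format, of m] by (auto simp: arcs_def)
  qed simp
  have "(f i, f (Suc i)) \<in> arcs a b" using assms by auto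
  then have 1: "f i < f (Suc i)" "a \<le> arc_diam (f i) (f (Suc i))" by (auto simp: arcs_def)
  have 2: "f (Suc i) \<le> f j" using *[of "Suc i" j] assms by simp
  show "f i < f j" "a \<le> arc_diam (f i) (f j)"
    using 1 2 arc_diam_mono[of "f i" "f i" "f (Suc i)" "f j"] by auto
qed

text \<open>A link of diameter above \<open>2 * e\<close> could be halved into two links of diameter
  at least \<open>e\<close>, against the maximality of the chain. Since \<open>b\<close> bounds all
  diameters, the first two assumptions restrict links only from below.\<close>

lemma arcs_relpow_cut:
  assumes st: "(s, t) \<in> arcs e b ^^ j" and max: "(s, t) \<notin> arcs e b ^^ Suc j" and "0 < e" and b: "\<And>u v. u \<le> v \<Longrightarrow> arc_diam u v \<le> b"
  shows "(s, t) \<in> arcs e (2 * e) ^^ j"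
proof -
  obtain f where f: "f 0 = s" "f j = t" "\<forall>i<j. (f i, f (Suc i)) \<in> arcs e b"
    using st relpow_fun_conv by metis
  have "(f i, f (Suc i)) \<in> arcs e (2 * e)" if i: "i < j" for i
  proof (rule ccontr)
    assume "(f i, f (Suc i)) \<notin> arcs e (2 * e)"
    moreover have fi: "f i < f (Suc i)" "e \<le> arc_diam (f i) (f (Suc i))" using f(3) i by (auto simp: arcs_def)
    ultimately have "2 * e < arc_diam (f i) (f (Suc i))" by (auto simp: arcs_def)
    then have "(f i, f (Suc i)) \<in> arcs (2 * e) b"
      using fi b[of "f i" "f (Suc i)"] by (auto simp: arcs_def)
    then have "(f i, f (Suc i)) \<in> arcs e b ^^ 2"
      using arcs_refine[of "f i" "f (Suc i)" "2 * e" b] \<open>0 < e\<close> by simp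
    moreover have "(f 0, f i) \<in> arcs e b ^^ i"
      unfolding relpow_fun_conv using f(3) i by (intro exI[of _ f]) auto
    moreover have "(f (Suc i), f j) \<in> arcs e b ^^ (j - Suc i)"
      unfolding relpow_fun_conv using f(3) i by (intro exI[of _ "\<lambda>l. f (Suc i + l)"]) auto
    ultimately have "(f 0, f j) \<in> arcs e b ^^ (i + (2 + (j - Suc i)))"
      by (auto simp only: relpow_add)
    moreover have "i + (2 + (j - Suc i)) = Suc j" using i by simp
    ultimately show False using max f by simp
  qed
  then show ?thesis unfolding relpow_fun_conv using f by blast
qed

end

text \<open>The separation \<open>R / (6 * k)\<close> is fitted to the subdivision step: in an arc
  of diameter \<open>R = 6 * e\<close>, bounded turning makes the cut points \<open>e / k\<close>
  apart.\<close>

locale quasicircle_pseudometric = circle_pseudometric +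
  fixes k :: real and N :: nat
  assumes k: "1 \<le> k" and N: "4 \<le> N"
    and turning: "s < t \<Longrightarrow> t < s + 1 \<Longrightarrow> min (arc_diam s t) (arc_diam t (s + 1)) \<le> k * \<rho> s t"
    and doubling: "finite F \<Longrightarrow> 0 < R \<Longrightarrow> (\<And>a b. a \<in> F \<Longrightarrow> b \<in> F \<Longrightarrow> \<rho> a b \<le> R) \<Longrightarrow>
      (\<And>a b. a \<in> F \<Longrightarrow> b \<in> F \<Longrightarrow> a \<noteq> b \<Longrightarrow> R / (6 * k) \<le> \<rho> a b) \<Longrightarrow> card F \<le> N"
begin

text \<open>\<open>N\<close> middle pieces and two end pieces. In \<open>c\<close> the 6 comes from
  measuring in sixths of the diameter, and \<open>2 ^ N\<close> pays for the padding of the middle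
  chain to exactly \<open>N\<close> links.\<close>

definition K :: nat where "K = N + 2"
definition c :: real where "c = 1 / (6 * 2 ^ N)"

definition is_split :: "real \<Rightarrow> real \<Rightarrow> (nat \<Rightarrow> real) \<Rightarrow> bool" where
  "is_split s t x \<longleftrightarrow> x 0 = s \<and> x K = t \<and>
     (\<forall>i<K. (x i, x (Suc i)) \<in> arcs (c * arc_diam s t) (arc_diam s t / 2)) \<and>
     arc_diam s (x 1) = arc_diam s t / 6 \<and> arc_diam (x (K - 1)) t = arc_diam s t / 6"

text \<open>Once the two end sixths are cut off, the middle is subdivided by a longest chain of
  links of diameter at least \<open>e\<close>. Doubling bounds its length, maximality bounds its
  links from above, and padding fixes the number of links.\<close>

lemma ex_split:
  assumes st: "s < t" "t \<le> s + 1"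
  shows "\<exists>x::nat \<Rightarrow> real. is_split s t x"
proof -
  let ?D = "arc_diam s t"
  define e where "e = ?D / 6"
  have D: "0 < ?D" "?D = 6 * e" using arc_diam_pos[OF st(1)] by (auto simp: e_def)
  then have e: "0 < e" by simp
  obtain s1 where s1: "s < s1" "s1 < t" "arc_diam s s1 = e"
    using cut_right[OF st(1), of e] e D by auto
  obtain t1 where t1: "s < t1" "t1 < t" "arc_diam t1 t = e"
    using cut_left[OF st(1), of e] e D by auto
  have "s1 < t1"
  proof (rule ccontr)
    assume "\<not> s1 < t1"
    then have "arc_diam s1 t \<le> e" using arc_diam_mono[of t1 s1 t t] s1 t1 by simp
    then show False using arc_diam_add[of s s1 t] s1 D by simp
  qed
  have mid: "4 * e \<le> arc_diam s1 t1"
    using arc_diam_add[of s s1 t] arc_diam_add[of s1 t1 t] s1 t1 \<open>s1 < t1\<close> D by simp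
  \<comment> \<open>No arc exceeds \<open>b\<close>, so \<open>P j\<close> bounds the links only
    from below.\<close>
  define b where "b = arc_diam 0 1"
  have b: "arc_diam u v \<le> b" if "u \<le> v" for u v
    using arc_diam_le_all that by (simp add: b_def)
  define P where "P j \<longleftrightarrow> (s1, t1) \<in> arcs e b ^^ j" for j
  have P_le: "j + 1 \<le> N" if Pj: "P j" for j
  proof -
    obtain f where f: "f 0 = s1" "f j = t1" "\<forall>i<j. (f i, f (Suc i)) \<in> arcs e b"
      using Pj unfolding P_def relpow_fun_conv by blast
    have f_le: "f i \<in> {s1..t1}" if "i \<le> j" for i
    proof -
      have "i = 0 \<or> f 0 < f i" "i = j \<or> f i < f j"
        using arcs_relpow_fun(1)[OF f(3)] that by (metis gr0I, metis order_refl le_neq_implies_less)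
      then show ?thesis using f(1,2) \<open>s1 < t1\<close> by auto
    qed
    have inj: "inj_on f {..j}"
      by (rule linorder_inj_onI) (auto dest: arcs_relpow_fun(1)[OF f(3)])
    have sep: "e / k \<le> \<rho> (f i) (f l)" if "i < l" "l \<le> j" for i l
    proof -
      have fil: "f i < f l" "e \<le> arc_diam (f i) (f l)"
        using arcs_relpow_fun[OF f(3) that] by auto
      have "f l \<le> t1" "s1 \<le> f i" using f_le that by auto
      \<comment> \<open>The complementary arc from \<open>f l\<close> to \<open>f i + 1\<close>
        contains the end sixth from \<open>t1\<close> to \<open>t\<close>, because
        \<open>t \<le> s + 1\<close>. Hence both arcs between the two cut points have diameter at
        least \<open>e\<close>, and bounded turning separates the points.\<close>
      then have "f l \<le> t1" "t \<le> f i + 1" "f l < f i + 1" using s1 t1 st by auto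
      then have "e \<le> arc_diam (f l) (f i + 1)"
        using arc_diam_mono[of "f l" t1 t "f i + 1"] t1 by simp
      then have "e \<le> k * \<rho> (f i) (f l)"
        using turning[OF fil(1) \<open>f l < f i + 1\<close>] fil(2) by simp
      then show ?thesis using k by (simp add: field_simps)
    qed
    have "card (f ` {..j}) \<le> N"
    proof (rule doubling[where R = "6 * e"])
      fix a b assume "a \<in> f ` {..j}" "b \<in> f ` {..j}"
      then have "a \<in> {s1..t1}" "b \<in> {s1..t1}" using f_le by auto
      then have "\<rho> a b \<le> arc_diam s t" using s1 t1 by (intro le_arc_diam) auto
      then show "\<rho> a b \<le> 6 * e" using D by simp
    next
      fix a b assume ab: "a \<in> f ` {..j}" "b \<in> f ` {..j}" "a \<noteq> b"
      then obtain i l where "i \<le> j" "l \<le> j" "a = f i" "b = f l" "i \<noteq> l" by auto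
      then show "6 * e / (6 * k) \<le> \<rho> a b"
        using sep[of i l] sep[of l i] commute[of a b] by (cases "i < l") auto
    qed (use e in auto)
    then show ?thesis by (simp add: card_image inj)
  qed
  have "P 1"
    using mid \<open>s1 < t1\<close> e b[of s1 t1] by (auto simp: P_def arcs_def)
  define j where "j = (GREATEST j. P j)"
  have Pj: "P j" and j_max: "\<And>i. P i \<Longrightarrow> i \<le> j"
  proof -
    have le: "\<And>i. P i \<Longrightarrow> i \<le> N" using P_le by fastforce
    show "P j" unfolding j_def using \<open>P 1\<close> le by (rule GreatestI_nat)
    show "\<And>i. P i \<Longrightarrow> i \<le> j" unfolding j_def using _ le by (rule Greatest_le_nat)
  qed
  have "1 \<le> j" using j_max[OF \<open>P 1\<close>] .
  have "\<not> P (Suc j)" using j_max[of "Suc j"] by auto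
  then have "(s1, t1) \<in> arcs e (2 * e) ^^ j"
    using arcs_relpow_cut[where s = s1 and t = t1 and e = e and b = b and j = j] Pj e b
    unfolding P_def by blast
  then have "(s1, t1) \<in> arcs (e / 2 ^ (N - j)) (2 * e) ^^ (j + (N - j))"
    using e \<open>1 \<le> j\<close> by (intro arcs_relpow_extend) simp_all
  moreover have "j + (N - j) = N" using P_le[OF Pj] by simp
  moreover have "e / 2 ^ N \<le> e / 2 ^ (N - j)"
    using e by (intro divide_left_mono power_increasing) auto
  then have "arcs (e / 2 ^ (N - j)) (2 * e) \<subseteq> arcs (e / 2 ^ N) (3 * e)"
    using e by (intro arcs_mono) auto
  ultimately have m: "(s1, t1) \<in> arcs (e / 2 ^ N) (3 * e) ^^ N"
    using relpow_mono' by (metis (no_types) subsetD)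
  obtain g where g: "g 0 = s1" "g N = t1" "\<forall>i<N. (g i, g (Suc i)) \<in> arcs (e / 2 ^ N) (3 * e)"
    using m relpow_fun_conv by metis
  \<comment> \<open>The chain \<open>g\<close> is shifted by one index to make room for
    \<open>s\<close>; the value \<open>t\<close> is reached at \<open>N + 2 = K\<close>.\<close>
  define x where "x i = (if i = 0 then s else if i \<le> N + 1 then g (i - 1) else t)" for i
  have le: "e / 2 ^ N \<le> e" using e by (simp add: divide_le_eq_1 divide_simps)
  have "is_split s t x"
    unfolding is_split_def
  proof (intro conjI allI impI)
    have x: "x 0 = s" "x (Suc 0) = s1" "x (N + 1) = t1" "x (Suc (N + 1)) = t" "K = Suc (N + 1)"
      using g by (simp_all add: x_def K_def)
    show "x 0 = s" "x K = t" "arc_diam s (x 1) = ?D / 6" "arc_diam (x (K - 1)) t = ?D / 6"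
      using s1(3) t1(3) x by (simp_all add: e_def)
    fix i assume "i < K"
    then have "i = 0 \<or> i = N + 1 \<or> 0 < i \<and> i < N + 1" unfolding K_def by linarith
    then consider "i = 0" | "i = N + 1" | "0 < i" "i < N + 1" by blast
    then have "(x i, x (Suc i)) \<in> arcs (e / 2 ^ N) (3 * e)"
    proof cases
      case 1
      then show ?thesis using x s1 e le by (simp add: arcs_def)
    next
      case 2
      then show ?thesis using x t1 e le by (simp add: arcs_def)
    next
      case 3
      then show ?thesis using g(3)[rule_format, of "i - 1"] by (simp add: x_def)
    qed
    moreover have "e / 2 ^ N = c * ?D" "3 * e = ?D / 2" using D by (auto simp: c_def)
    ultimately show "(x i, x (Suc i)) \<in> arcs (c * ?D) (?D / 2)" by simp
  qed
  then show ?thesis by blast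
qed


section \<open>The nested subdivisions of the line\<close>

definition split :: "real \<Rightarrow> real \<Rightarrow> nat \<Rightarrow> real" where
  "split s t = (SOME x. is_split s t x)"

lemma is_split: "s < t \<Longrightarrow> t \<le> s + 1 \<Longrightarrow> is_split s t (split s t)"
  unfolding split_def using someI_ex[OF ex_split] by blast

lemma is_split_shift:
  assumes "is_split s t x" "i \<in> \<int>"
  shows "is_split (s + i) (t + i) (\<lambda>j. x j + i)"
  using assms by (auto simp: is_split_def arc_diam_shift arcs_def)

text \<open>The choice made by \<open>split\<close> need not commute with integer translations.
  Normalizing by the integer part of \<open>s\<close> forces it to, which makes all subdivisions
  1-periodic (\<open>p_shift\<close>).\<close>

definition split' :: "real \<Rightarrow> real \<Rightarrow> nat \<Rightarrow> real" where
  "split' s t j = split (s - of_int \<lfloor>s\<rfloor>) (t - of_int \<lfloor>s\<rfloor>) j + of_int \<lfloor>s\<rfloor>"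

lemma is_split': "s < t \<Longrightarrow> t \<le> s + 1 \<Longrightarrow> is_split s t (split' s t)"
  using is_split_shift[OF is_split[of "s - of_int \<lfloor>s\<rfloor>" "t - of_int \<lfloor>s\<rfloor>"], of "of_int \<lfloor>s\<rfloor>"]
  unfolding split'_def[abs_def] by simp

lemma split'_shift: "split' (s + of_int i) (t + of_int i) j = split' s t j + of_int i"
  by (simp add: split'_def)

text \<open>Level \<open>n\<close> cuts every period into \<open>K ^ n\<close> pieces, numbered by
  all integers so that no end has to be treated separately. Quotient and remainder of
  \<open>m\<close> by \<open>K\<close> are the number of the parent piece and the position inside
  it.\<close>

primrec p :: "nat \<Rightarrow> int \<Rightarrow> real" where
  "p 0 m = of_int m"
| "p (Suc n) m = split' (p n (m div int K)) (p n (m div int K + 1)) (nat (m mod int K))"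

declare p.simps(2) [simp del]

lemma is_split_cong: "is_split s t x \<Longrightarrow> (\<And>j. j \<le> K \<Longrightarrow> x j = y j) \<Longrightarrow> is_split s t y"
  by (simp add: is_split_def K_def)

lemma K: "6 \<le> K" "0 < K"
  using N by (simp_all add: K_def)

lemma p_shift: "p n (m + int K ^ n * i) = p n m + of_int i"
proof (induction n arbitrary: m)
  case (Suc n)
  have *: "m + int K ^ Suc n * i = m + int K * (int K ^ n * i)" by simp
  have "(m + int K ^ Suc n * i) div int K = m div int K + int K ^ n * i"
    "(m + int K ^ Suc n * i) mod int K = m mod int K"
    unfolding * using K(2) by simp_all
  moreover have "m div int K + int K ^ n * i + 1 = m div int K + 1 + int K ^ n * i" by simp
  ultimately show ?case
    using Suc[of "m div int K"] Suc[of "m div int K + 1"] by (simp only: p.simps split'_shift)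
qed simp

text \<open>The premise is what \<open>p_step\<close> proves. It stays a premise because the
  induction for \<open>p_step\<close> uses \<open>p_le_aux\<close>, and with it this lemma, for the
  parent level.\<close>

lemma p_mono_aux: "(\<And>m. p n m < p n (m + 1)) \<Longrightarrow> i < j \<Longrightarrow> p n i < p n j"
proof -
  assume *: "\<And>m. p n m < p n (m + 1)"
  assume "i < j"
  then show "p n i < p n j"
  proof (induction rule: int_less_induct)
    case base
    then show ?case using *[of "j - 1"] by simp
  next
    case (step i)
    then show ?case using *[of "i - 1"] by simp
  qed
qed

lemma p_le_aux: "(\<And>m. p n m < p n (m + 1)) \<Longrightarrow> p n (m + 1) \<le> p n m + 1"
proof -
  assume *: "\<And>m. p n m < p n (m + 1)"
  have "m + 1 \<le> m + int K ^ n * 1" using K(2) by simp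
  then have "p n (m + 1) \<le> p n (m + int K ^ n * 1)"
    using p_mono_aux[OF *] by (metis order_le_less)
  then show ?thesis by (simp only: p_shift of_int_1)
qed

lemma p_child: "0 \<le> j \<Longrightarrow> j < int K \<Longrightarrow> p (Suc n) (int K * m + j) = split' (p n m) (p n (m + 1)) (nat j)"
  by (simp add: p.simps(2) div_add1_eq mod_add_eq)

lemma p_step: "p n m < p n (m + 1)"
proof (induction n arbitrary: m)
  case (Suc n)
  let ?i = "m div int K" and ?j = "m mod int K"
  let ?x = "split' (p n ?i) (p n (?i + 1))"
  have j: "0 \<le> ?j" "?j < int K" using K(2) by simp_all
  have x: "is_split (p n ?i) (p n (?i + 1)) ?x"
    using Suc p_le_aux[OF Suc] by (intro is_split')
  then have lt: "?x (nat ?j) < ?x (Suc (nat ?j))"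
    using j by (auto simp: is_split_def arcs_def nat_less_iff)
  have m: "m = int K * ?i + ?j" by simp
  show ?case
  proof (cases "?j = int K - 1")
    case True
    \<comment> \<open>The successor of the last child belongs to the next parent, whose first point
      is the right endpoint of the present one.\<close>
    have "m + 1 = int K * (?i + 1) + 0" using m True by (simp add: algebra_simps)
    then have "p (Suc n) (m + 1) = split' (p n (?i + 1)) (p n (?i + 1 + 1)) 0"
      using p_child[of 0 n "?i + 1"] K(2) by simp
    also have "\<dots> = p n (?i + 1)"
      using is_split'[OF Suc[of "?i + 1"] p_le_aux[OF Suc]] by (simp add: is_split_def)
    also have "\<dots> = ?x (Suc (nat ?j))"
      using x True K(2) by (simp add: is_split_def Suc_nat_eq_nat_zadd1)
    finally show ?thesis using lt by (simp add: p.simps(2))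
  next
    case False
    have "p (Suc n) (m + 1) = p (Suc n) (int K * ?i + (?j + 1))" using m by (simp add: algebra_simps)
    also have "\<dots> = ?x (nat (?j + 1))" using j False by (intro p_child) auto
    also have "nat (?j + 1) = Suc (nat ?j)" using j by simp
    finally show ?thesis using lt by (simp add: p.simps(2))
  qed
qed simp

lemmas p_less = p_mono_aux[OF p_step]
lemmas p_step_le = p_le_aux[OF p_step]

lemma p_mono: "i \<le> j \<Longrightarrow> p n i \<le> p n j"
  using p_less[of i j n] by (cases "i = j") auto

lemma p_split: "is_split (p n m) (p n (m + 1)) (\<lambda>j. p (Suc n) (int K * m + int j))"
proof -
  let ?x = "split' (p n m) (p n (m + 1))"
  have x: "is_split (p n m) (p n (m + 1)) ?x"
    using p_step p_step_le by (intro is_split')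
  have "p (Suc n) (int K * m + int j) = ?x j" if "j \<le> K" for j
  proof (cases "j = K")
    case True
    have "p (Suc n) (int K * (m + 1) + 0) = split' (p n (m + 1)) (p n (m + 1 + 1)) (nat 0)"
      using K(2) by (intro p_child) auto
    also have "\<dots> = p n (m + 1)"
      using is_split'[OF p_step[of n "m + 1"] p_step_le] by (simp add: is_split_def)
    also have "\<dots> = ?x j" using x True by (simp add: is_split_def)
    finally show ?thesis using True by (simp add: algebra_simps)
  next
    case False
    then show ?thesis using p_child[of "int j" n m] that by simp
  qed
  then show ?thesis using is_split_cong[OF x] by simp
qed

lemma p_refine: "p (Suc n) (int K * m) = p n m"
  using p_split[of n m] by (simp add: is_split_def)

section \<open>Diameters of the pieces\<close>

definition piece :: "nat \<Rightarrow> int \<Rightarrow> real" where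
  "piece n m = arc_diam (p n m) (p n (m + 1))"

lemma piece_pos: "0 < piece n m"
  unfolding piece_def by (intro arc_diam_pos p_step)

lemma piece_child:
  "c * piece n (m div int K) \<le> piece (Suc n) m" "piece (Suc n) m \<le> piece n (m div int K) / 2"
proof -
  let ?i = "m div int K" and ?j = "nat (m mod int K)"
  have "?j < K" using K(2) by (simp add: nat_less_iff)
  then have "(p (Suc n) (int K * ?i + int ?j), p (Suc n) (int K * ?i + int (Suc ?j)))
      \<in> arcs (c * piece n ?i) (piece n ?i / 2)"
    using p_split[of n ?i] unfolding is_split_def piece_def by blast
  moreover have "int K * ?i + int ?j = m" "int K * ?i + int (Suc ?j) = m + 1"
  proof -
    have j: "int ?j = m mod int K" using K(2) by simp
    show "int K * ?i + int ?j = m" unfolding j by simp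
    then show "int K * ?i + int (Suc ?j) = m + 1" by simp
  qed
  ultimately have "(p (Suc n) m, p (Suc n) (m + 1)) \<in> arcs (c * piece n ?i) (piece n ?i / 2)"
    by (simp only:)
  then show "c * piece n ?i \<le> piece (Suc n) m" "piece (Suc n) m \<le> piece n ?i / 2"
    by (auto simp: arcs_def piece_def)
qed

lemma piece_first: "piece (Suc n) (int K * m) = piece n m / 6"
  using p_split[of n m] unfolding piece_def is_split_def by simp

lemma piece_last: "piece (Suc n) (int K * m - 1) = piece n (m - 1) / 6"
proof -
  have "int K * (m - 1) + int (K - 1) = int K * m - 1" "int K * (m - 1) + int K = int K * m - 1 + 1"
    using K(2) by (simp_all add: algebra_simps of_nat_diff)
  note eqs = this
  show ?thesis
    using p_split[of n "m - 1"] p_refine[of n m] unfolding piece_def is_split_def eqs by simp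
qed

text \<open>Siblings have between \<open>c\<close> and 1/2 times the diameter of their parent, so
  this bounds their ratio.\<close>

definition C :: real where "C = 1 / c"

lemma c: "0 < c" "c \<le> 1/2" "1 \<le> C" "0 < C"
proof -
  show "0 < c" by (simp add: c_def)
  have "(1::real) \<le> 2 ^ N" by simp
  then have "1 / (6 * 2 ^ N) \<le> 1 / (6 * 1::real)" by (intro divide_left_mono) auto
  then show "c \<le> 1/2" unfolding c_def by linarith
  then show "1 \<le> C" "0 < C" using \<open>0 < c\<close> by (auto simp: C_def field_simps)
qed

lemma piece_0: "piece 0 m = arc_diam 0 1"
  using arc_diam_shift[of "of_int m" 0 1] by (simp add: piece_def add.commute)

text \<open>Neighbouring pieces with different parents are an extreme left and an extreme right child,
  so their ratio is inherited unchanged from the parents.\<close>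

lemma piece_neighbour: "piece n m \<le> C * piece n (m + 1) \<and> piece n (m + 1) \<le> C * piece n m"
proof (induction n arbitrary: m)
  case 0
  then show ?case using arc_diam_nonneg[of 0 1] c mult_right_mono[of 1 C "arc_diam 0 1"] by (simp add: piece_0)
next
  case (Suc n)
  show ?case
  proof (cases "int K dvd m + 1")
    case True
    then obtain i where i: "m + 1 = int K * i" by blast
    then have "piece (Suc n) (m + 1) = piece n i / 6" "piece (Suc n) m = piece n (i - 1) / 6"
      using piece_first[of n i] piece_last[of n i] by (simp_all flip: i)
    note eqs = this
    show ?thesis unfolding eqs using Suc[of "i - 1"] by simp
  next
    case False
    have "(m + 1) div int K = m div int K"
    proof -
      have m: "m = m mod int K + m div int K * int K" by simp
      have j: "0 \<le> m mod int K" "m mod int K < int K" using K(2) by simp_all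
      have "m mod int K \<noteq> int K - 1"
      proof
        assume "m mod int K = int K - 1"
        then have "m + 1 = int K + m div int K * int K" using m by linarith
        then have "m + 1 = int K * (m div int K + 1)" by (simp add: algebra_simps)
        then show False using False by (metis dvd_triv_left)
      qed
      then have "(m mod int K + 1) div int K = 0" using j by (intro div_pos_pos_trivial) auto
      moreover have "m + 1 = (m mod int K + 1) + m div int K * int K" using m by linarith
      ultimately show ?thesis using K(2) by (metis add.right_neutral div_mult_self3 add.commute of_nat_0_eq_iff less_irrefl)
    qed
    then have "c * piece n (m div int K) \<le> piece (Suc n) m" "piece (Suc n) m \<le> piece n (m div int K) / 2"
      "c * piece n (m div int K) \<le> piece (Suc n) (m + 1)" "piece (Suc n) (m + 1) \<le> piece n (m div int K) / 2"
      using piece_child[of n m] piece_child[of n "m + 1"] by auto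
    moreover have "piece n (m div int K) / 2 \<le> C * (c * piece n (m div int K))"
      using c(1) piece_pos[of n "m div int K"] by (simp add: C_def)
    ultimately show ?thesis
      using mult_left_mono[of "c * piece n (m div int K)" _ C] c(4) by (meson less_imp_le order_trans)
  qed
qed

lemma piece_le: "piece n m \<le> arc_diam 0 1 / 2 ^ n"
proof (induction n arbitrary: m)
  case (Suc n)
  have "piece (Suc n) m \<le> piece n (m div int K) / 2" by (rule piece_child)
  also have "\<dots> \<le> arc_diam 0 1 / 2 ^ n / 2" using Suc by (rule divide_right_mono) simp
  finally show ?case by (simp add: mult.commute)
qed (simp add: piece_0)

section \<open>The parametrization matching equal intervals with pieces\<close>

abbreviation index :: "nat \<Rightarrow> real \<Rightarrow> int" where
  "index n x \<equiv> \<lfloor>x * real K ^ n\<rfloor>"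

lemma index_Suc: "index (Suc n) x div int K = index n x"
proof -
  have "index n x = \<lfloor>(x * real K ^ Suc n) / real_of_int (int K)\<rfloor>" using K(2) by simp
  also have "\<dots> = index (Suc n) x div int K" by (rule floor_divide_real_eq_div) simp
  finally show ?thesis by simp
qed

lemma nested: "p n (index n x) \<le> p (Suc n) (index (Suc n) x)"
  "p (Suc n) (index (Suc n) x + 1) \<le> p n (index n x + 1)"
proof -
  let ?i = "index n x" and ?m = "index (Suc n) x"
  have m: "?m = int K * ?i + ?m mod int K" by (metis index_Suc mult_div_mod_eq)
  have j: "0 \<le> ?m mod int K" "?m mod int K < int K" using K(2) by simp_all
  have "int K * ?i \<le> ?m" "?m + 1 \<le> int K * (?i + 1)" using m j by (simp_all add: algebra_simps)
  then show "p n ?i \<le> p (Suc n) ?m" "p (Suc n) (?m + 1) \<le> p n (?i + 1)"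
    using p_mono p_refine by metis+
qed

text \<open>At every level \<open>y\<close> lies in the piece carrying the number of the
  \<open>K\<close>-adic interval of \<open>x\<close>. The pieces are closed, so the nested
  intersection is nonempty, and their diameters tend to 0, so it is a single point.\<close>

definition locates :: "real \<Rightarrow> real \<Rightarrow> bool" where
  "locates x y \<longleftrightarrow> (\<forall>n. p n (index n x) \<le> y \<and> y \<le> p n (index n x + 1))"

lemma ex_locates: "\<exists>y. locates x y"
proof -
  let ?l = "\<lambda>n. p n (index n x)" and ?u = "\<lambda>n. p n (index n x + 1)"
  have l: "incseq ?l" and u: "decseq ?u" using nested by (auto intro!: incseq_SucI decseq_SucI)
  have lu: "?l m \<le> ?u n" for m n
  proof -
    have "?l m \<le> ?l (max m n)" "?u (max m n) \<le> ?u n"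
      using l u by (auto simp: incseq_def decseq_def)
    then show ?thesis using p_step[of "max m n" "index (max m n) x"] by linarith
  qed
  then have b: "bdd_above (range ?l)" by (intro bdd_aboveI2)
  show ?thesis
    unfolding locates_def using lu cSUP_upper[OF _ b] cSUP_least[of UNIV ?l] by (intro exI[of _ "SUP n. ?l n"]) auto
qed

lemma locates_unique: "locates x y \<Longrightarrow> locates x z \<Longrightarrow> y = z"
proof (induction y z rule: linorder_wlog)
  case (le y z)
  show ?case
  proof (rule ccontr)
    assume "y \<noteq> z"
    then have "0 < arc_diam y z" using le by (intro arc_diam_pos) auto
    then obtain n where n: "(1/2) ^ n < arc_diam y z / arc_diam 0 1"
      using arc_diam_pos[of 0 1] real_arch_pow_inv[of "arc_diam y z / arc_diam 0 1" "1/2"] by auto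
    have "arc_diam y z \<le> piece n (index n x)"
      using le unfolding piece_def locates_def by (intro arc_diam_mono) auto
    also have "\<dots> \<le> arc_diam 0 1 / 2 ^ n" by (rule piece_le)
    finally show False using n arc_diam_pos[of 0 1] by (simp add: field_simps power_divide)
  qed
qed auto

definition \<theta> :: "real \<Rightarrow> real" where "\<theta> x = (SOME y. locates x y)"

lemma locates_theta: "locates x (\<theta> x)"
  unfolding \<theta>_def using ex_locates by (rule someI_ex)

lemma theta_ge: "p n (index n x) \<le> \<theta> x" and theta_le: "\<theta> x \<le> p n (index n x + 1)"
  using locates_theta unfolding locates_def by blast+

lemma theta_shift: "\<theta> (x + of_int i) = \<theta> x + of_int i"
proof -
  have "index n (x + of_int i) = index n x + int K ^ n * i" for n
  proof -
    have "(x + of_int i) * real K ^ n = x * real K ^ n + of_int (int K ^ n * i)" by (simp add: algebra_simps)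
    then show ?thesis by (metis floor_add_int)
  qed
  moreover have "p n (a + int K ^ n * i + 1) = p n (a + 1) + of_int i" for a n
    using p_shift[of n "a + 1" i] by (simp add: algebra_simps)
  ultimately have "locates (x + of_int i) (\<theta> x + of_int i)"
    unfolding locates_def using theta_ge theta_le by (simp add: p_shift)
  then show ?thesis using locates_unique locates_theta by blast
qed

text \<open>Density of the image; surjectivity onto the circle follows from it later because the
  image is compact.\<close>

lemma theta_dense: "\<exists>x. \<rho> (\<theta> x) y \<le> arc_diam 0 1 / 2 ^ n"
proof -
  obtain m where m: "p n m \<le> y" "y \<le> p n (m + 1)"
  proof -
    have up: "p n (int K ^ n * i) = p n 0 + of_int i" for i using p_shift[of n 0 i] by simp
    define lo where "lo = int K ^ n * \<lfloor>y - p n 0\<rfloor>"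
    have lo: "p n lo \<le> y" unfolding lo_def up by linarith
    define hi where "hi = int K ^ n * (\<lfloor>y - p n 0\<rfloor> + 1)"
    have hi: "y < p n hi" unfolding hi_def up by linarith
    have "lo < hi" using lo hi p_mono[of hi lo n] by linarith
    then have "\<exists>m\<ge>lo. m < hi \<and> p n m \<le> y \<and> y \<le> p n (m + 1)"
      using lo
    proof (induction rule: int_less_induct)
      case base
      then show ?case using hi by (intro exI[of _ "hi - 1"]) auto
    next
      case (step i)
      show ?case
      proof (cases "p n i \<le> y")
        case True
        then obtain m where "i \<le> m" "m < hi" "p n m \<le> y" "y \<le> p n (m + 1)" using step by blast
        then show ?thesis by (intro exI[of _ m]) auto
      next
        case False
        then show ?thesis using step by (intro exI[of _ "i - 1"]) auto
      qed
    qed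
    then show ?thesis using that by blast
  qed
  define x where "x = real_of_int m / real K ^ n"
  have ix: "index n x = m" using K(2) by (simp add: x_def)
  have "\<rho> (\<theta> x) y \<le> piece n m"
    unfolding piece_def using m theta_ge[of n x] theta_le[of x n] ix by (intro le_arc_diam) auto
  also have "piece n m \<le> arc_diam 0 1 / 2 ^ n" by (rule piece_le)
  finally show ?thesis by blast
qed

section \<open>Distance estimates and the quasisymmetry gauge\<close>

lemma dist_theta_le:
  assumes "\<bar>index n x - index n y\<bar> \<le> 1"
  shows "\<rho> (\<theta> x) (\<theta> y) \<le> (1 + C) * piece n (index n x)"
proof -
  let ?i = "index n x" and ?j = "index n y"
  have x: "\<theta> x \<in> {p n ?i..p n (?i + 1)}" and y: "\<theta> y \<in> {p n ?j..p n (?j + 1)}"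
    using theta_ge theta_le by auto
  have 1: "piece n ?i \<le> (1 + C) * piece n ?i"
    using c piece_pos[of n ?i] by simp
  have q: "0 \<le> C * piece n ?i" using c piece_pos[of n ?i] by simp
  have p3: "p n (?i - 1) \<le> p n ?i" "p n ?i \<le> p n (?i + 1)" "p n (?i + 1) \<le> p n (?i + 2)" by (auto intro: p_mono)
  consider "?j = ?i" | "?j = ?i + 1" | "?j = ?i - 1" using assms by linarith
  then show ?thesis
  proof cases
    case 1
    then have "\<rho> (\<theta> x) (\<theta> y) \<le> piece n ?i"
      using le_arc_diam[OF x, of "\<theta> y"] y by (simp add: piece_def)
    then show ?thesis using q by (simp add: algebra_simps)
  next
    case 2
    have "\<rho> (\<theta> x) (\<theta> y) \<le> arc_diam (p n ?i) (p n (?i + 2))"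
      using x y 2 p3 by (intro le_arc_diam) (auto simp: algebra_simps)
    also have "\<dots> \<le> piece n ?i + piece n (?i + 1)"
      using arc_diam_add[OF p3(2,3)] by (simp add: piece_def algebra_simps)
    also have "\<dots> \<le> piece n ?i + C * piece n ?i" using piece_neighbour by simp
    finally show ?thesis by (simp add: algebra_simps)
  next
    case 3
    have "\<rho> (\<theta> x) (\<theta> y) \<le> arc_diam (p n (?i - 1)) (p n (?i + 1))"
      using x y 3 p3 by (intro le_arc_diam) (auto simp: algebra_simps)
    also have "\<dots> \<le> piece n (?i - 1) + piece n ?i"
      using arc_diam_add[OF p3(1,2)] by (simp add: piece_def algebra_simps)
    also have "\<dots> \<le> C * piece n ?i + piece n ?i" using piece_neighbour[of n "?i - 1"] by simp
    finally show ?thesis by (simp add: algebra_simps)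
  qed
qed

text \<open>With a full piece between them on both sides, the two points are joined by two large
  arcs: one contains the pieces \<open>?i + 1\<close> and \<open>?j - 1\<close>, the other
  \<open>?j + 1\<close> and a translate of \<open>?i - 1\<close>. Bounded turning turns this into a
  lower bound for the distance. The disjunction about \<open>B\<close> allows either point to be the
  reference point.\<close>

lemma dist_theta_ge_aux:
  assumes n: "1 \<le> n" and xy: "x < y" "y \<le> x + 1/2" "index n x + 2 \<le> index n y"
    and B: "B \<le> piece n (index n x + 1) \<and> B \<le> piece n (index n x - 1) \<or>
      B \<le> piece n (index n y + 1) \<and> B \<le> piece n (index n y - 1)"
  shows "B \<le> k * \<rho> (\<theta> x) (\<theta> y)"
proof -
  let ?i = "index n x" and ?j = "index n y" and ?K = "int K ^ n"
  have x: "p n ?i \<le> \<theta> x" "\<theta> x \<le> p n (?i + 1)" and y: "p n ?j \<le> \<theta> y" "\<theta> y \<le> p n (?j + 1)"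
    using theta_ge theta_le by auto
  \<comment> \<open>Half a period then has at least 3 intervals of level \<open>n\<close>, so from
    \<open>y \<le> x + 1/2\<close> the way back from \<open>y\<close> to \<open>x + 1\<close> also
    contains full pieces.\<close>
  have K6: "6 \<le> real K ^ n"
  proof -
    have "6 \<le> real K" using K(1) by simp
    moreover from this have "real K ^ 1 \<le> real K ^ n" using n by (intro power_increasing) auto
    ultimately show ?thesis unfolding power_one_right by (rule order_trans)
  qed
  have "?j \<le> y * real K ^ n" "x * real K ^ n < ?i + 1" by linarith+
  moreover have "y * real K ^ n \<le> (x + 1/2) * real K ^ n" using xy by (intro mult_right_mono) auto
  moreover have "(x + 1/2) * real K ^ n = x * real K ^ n + real K ^ n / 2" by (simp add: algebra_simps)
  ultimately have "real_of_int ?j < ?i + 1 + real K ^ n / 2" by linarith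
  then have "real_of_int ?j + 2 < ?i + real K ^ n" using K6 by linarith
  then have "real_of_int (?j + 2) < real_of_int (?i + ?K)" by simp
  then have ji: "?j + 2 \<le> ?i + ?K" by linarith
  have sh: "p n (?i + ?K) = p n ?i + 1" "p n (?j + 1) \<le> p n (?i + ?K - 1)" "p n (?j + 2) \<le> p n (?i + ?K)"
  proof -
    show "p n (?i + ?K) = p n ?i + 1" using p_shift[of n ?i 1] by simp
    show "p n (?j + 1) \<le> p n (?i + ?K - 1)" "p n (?j + 2) \<le> p n (?i + ?K)" using ji by (simp_all add: p_mono)
  qed
  have lt: "\<theta> x < \<theta> y"
    using x y xy p_less[of "?i + 1" ?j n] by linarith
  have lt1: "\<theta> y < \<theta> x + 1"
    using x y sh p_less[of "?j + 1" "?i + ?K" n] ji by linarith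
  have "piece n (?i + 1) \<le> arc_diam (\<theta> x) (\<theta> y)"
    unfolding piece_def using x y xy p_mono[of "?i + 1 + 1" ?j n] p_step[of n "?i + 1"] by (intro arc_diam_mono) auto
  moreover have "piece n (?j - 1) \<le> arc_diam (\<theta> x) (\<theta> y)"
    unfolding piece_def using x y xy p_mono[of "?i + 1" "?j - 1" n] p_step[of n "?j - 1"]
    by (intro arc_diam_mono) auto
  moreover have "piece n (?j + 1) \<le> arc_diam (\<theta> y) (\<theta> x + 1)"
    unfolding piece_def using x y sh p_step[of n "?j + 1"] by (intro arc_diam_mono) (auto simp: algebra_simps)
  moreover have "piece n (?i - 1) \<le> arc_diam (\<theta> y) (\<theta> x + 1)"
  proof -
    have "piece n (?i - 1) = piece n (?i + ?K - 1)"
      unfolding piece_def using p_shift[of n "?i - 1" 1] p_shift[of n ?i 1] arc_diam_shift[of 1 "p n (?i - 1)" "p n ?i"]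
      by (simp add: algebra_simps)
    also have "\<dots> \<le> arc_diam (\<theta> y) (\<theta> x + 1)"
      unfolding piece_def using x y sh p_step[of n "?i + ?K - 1"] by (intro arc_diam_mono) auto
    finally show ?thesis .
  qed
  ultimately have "B \<le> min (arc_diam (\<theta> x) (\<theta> y)) (arc_diam (\<theta> y) (\<theta> x + 1))"
    using B by auto
  then show ?thesis using turning[OF lt lt1] by linarith
qed

lemma dist_theta_ge:
  assumes "1 \<le> n" "\<bar>x - y\<bar> \<le> 1/2" "2 \<le> \<bar>index n x - index n y\<bar>"
  shows "piece n (index n x) \<le> k * C * \<rho> (\<theta> x) (\<theta> y)"
proof -
  let ?i = "index n x"
  have B: "piece n ?i / C \<le> piece n (?i + 1)" "piece n ?i / C \<le> piece n (?i - 1)"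
    using piece_neighbour[of n ?i] piece_neighbour[of n "?i - 1"] c(4) by (auto simp: field_simps)
  consider "index n x + 2 \<le> index n y" | "index n y + 2 \<le> index n x" using assms(3) by linarith
  then have "piece n ?i / C \<le> k * \<rho> (\<theta> x) (\<theta> y)"
  proof cases
    case 1
    have "x < y"
    proof (rule ccontr)
      assume "\<not> x < y"
      then have "y * real K ^ n \<le> x * real K ^ n" by (intro mult_right_mono) auto
      then show False using 1 by linarith
    qed
    moreover have "y \<le> x + 1/2" using assms(2) by linarith
    ultimately show ?thesis
      using assms(1) 1 B by (intro dist_theta_ge_aux[of n]) auto
  next
    case 2
    have "y < x"
    proof (rule ccontr)
      assume "\<not> y < x"
      then have "x * real K ^ n \<le> y * real K ^ n" by (intro mult_right_mono) auto
      then show False using 2 by linarith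
    qed
    moreover have "x \<le> y + 1/2" using assms(2) by linarith
    ultimately have "piece n ?i / C \<le> k * \<rho> (\<theta> y) (\<theta> x)"
      using assms(1) 2 B by (intro dist_theta_ge_aux[of n]) auto
    then show ?thesis by (simp only: commute)
  qed
  then show ?thesis using c(4) by (simp add: field_simps)
qed


text \<open>\<open>Suc n\<close> is the first level at which the two indices differ by at least 2.
  The level before it gives the upper bounds, this level gives the lower ones.\<close>

lemma level:
  assumes "0 < \<bar>x - y\<bar>" "\<bar>x - y\<bar> \<le> 1/2"
  obtains n where "\<bar>x - y\<bar> \<le> 2 / real K ^ n" "\<rho> (\<theta> x) (\<theta> y) \<le> (1 + C) * piece n (index n x)"
    "1 / real K ^ Suc n \<le> \<bar>x - y\<bar>" "piece (Suc n) (index (Suc n) x) \<le> k * C * \<rho> (\<theta> x) (\<theta> y)"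
proof -
  have K1: "1 < real K" using K(1) by simp
  have gap: "\<bar>x - y\<bar> * real K ^ n < \<bar>index n x - index n y\<bar> + 1" for n
  proof -
    have "\<bar>x - y\<bar> * real K ^ n = \<bar>x * real K ^ n - y * real K ^ n\<bar>"
      by (simp add: abs_mult flip: left_diff_distrib)
    also have "\<dots> < \<bar>index n x - index n y\<bar> + 1" by linarith
    finally show ?thesis .
  qed
  have gap': "\<bar>index n x - index n y\<bar> \<le> \<bar>x - y\<bar> * real K ^ n + 1" for n
  proof -
    have "\<bar>x - y\<bar> * real K ^ n = \<bar>x * real K ^ n - y * real K ^ n\<bar>"
      by (simp add: abs_mult flip: left_diff_distrib)
    also have "\<bar>index n x - index n y\<bar> \<le> \<bar>x * real K ^ n - y * real K ^ n\<bar> + 1" by linarith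
    finally show ?thesis by simp
  qed
  let ?P = "\<lambda>n. 2 \<le> \<bar>index n x - index n y\<bar>"
  obtain n where "3 / \<bar>x - y\<bar> < real K ^ n" using real_arch_pow[OF K1] by blast
  then have "3 < \<bar>x - y\<bar> * real K ^ n" using assms(1) by (simp add: field_simps)
  then have "?P n" using gap[of n] by linarith
  define m where "m = (LEAST n. ?P n)"
  have Pm: "?P m" unfolding m_def using \<open>?P n\<close> by (rule LeastI)
  have "\<not> ?P 0"
  proof
    assume "?P 0"
    then have "2 \<le> real_of_int \<bar>index 0 x - index 0 y\<bar>" by linarith
    also have "\<dots> \<le> \<bar>x - y\<bar> + 1" using gap'[of 0] by simp
    finally show False using assms(2) by simp
  qed
  then have "m \<noteq> 0" using Pm by metis
  then obtain n where m: "m = Suc n" using not0_implies_Suc by blast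
  then have "\<not> ?P n" unfolding m_def by (intro not_less_Least) simp
  then have le: "\<bar>index n x - index n y\<bar> \<le> 1" by linarith
  show ?thesis
  proof (rule that)
    have "\<bar>x - y\<bar> * real K ^ n \<le> 2" using gap[of n] le by linarith
    then show "\<bar>x - y\<bar> \<le> 2 / real K ^ n" using K(2) by (simp add: field_simps)
    show "\<rho> (\<theta> x) (\<theta> y) \<le> (1 + C) * piece n (index n x)" using le by (rule dist_theta_le)
    have "1 \<le> \<bar>x - y\<bar> * real K ^ Suc n" using gap'[of m] Pm unfolding m by linarith
    then show "1 / real K ^ Suc n \<le> \<bar>x - y\<bar>"
      using K(2) by (subst pos_divide_le_eq) auto
    show "piece (Suc n) (index (Suc n) x) \<le> k * C * \<rho> (\<theta> x) (\<theta> y)"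
      using Pm assms(2) m by (intro dist_theta_ge) auto
  qed
qed

lemma piece_index_decay: "piece (m + i) (index (m + i) x) \<le> piece m (index m x) / 2 ^ i"
proof (induction i)
  case (Suc i)
  have "piece (m + Suc i) (index (m + Suc i) x) \<le> piece (m + i) (index (m + i) x) / 2"
    using piece_child(2)[of "m + i" "index (Suc (m + i)) x"] unfolding index_Suc by simp
  also have "\<dots> \<le> piece m (index m x) / 2 ^ i / 2" using Suc by (rule divide_right_mono) simp
  finally show ?case by (simp add: mult.commute)
qed simp

lemma piece_index_decay': "c ^ i * piece m (index m x) \<le> piece (m + i) (index (m + i) x)"
proof (induction i)
  case (Suc i)
  then have "c ^ Suc i * piece m (index m x) \<le> c * piece (m + i) (index (m + i) x)" using c(1) by simp
  also have "\<dots> \<le> piece (m + Suc i) (index (m + Suc i) x)"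
    using piece_child(1)[of "m + i" "index (Suc (m + i)) x"] unfolding index_Suc by simp
  finally show ?case .
qed simp

text \<open>One level shrinks parameters by \<open>1 / K\<close> and diameters by a factor between
  \<open>c\<close> and 1/2. The two exponents are the logarithms to base \<open>K\<close> of the
  reciprocals of the extreme factors.\<close>

definition s1 :: real where "s1 = ln 2 / ln (real K)"
definition s2 :: real where "s2 = ln (1 / c) / ln (real K)"

text \<open>If \<open>level\<close> yields \<open>m\<close> for the numerator and \<open>n\<close>
  for the denominator of a ratio \<open>t\<close>, then
  \<open>K ^ Suc n / K ^ m \<le> 2 * K ^ 2 * t\<close>. The power \<open>s1\<close> covers the case
  where this quotient of powers is at most 1, \<open>s2\<close> the case where it is at least 1. The
  constant in front collects the factors of the two distance estimates.\<close>

definition \<eta> :: "real \<Rightarrow> real" where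
  "\<eta> t = (1 + C) * (k * C) * ((2 * real K ^ 2 * t) powr s1 + (2 * real K ^ 2 * t) powr s2)"

lemma s_pos: "0 < s1" "0 < s2" and s_eq: "(real K ^ i) powr s1 = 2 ^ i" "(real K ^ i) powr s2 = (1 / c) ^ i"
proof -
  have lK: "0 < ln (real K)" using K(1) by simp
  moreover have "0 < ln (1 / c)" using c by (intro ln_gt_zero) (auto simp: field_simps)
  ultimately show "0 < s1" "0 < s2" by (auto simp: s1_def s2_def)
  have "real K powr s1 = 2" "real K powr s2 = 1 / c"
    using K(2) lK c(1) by (auto simp: s1_def s2_def powr_def)
  moreover have "(real K ^ i) powr s = (real K powr s) ^ i" for s
    using K(2) by (simp add: powr_realpow[symmetric] powr_powr powr_power mult.commute)
  ultimately show "(real K ^ i) powr s1 = 2 ^ i" "(real K ^ i) powr s2 = (1 / c) ^ i" by simp_all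
qed

lemma theta_quasisymmetric:
  assumes "\<bar>x - y\<bar> \<le> 1/2" "0 < \<bar>x - z\<bar>" "\<bar>x - z\<bar> \<le> 1/2"
  shows "\<rho> (\<theta> x) (\<theta> y) / \<rho> (\<theta> x) (\<theta> z) \<le> \<eta> (\<bar>x - y\<bar> / \<bar>x - z\<bar>)"
proof (cases "x = y")
  case True
  then show ?thesis by (simp add: \<eta>_def)
next
  case False
  let ?g = "\<lambda>n. piece n (index n x)"
  let ?t = "\<bar>x - y\<bar> / \<bar>x - z\<bar>"
  let ?T = "2 * real K ^ 2 * ?t"
  obtain m where m: "\<rho> (\<theta> x) (\<theta> y) \<le> (1 + C) * ?g m" "1 / real K ^ Suc m \<le> \<bar>x - y\<bar>"
    using level[of x y] False assms by auto
  obtain n where n: "\<bar>x - z\<bar> \<le> 2 / real K ^ n" "?g (Suc n) \<le> k * C * \<rho> (\<theta> x) (\<theta> z)"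
    using level[of x z] assms by auto
  have kC: "0 < k * C" "0 < 1 + C" using k c by auto
  have g: "0 < ?g i" for i by (rule piece_pos)
  have \<rho>z: "0 < \<rho> (\<theta> x) (\<theta> z)"
    using n(2) g[of "Suc n"] kC by (metis less_le_trans zero_less_mult_pos)
  have Kp: "0 < real K ^ i" for i using K(2) by simp
  have "(1 / real K ^ Suc m) / (2 / real K ^ n) \<le> ?t"
    using m(2) n(1) assms Kp by (intro frac_le) auto
  then have "2 * real K ^ 2 * ((1 / real K ^ Suc m) / (2 / real K ^ n)) \<le> ?T"
    by (intro mult_left_mono) auto
  moreover have "2 * real K ^ 2 * ((1 / real K ^ Suc m) / (2 / real K ^ n)) = real K ^ Suc n / real K ^ m"
    using Kp K(2) by (simp add: power2_eq_square field_simps)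
  ultimately have T: "real K ^ Suc n / real K ^ m \<le> ?T" by simp
  \<comment> \<open>Both pieces belong to the nested sequence of the same point \<open>x\<close>, so
    their ratio is governed by the number of levels between them.\<close>
  have "?g m / ?g (Suc n) \<le> ?T powr s1 + ?T powr s2"
  proof (cases "Suc n \<le> m")
    case True
    then obtain i where i: "m = Suc n + i" using le_Suc_ex by blast
    have "?g m / ?g (Suc n) \<le> 1 / 2 ^ i"
      using piece_index_decay[of "Suc n" i x] g[of "Suc n"] unfolding i by (simp add: field_simps)
    also have "\<dots> = (1 / real K ^ i) powr s1"
      using Kp[of i] s_eq(1)[of i] by (simp add: powr_divide)
    also have "\<dots> \<le> ?T powr s1"
    proof (rule powr_mono2)
      have "real K ^ m = real K ^ Suc n * real K ^ i" unfolding i power_add ..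
      then have "1 / real K ^ i = real K ^ Suc n / real K ^ m"
        using Kp[of i] Kp[of "Suc n"] K(2) by (simp only: divide_simps) simp
      then show "1 / real K ^ i \<le> ?T" using T by simp
    qed (use s_pos Kp in auto)
    finally show ?thesis by (simp add: add_increasing2)
  next
    case False
    then obtain i where i: "Suc n = m + i" using le_Suc_ex by (metis nat_le_linear)
    have "?g m / ?g (Suc n) \<le> (1 / c) ^ i"
      using piece_index_decay'[of i m x] g[of "Suc n"] c(1) unfolding i by (simp add: field_simps)
    also have "\<dots> = (real K ^ i) powr s2" by (simp add: s_eq)
    also have "\<dots> \<le> ?T powr s2"
    proof (rule powr_mono2)
      have "real K ^ Suc n = real K ^ m * real K ^ i" unfolding i power_add ..
      then have "real K ^ i = real K ^ Suc n / real K ^ m" using Kp[of m] by simp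
      then show "real K ^ i \<le> ?T" using T by simp
    qed (use s_pos Kp in auto)
    finally show ?thesis by (simp add: add_increasing)
  qed
  have "\<rho> (\<theta> x) (\<theta> y) / \<rho> (\<theta> x) (\<theta> z) \<le> ((1 + C) * ?g m) / (?g (Suc n) / (k * C))"
  proof (rule frac_le)
    show "0 \<le> (1 + C) * ?g m" using kC(2) g[of m] by simp
    show "0 < ?g (Suc n) / (k * C)" using kC(1) g[of "Suc n"] by (rule divide_pos_pos[rotated])
    show "?g (Suc n) / (k * C) \<le> \<rho> (\<theta> x) (\<theta> z)"
      using n(2) kC(1) by (simp only: pos_divide_le_eq mult.commute)
  qed (rule m(1))
  also have "\<dots> = (1 + C) * (k * C) * (?g m / ?g (Suc n))" by simp
  also have "\<dots> \<le> \<eta> ?t"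
    unfolding \<eta>_def using \<open>?g m / ?g (Suc n) \<le> _\<close> kC by (intro mult_left_mono) auto
  finally show ?thesis .
qed

lemma theta_continuity: "\<bar>x - y\<bar> \<le> 1 / real K ^ n \<Longrightarrow> \<rho> (\<theta> x) (\<theta> y) \<le> (1 + C) * arc_diam 0 1 / 2 ^ n"
proof -
  assume "\<bar>x - y\<bar> \<le> 1 / real K ^ n"
  then have "\<bar>x - y\<bar> * real K ^ n \<le> 1" using K(2) by (simp add: field_simps)
  then have "\<bar>x * real K ^ n - y * real K ^ n\<bar> \<le> 1"
    by (simp add: abs_mult flip: left_diff_distrib)
  then have "\<bar>index n x - index n y\<bar> \<le> 1" by linarith
  then have "\<rho> (\<theta> x) (\<theta> y) \<le> (1 + C) * piece n (index n x)" by (rule dist_theta_le)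
  also have "\<dots> \<le> (1 + C) * (arc_diam 0 1 / 2 ^ n)" using piece_le c by (intro mult_left_mono) auto
  finally show ?thesis by simp
qed

lemma theta_separated:
  assumes "0 < \<bar>x - y\<bar>" "\<bar>x - y\<bar> \<le> 1/2"
  shows "0 < \<rho> (\<theta> x) (\<theta> y)"
proof -
  obtain n where "piece (Suc n) (index (Suc n) x) \<le> k * C * \<rho> (\<theta> x) (\<theta> y)"
    using level[OF assms] by blast
  moreover have "0 < k * C" using k c by auto
  ultimately show ?thesis using piece_pos[of "Suc n" "index (Suc n) x"] by (metis less_le_trans zero_less_mult_pos)
qed

end

section \<open>Arcs and circles\<close>

lemma openin_mtopology_of:
  "openin (mtopology_of m) U \<longleftrightarrow> U \<subseteq> mspace m \<and> (\<forall>x\<in>U. \<exists>r>0. mball_of m x r \<subseteq> U)"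
  by (simp add: mtopology_of_def mball_of_def Metric_space.openin_mtopology) blast

lemma Hausdorff_space_mtopology_of: "Hausdorff_space (mtopology_of m)"
  by (simp add: mtopology_of_def Metric_space.Hausdorff_space_mtopology)

lemma mdist_self: "x \<in> mspace m \<Longrightarrow> mdist m x x = 0"
  by simp

lemma continuous_map_mtopology_of:
  "continuous_map (mtopology_of m) (mtopology_of m') f \<longleftrightarrow> f \<in> mspace m \<rightarrow> mspace m' \<and>
    (\<forall>x\<in>mspace m. \<forall>\<epsilon>>0. \<exists>\<delta>>0. \<forall>y\<in>mspace m. mdist m x y < \<delta> \<longrightarrow> mdist m' (f x) (f y) < \<epsilon>)"
proof (intro iffI conjI ballI allI impI)
  assume f: "continuous_map (mtopology_of m) (mtopology_of m') f"
  then show fm: "f \<in> mspace m \<rightarrow> mspace m'" by (auto simp: continuous_map_def)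
  fix x \<epsilon> assume x: "x \<in> mspace m" and \<epsilon>: "0 < (\<epsilon>::real)"
  have "openin (mtopology_of m') (mball_of m' (f x) \<epsilon>)"
    by (simp add: mtopology_of_def mball_of_def Metric_space.openin_mball)
  then have "openin (mtopology_of m) {y \<in> mspace m. f y \<in> mball_of m' (f x) \<epsilon>}"
    using f unfolding continuous_map topspace_mtopology_of by blast
  moreover have "x \<in> {y \<in> mspace m. f y \<in> mball_of m' (f x) \<epsilon>}"
    using x fm \<epsilon> by (auto simp: Pi_iff mdist_self)
  ultimately obtain \<delta> where "0 < \<delta>" "mball_of m x \<delta> \<subseteq> {y \<in> mspace m. f y \<in> mball_of m' (f x) \<epsilon>}"
    unfolding openin_mtopology_of by blast
  then show "\<exists>\<delta>>0. \<forall>y\<in>mspace m. mdist m x y < \<delta> \<longrightarrow> mdist m' (f x) (f y) < \<epsilon>"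
    using x by (intro exI[of _ \<delta>]) auto
next
  assume *: "f \<in> mspace m \<rightarrow> mspace m' \<and>
    (\<forall>x\<in>mspace m. \<forall>\<epsilon>>0. \<exists>\<delta>>0. \<forall>y\<in>mspace m. mdist m x y < \<delta> \<longrightarrow> mdist m' (f x) (f y) < \<epsilon>)"
  have "openin (mtopology_of m) {x \<in> mspace m. f x \<in> U}" if U: "openin (mtopology_of m') U" for U
    unfolding openin_mtopology_of
  proof (intro conjI ballI)
    fix x assume x: "x \<in> {x \<in> mspace m. f x \<in> U}"
    then obtain \<epsilon> where \<epsilon>: "0 < \<epsilon>" "mball_of m' (f x) \<epsilon> \<subseteq> U" using U unfolding openin_mtopology_of by blast
    then obtain \<delta> where \<delta>: "0 < \<delta>" "\<And>y. y \<in> mspace m \<Longrightarrow> mdist m x y < \<delta> \<Longrightarrow> mdist m' (f x) (f y) < \<epsilon>"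
      using * x by blast
    have "mball_of m x \<delta> \<subseteq> {x \<in> mspace m. f x \<in> U}"
    proof
      fix y assume "y \<in> mball_of m x \<delta>"
      then have y: "y \<in> mspace m" "mdist m' (f x) (f y) < \<epsilon>" using \<delta> by auto
      then have "f y \<in> mball_of m' (f x) \<epsilon>" using * x by auto
      then show "y \<in> {x \<in> mspace m. f x \<in> U}" using \<epsilon> y by blast
    qed
    then show "\<exists>r>0. mball_of m x r \<subseteq> {x \<in> mspace m. f x \<in> U}" using \<delta> by blast
  qed auto
  then show "continuous_map (mtopology_of m) (mtopology_of m') f"
    using * unfolding continuous_map topspace_mtopology_of by auto
qed

section \<open>The unit circle as a quotient of the line\<close>

lemma half_le_sin: "0 \<le> x \<Longrightarrow> x \<le> pi / 3 \<Longrightarrow> x / 2 \<le> sin x"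
proof (cases "x = 0")
  case False
  assume "0 \<le> x" "x \<le> pi / 3"
  then obtain z where z: "0 < z" "z < x" "sin x - sin 0 = (x - 0) * cos z"
    using MVT2[of 0 x sin cos] False by (auto intro!: derivative_eq_intros)
  have "cos (pi / 3) \<le> cos z" using z \<open>x \<le> pi / 3\<close> by (intro cos_monotone_0_pi_le) auto
  then have "1/2 \<le> cos z" by (simp add: cos_60)
  then have "x * (1/2) \<le> x * cos z" using \<open>0 \<le> x\<close> by (intro mult_left_mono) auto
  then show ?thesis using z by simp
qed simp

lemma dist_cis: "dist (cis x) (cis y) = 2 * \<bar>sin ((x - y) / 2)\<bar>"
proof -
  have "cis x - cis y = cis y * (cis (x - y) - 1)" by (simp add: algebra_simps cis_mult)
  then have "dist (cis x) (cis y) = norm (cis (x - y) - 1)" by (simp add: dist_norm norm_mult)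
  then show ?thesis using dist_exp_i_1[of "x - y"] by (simp add: cis_conv_exp)
qed

abbreviation ecis :: "real \<Rightarrow> complex" where "ecis t \<equiv> cis (2 * pi * t)"

lemma dist_ecis:
  assumes "\<bar>s - t\<bar> \<le> 1/2"
  shows "\<bar>s - t\<bar> \<le> dist (ecis s) (ecis t)" "dist (ecis s) (ecis t) \<le> 2 * pi * \<bar>s - t\<bar>"
proof -
  have eq: "dist (ecis s) (ecis t) = 2 * \<bar>sin (pi * \<bar>s - t\<bar>)\<bar>"
  proof (cases "s \<le> t")
    case True
    have "2 * pi * s - 2 * pi * t = 2 * (- (pi * \<bar>s - t\<bar>))" using True by (simp add: algebra_simps)
    then have "(2 * pi * s - 2 * pi * t) / 2 = - (pi * \<bar>s - t\<bar>)" by simp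
    then show ?thesis by (simp only: dist_cis) simp
  next
    case False
    have "2 * pi * s - 2 * pi * t = 2 * (pi * \<bar>s - t\<bar>)" using False by (simp add: algebra_simps)
    then have "(2 * pi * s - 2 * pi * t) / 2 = pi * \<bar>s - t\<bar>" by simp
    then show ?thesis by (simp only: dist_cis)
  qed
  define u where "u = \<bar>s - t\<bar>"
  have u: "0 \<le> u" "u \<le> 1/2" using assms by (auto simp: u_def)
  have "\<bar>sin (pi * u)\<bar> \<le> \<bar>pi * u\<bar>" by (rule abs_sin_x_le_abs_x)
  then show "dist (ecis s) (ecis t) \<le> 2 * pi * \<bar>s - t\<bar>" using eq u by (simp add: u_def)
  \<comment> \<open>Halving the angle brings it into the range where \<open>half_le_sin\<close>
    holds and the cosine is at least 1/2; the double angle formula then bounds the sine of the full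
    angle.\<close>
  have "pi * u / 2 \<le> pi / 3" using u by simp
  then have 1: "pi * u / 2 / 2 \<le> sin (pi * u / 2)" using u by (intro half_le_sin) auto
  have "cos (pi / 3) \<le> cos (pi * u / 2)" using u by (intro cos_monotone_0_pi_le) auto
  then have 2: "1/2 \<le> cos (pi * u / 2)" by (simp add: cos_60)
  have "sin (pi * u) = 2 * sin (pi * u / 2) * cos (pi * u / 2)" using sin_double[of "pi * u / 2"] by simp
  also have "\<dots> \<ge> 2 * (pi * u / 2 / 2) * (1/2)"
  proof (intro mult_mono)
    have "0 \<le> pi * u / 2 / 2" using u by simp
    with 1 show "0 \<le> 2 * sin (pi * u / 2)" by linarith
  qed (use 1 2 u in auto)
  finally have "2 * sin (pi * u) \<ge> pi / 2 * u" by simp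
  moreover have "1 * u \<le> pi / 2 * u" using u pi_ge_two by (intro mult_right_mono) auto
  ultimately have "u \<le> 2 * sin (pi * u)" by simp
  also have "\<dots> \<le> 2 * \<bar>sin (pi * u)\<bar>" by simp
  finally show "\<bar>s - t\<bar> \<le> dist (ecis s) (ecis t)" by (simp only: eq u_def)
qed

lemma ecis_eq_iff: "ecis s = ecis t \<longleftrightarrow> s - t \<in> \<int>"
proof -
  have "ecis s = ecis t \<longleftrightarrow> (\<exists>n::int. 2 * pi * s = 2 * pi * t + 2 * pi * of_int n)"
    using sin_cos_eq_iff[of "2 * pi * s" "2 * pi * t"] by (auto simp: complex_eq_iff)
  also have "\<dots> \<longleftrightarrow> (\<exists>n::int. s - t = of_int n)"
  proof -
    have "2 * pi * s = 2 * pi * t + 2 * pi * of_int n \<longleftrightarrow> s - t = of_int n" for n :: int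
    proof -
      have "2 * pi * s = 2 * pi * t + 2 * pi * of_int n \<longleftrightarrow> 2 * pi * s = 2 * pi * (t + of_int n)"
        by (simp add: distrib_left)
      then show ?thesis by auto
    qed
    then show ?thesis by simp
  qed
  finally show ?thesis by (auto simp: Ints_def)
qed

lemma ecis_surj: "z \<in> sphere 0 1 \<Longrightarrow> ecis (Arg z / (2 * pi)) = z"
  by (auto simp: cis_Arg_unique sgn_eq intro!: cis_Arg[THEN trans])

text \<open>Lifts within 1/2 of each other are the ones to which \<open>dist_ecis\<close> and the
  estimates for \<open>\<theta>\<close> apply.\<close>

lemma ecis_lift: "\<exists>t. ecis t = ecis u \<and> \<bar>s - t\<bar> \<le> 1/2"
proof -
  have "\<bar>s - (u + of_int (round (s - u)))\<bar> \<le> 1/2" using of_int_round_abs_le[of "s - u"] by linarith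
  moreover have "ecis (u + of_int (round (s - u))) = ecis u" by (subst ecis_eq_iff) simp
  ultimately show ?thesis by blast
qed

text \<open>The function below vanishes exactly at \<open>ecis a\<close> and \<open>ecis b\<close> and separates the two open arcs between them.\<close>

lemma connected_contains_arc:
  assumes E: "connected E" "E \<subseteq> sphere 0 1" "ecis s \<in> E" "ecis t \<in> E" and st: "s < t" "t < s + 1"
  shows "ecis ` {s..t} \<subseteq> E \<or> ecis ` {t..s+1} \<subseteq> E"
proof (rule ccontr)
  assume "\<not> ?thesis"
  then obtain a b where a: "a \<in> {s..t}" "ecis a \<notin> E" and b: "b \<in> {t..s+1}" "ecis b \<notin> E" by blast
  have "ecis (s + 1) = ecis s" by (subst ecis_eq_iff) simp
  then have ab: "s < a" "a < t" "t < b" "b < s + 1"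
    using a b E(3,4) by (auto simp: less_le)
  define h where "h z = cos (pi * (b - a)) - Re (z * cis (- pi * (a + b)))" for z
  have h: "h (ecis x) = 2 * sin (pi * (x - a)) * sin (pi * (x - b))" for x
  proof -
    have "Re (ecis x * cis (- pi * (a + b))) = cos (pi * (x - a) + pi * (x - b))"
      by (simp add: cis_mult algebra_simps)
    moreover have "cos (pi * (b - a)) = cos (pi * (x - a) - pi * (x - b))" by (simp add: algebra_simps)
    ultimately show ?thesis unfolding h_def by (simp only: cos_add cos_diff)
  qed
  have "h (ecis t) < 0"
  proof -
    have "0 < sin (pi * (t - a))" using ab by (intro sin_gt_zero) (auto simp: )
    moreover have "0 < sin (pi * (b - t))" using ab by (intro sin_gt_zero) (auto simp: )
    moreover have "sin (pi * (t - b)) = - sin (pi * (b - t))" by (metis minus_diff_eq mult_minus_right sin_minus)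
    ultimately show ?thesis unfolding h by (simp add: mult_pos_pos)
  qed
  moreover have "0 < h (ecis s)"
  proof -
    have "0 < sin (pi * (a - s))" using ab by (intro sin_gt_zero) (auto simp: )
    moreover have "0 < sin (pi * (b - s))" using ab by (intro sin_gt_zero) (auto simp: )
    moreover have "sin (pi * (s - b)) = - sin (pi * (b - s))" "sin (pi * (s - a)) = - sin (pi * (a - s))"
      by (metis minus_diff_eq mult_minus_right sin_minus)+
    ultimately show ?thesis unfolding h by (simp add: mult_pos_pos)
  qed
  moreover have "connected (h ` E)"
    using E(1) unfolding h_def by (intro connected_continuous_image) (auto intro!: continuous_intros)
  ultimately have "0 \<in> h ` E"
    using E(3,4) connected_contains_Icc[of "h ` E" "h (ecis t)" "h (ecis s)"] by auto
  then obtain z where z: "z \<in> E" "h z = 0" by auto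
  define x where "x = Arg z / (2 * pi)"
  have x: "ecis x = z" unfolding x_def using z(1) E(2) by (intro ecis_surj) auto
  then have "sin (pi * (x - a)) = 0 \<or> sin (pi * (x - b)) = 0" using z h[of x] by simp
  then have "x - a \<in> \<int> \<or> x - b \<in> \<int>"
    by (auto simp: sin_zero_iff_int2 Ints_def)
  then have "z = ecis a \<or> z = ecis b" using x ecis_eq_iff by metis
  then show False using z a b by auto
qed

lemma homeo_halfline_powr:
  assumes "0 < A" "0 < B" "0 < p" "0 < q"
  shows "homeo_halfline (\<lambda>t. A * ((B * t) powr p + (B * t) powr q))" (is "homeo_halfline ?h")
proof -
  have mono: "?h s < ?h t" if "0 \<le> s" "s < t" for s t
    using assms that by (intro mult_strict_left_mono add_strict_mono powr_less_mono2) auto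
  have cont: "continuous_on {0..} ?h"
    using assms by (intro continuous_intros continuous_on_powr') auto
  have inj: "inj_on ?h {0..}"
    using mono by (intro linorder_inj_onI) (force simp: less_imp_neq)+
  have surj: "?h ` {0..} = {0..}"
  proof (intro equalityI subsetI)
    fix y assume "y \<in> ?h ` {0..}"
    then show "y \<in> {0..}" using assms by auto
  next
    fix y :: real assume y: "y \<in> {0..}"
    \<comment> \<open>At this point the first summand alone takes the value
      \<open>y\<close>.\<close>
    define u where "u = (y / A) powr (1 / p) / B"
    have "(B * u) powr p = y / A" using y assms by (simp add: u_def powr_powr)
    then have "y \<le> ?h u" using assms by (simp add: distrib_left)
    moreover have "?h 0 \<le> y" using y assms by simp
    moreover have "0 \<le> u" using assms by (simp add: u_def)
    ultimately have "\<exists>x\<ge>0. x \<le> u \<and> ?h x = y"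
      using continuous_on_subset[OF cont, of "{0..u}"] by (intro IVT') auto
    then show "y \<in> ?h ` {0..}" by auto
  qed
  have "path_connected {0::real..}" by (intro convex_imp_path_connected) auto
  then obtain g where "homeomorphism {0..} (?h ` {0..}) ?h g"
    using injective_into_1d_eq_homeomorphism[OF cont] inj by blast
  then have "homeomorphism {0..} {0..} ?h g" by (simp add: surj)
  then have "homeomorphic_maps (top_of_set {0..}) (top_of_set {0..}) ?h g"
    by (force simp: homeomorphism_def homeomorphic_maps_def)
  then show ?thesis unfolding homeo_halfline_def homeomorphic_map_maps by blast
qed


text \<open>Connected subsets stand in for subarcs. They are preserved by homeomorphisms without
  reference to a parametrization, and on a circle \<open>connected_contains_arc\<close> recovers an
  arc from them.\<close>

definition bounded_turning :: "'a metric \<Rightarrow> real \<Rightarrow> 'a set \<Rightarrow> bool" where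
  "bounded_turning m k S \<longleftrightarrow> (\<forall>x\<in>S. \<forall>y\<in>S. \<exists>E\<subseteq>S. connectedin (mtopology_of m) E \<and> x \<in> E \<and> y \<in> E \<and>
     (\<forall>u\<in>E. \<forall>v\<in>E. mdist m u v \<le> k * mdist m x y))"

text \<open>Doubling expressed by separated sets at one fixed ratio \<open>q\<close>; in this form
  it passes to subsets and survives blow-ups.\<close>

definition separated_card_le :: "'a metric \<Rightarrow> real \<Rightarrow> nat \<Rightarrow> 'a set \<Rightarrow> bool" where
  "separated_card_le m q N S \<longleftrightarrow> (\<forall>F R. finite F \<and> F \<subseteq> S \<and> 0 < R \<and> (\<forall>a\<in>F. \<forall>b\<in>F. mdist m a b \<le> R) \<and>
     (\<forall>a\<in>F. \<forall>b\<in>F. a \<noteq> b \<longrightarrow> R / q \<le> mdist m a b) \<longrightarrow> card F \<le> N)"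


lemma (in quasicircle_pseudometric) eta_mono: "0 \<le> s \<Longrightarrow> s \<le> t \<Longrightarrow> \<eta> s \<le> \<eta> t"
proof -
  assume st: "0 \<le> s" "s \<le> t"
  have "0 < 1 + C" "0 < k * C" using c(4) k by auto
  then have "0 \<le> (1 + C) * (k * C)" by (simp add: less_imp_le)
  moreover have st: "2 * real K ^ 2 * s \<le> 2 * real K ^ 2 * t" "0 \<le> 2 * real K ^ 2 * s"
    using st by (simp_all add: mult_left_mono)
  have "(2 * real K ^ 2 * s) powr s1 \<le> (2 * real K ^ 2 * t) powr s1"
    using s_pos(1) st by (intro powr_mono2) auto
  moreover have "(2 * real K ^ 2 * s) powr s2 \<le> (2 * real K ^ 2 * t) powr s2"
    using s_pos(2) st by (intro powr_mono2) auto
  ultimately show ?thesis unfolding \<eta>_def by (intro mult_left_mono add_mono)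
qed

text \<open>The exported gauge has only \<open>k\<close> and \<open>N\<close> as parameters, so it
  does not depend on the circle. The pseudometric is exported too, because an instance of the locale
  is what makes facts about the gauge available. It is the metric pulled back along
  \<open>ecis\<close> followed by a homeomorphism onto \<open>S\<close>.\<close>

lemma quasicircle_parametrization_aux:
  assumes k: "1 \<le> k" and N: "4 \<le> N" and S: "S \<subseteq> mspace m"
    and hom: "subtopology (mtopology_of m) S homeomorphic_space top_of_set (sphere (0::complex) 1)"
    and turn: "bounded_turning m k S" and doub: "separated_card_le m (6 * k) N S"
  shows "\<exists>\<rho> f. quasicircle_pseudometric \<rho> k N \<and>
    quasisymmetric (\<lambda>t. quasicircle_pseudometric.\<eta> k N (2 * pi * t))
      (submetric euclidean_metric (sphere (0::complex) 1)) (submetric m S) f"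
proof -
  let ?T = "subtopology (mtopology_of m) S" and ?C = "top_of_set (sphere (0::complex) 1)"

  have "?C homeomorphic_space ?T" using hom homeomorphic_space_sym by blast
  then obtain \<psi> where \<psi>: "homeomorphic_map ?C ?T \<psi>"
    unfolding homeomorphic_space by blast
  have tS: "topspace ?T = S" using S by auto
  have \<psi>_inj: "inj_on \<psi> (sphere 0 1)" and \<psi>_im: "\<psi> ` sphere 0 1 = S"
    using homeomorphic_imp_injective_map[OF \<psi>] homeomorphic_imp_surjective_map[OF \<psi>] tS by auto
  define \<phi> where "\<phi> t = \<psi> (ecis t)" for t
  have \<phi>_S: "\<phi> t \<in> S" for t using \<psi>_im by (auto simp: \<phi>_def)
  then have \<phi>_m: "\<phi> t \<in> mspace m" for t using S by auto
  have \<phi>_eq: "\<phi> s = \<phi> t \<longleftrightarrow> s - t \<in> \<int>" for s t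
    using inj_on_eq_iff[OF \<psi>_inj, of "ecis s" "ecis t"] by (simp add: \<phi>_def ecis_eq_iff)
  define \<rho> where "\<rho> s t = mdist m (\<phi> s) (\<phi> t)" for s t
  have \<psi>_cont: "continuous_map ?C ?T \<psi>" using \<psi> by (rule homeomorphic_imp_continuous_map)
  have "continuous_map euclidean ?C ecis"
    by (simp add: continuous_map_in_subtopology) (intro continuous_intros)
  from continuous_map_compose[OF this \<psi>_cont] have "continuous_map euclidean ?T \<phi>"
    by (simp add: \<phi>_def[abs_def] o_def)
  then have \<phi>_cont: "continuous_map euclidean (mtopology_of m) \<phi>" by (simp add: continuous_map_in_subtopology)
  have "continuous_map (euclidean :: (real \<times> real) topology) euclidean (\<lambda>x. mdist m ((\<phi> \<circ> fst) x) ((\<phi> \<circ> snd) x))"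
    by (intro continuous_map_mdist continuous_map_compose[OF _ \<phi>_cont]) (auto intro: continuous_intros)
  then have \<rho>_cont: "continuous_on UNIV (\<lambda>(s, t). \<rho> s t)" by (simp add: \<rho>_def case_prod_unfold)
  interpret circle_pseudometric \<rho>
  proof
    show "\<rho> s t = \<rho> t s" for s t by (simp add: \<rho>_def mdist_commute)
    show "\<rho> s u \<le> \<rho> s t + \<rho> t u" for s t u using \<phi>_m by (simp add: \<rho>_def mdist_triangle)
    show "0 \<le> \<rho> s t" for s t by (simp add: \<rho>_def)
    show "\<rho> s t = 0 \<longleftrightarrow> s - t \<in> \<int>" for s t using \<phi>_m by (simp add: \<rho>_def \<phi>_eq)
  qed (rule \<rho>_cont)
  interpret quasicircle_pseudometric \<rho> k N
  proof
    show "1 \<le> k" "4 \<le> N" by fact+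
  next
    fix s t :: real assume st: "s < t" "t < s + 1"
    obtain E where E: "E \<subseteq> S" "connectedin (mtopology_of m) E" "\<phi> s \<in> E" "\<phi> t \<in> E"
      "\<And>u v. u \<in> E \<Longrightarrow> v \<in> E \<Longrightarrow> mdist m u v \<le> k * mdist m (\<phi> s) (\<phi> t)"
      using turn \<phi>_S unfolding bounded_turning_def by meson
    \<comment> \<open>On the unit circle the connected set must contain one of the two arcs between
      the points, and that arc inherits the diameter bound.\<close>
    define E' where "E' = {z \<in> sphere 0 1. \<psi> z \<in> E}"
    have "\<psi> ` E' = E" using E(1) \<psi>_im by (auto simp: E'_def)
    have "connectedin ?T E" using E(1,2) by (simp add: connectedin_subtopology)
    then have "connectedin ?C E'"
    proof -
      have "E' \<subseteq> topspace ?C" unfolding E'_def topspace_euclidean_subtopology by (rule Collect_subset)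
      then show ?thesis
        using homeomorphic_map_connectedness[OF \<psi>, of E'] \<open>\<psi> ` E' = E\<close> \<open>connectedin ?T E\<close> by simp
    qed
    then have "connected E'" by (simp add: connectedin_subtopology)
    then have arc: "ecis ` {s..t} \<subseteq> E' \<or> ecis ` {t..s+1} \<subseteq> E'"
      using E(3,4) st by (intro connected_contains_arc) (auto simp: E'_def \<phi>_def)
    have *: "arc_diam a b \<le> k * \<rho> s t" if "ecis ` {a..b} \<subseteq> E'" "a \<le> b" for a b
    proof (rule arc_diam_le[OF that(2)])
      fix u v assume "u \<in> {a..b}" "v \<in> {a..b}"
      then have "ecis u \<in> E'" "ecis v \<in> E'" using that(1) by blast+
      then have "\<phi> u \<in> E" "\<phi> v \<in> E" by (simp_all add: E'_def \<phi>_def)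
      then show "\<rho> u v \<le> k * \<rho> s t" unfolding \<rho>_def by (rule E(5))
    qed
    then show "min (arc_diam s t) (arc_diam t (s + 1)) \<le> k * \<rho> s t"
      using arc *[of s t] *[of t "s + 1"] st by (meson less_imp_le min.coboundedI1 min.coboundedI2)
  next
    fix F :: "real set" and R assume F: "finite F" "0 < R" "\<And>a b. a \<in> F \<Longrightarrow> b \<in> F \<Longrightarrow> \<rho> a b \<le> R"
      "\<And>a b. a \<in> F \<Longrightarrow> b \<in> F \<Longrightarrow> a \<noteq> b \<Longrightarrow> R / (6 * k) \<le> \<rho> a b"
    have "inj_on \<phi> F"
    proof (rule inj_onI, rule ccontr)
      fix a b assume "a \<in> F" "b \<in> F" "\<phi> a = \<phi> b" "a \<noteq> b"
      moreover have "0 < R / (6 * k)" using F(2) k by simp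
      moreover have "\<rho> a b = 0" using \<open>\<phi> a = \<phi> b\<close> mdist_zero[OF \<phi>_m \<phi>_m] by (simp add: \<rho>_def)
      ultimately show False using F(4)[of a b] by linarith
    qed
    moreover have "card (\<phi> ` F) \<le> N"
      using doub[unfolded separated_card_le_def, rule_format, of "\<phi> ` F" R] F \<phi>_S
      by (force simp: \<rho>_def)
    ultimately show "card F \<le> N" by (simp add: card_image)
  qed
  \<comment> \<open>\<open>Arg\<close> selects one lift of \<open>z\<close>; by
    \<open>theta_shift\<close> every other lift gives the same point.\<close>
  define f where "f z = \<phi> (\<theta> (Arg z / (2 * pi)))" for z
  have f: "f (ecis x) = \<phi> (\<theta> x)" for x
  proof -
    have "ecis (Arg (ecis x) / (2 * pi)) = ecis x" by (intro ecis_surj) auto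
    then obtain i where "Arg (ecis x) / (2 * pi) = x + of_int i"
      unfolding ecis_eq_iff by (elim Ints_cases) (simp add: algebra_simps)
    then have "\<theta> (Arg (ecis x) / (2 * pi)) - \<theta> x \<in> \<int>" by (simp add: theta_shift)
    then show ?thesis unfolding f_def \<phi>_eq .
  qed
  have \<rho>f: "mdist m (f (ecis x)) (f (ecis y)) = \<rho> (\<theta> x) (\<theta> y)" for x y by (simp add: f \<rho>_def)
  have f_S: "f z \<in> S" for z unfolding f_def by (rule \<phi>_S)
  have lift: "\<exists>t. y = ecis t \<and> \<bar>s - t\<bar> \<le> 1/2" if "y \<in> sphere 0 1" for y s
    using ecis_lift[of "Arg y / (2 * pi)" s] ecis_surj[OF that] by metis
  have f_cont: "continuous_map ?C ?T f"
  proof -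
    have "\<exists>\<delta>>0. \<forall>y\<in>sphere 0 1. dist x y < \<delta> \<longrightarrow> mdist m (f x) (f y) < \<epsilon>"
      if x: "x \<in> sphere 0 1" and "0 < \<epsilon>" for x \<epsilon>
    proof -
      let ?A = "(1 + C) * arc_diam 0 1"
      have A: "0 < ?A" using c arc_diam_pos[of 0 1] by simp
      obtain n where "(1/2) ^ n < \<epsilon> / ?A" using real_arch_pow_inv[of "\<epsilon> / ?A" "1/2"] A \<open>0 < \<epsilon>\<close> by auto
      then have n: "?A / 2 ^ n < \<epsilon>" using A by (simp add: field_simps power_divide)
      obtain s where s: "x = ecis s" using lift[OF x] by blast
      have "mdist m (f x) (f y) < \<epsilon>" if y: "y \<in> sphere 0 1" and d: "dist x y < 1 / real K ^ n" for y
      proof -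
        obtain t where t: "y = ecis t" "\<bar>s - t\<bar> \<le> 1/2" using lift[OF y] by blast
        then have "\<bar>s - t\<bar> \<le> 1 / real K ^ n" using dist_ecis(1)[OF t(2)] d s by simp
        then have "\<rho> (\<theta> s) (\<theta> t) \<le> ?A / 2 ^ n" by (rule theta_continuity)
        then show ?thesis using n s t \<rho>f by simp
      qed
      then show ?thesis using K(2) by (intro exI[of _ "1 / real K ^ n"]) auto
    qed
    then have "continuous_map (mtopology_of (submetric euclidean_metric (sphere 0 1))) (mtopology_of m) f"
      unfolding continuous_map_mtopology_of using S f_S
      by (simp only: mspace_submetric mdist_submetric mspace_euclidean_metric mdist_euclidean_metric Int_UNIV_right) blast
    then show ?thesis using f_S by (auto simp: mtopology_of_submetric continuous_map_in_subtopology)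
  qed
  have f_inj: "inj_on f (sphere 0 1)"
  proof (rule inj_onI, rule ccontr)
    fix x y assume xy: "x \<in> sphere 0 1" "y \<in> sphere 0 1" "f x = f y" "x \<noteq> y"
    obtain s where s: "x = ecis s" using lift[OF xy(1)] by blast
    obtain t where t: "y = ecis t" "\<bar>s - t\<bar> \<le> 1/2" using lift[OF xy(2)] by blast
    then have "0 < \<rho> (\<theta> s) (\<theta> t)" using xy s by (intro theta_separated) auto
    moreover have "\<rho> (\<theta> s) (\<theta> t) = mdist m (f x) (f y)" using \<rho>f[of s t] s t by simp
    moreover have "mdist m (f x) (f y) = 0" using xy(3) mdist_self[of "f y" m] f_S[of y] S by auto
    ultimately show False by linarith
  qed
  have cptC: "compact_space ?C" by (simp add: compact_space_subtopology)
  have hausT: "Hausdorff_space ?T" by (simp add: Hausdorff_space_subtopology Hausdorff_space_mtopology_of)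
  have closed: "closed_map ?C ?T f" using f_cont cptC hausT by (rule continuous_imp_closed_map)
  \<comment> \<open>The image is closed, being the image of a compact space in a Hausdorff space,
    and dense by \<open>theta_dense\<close>.\<close>
  have f_im: "f ` sphere 0 1 = S"
  proof (rule antisym)
    show "f ` sphere 0 1 \<subseteq> S" using f_S by auto
    show "S \<subseteq> f ` sphere 0 1"
    proof
      fix w assume w: "w \<in> S"
      have "closedin ?T (f ` sphere 0 1)" using closed by (simp add: closed_map_def)
      then have "openin ?T (S - f ` sphere 0 1)" using tS by (metis openin_diff openin_topspace)
      then obtain U where U: "openin (mtopology_of m) U" "S - f ` sphere 0 1 = U \<inter> S" by (auto simp: openin_subtopology)
      show "w \<in> f ` sphere 0 1"
      proof (rule ccontr)
        assume nw: "w \<notin> f ` sphere 0 1"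
        then have "w \<in> U" using w U(2) by auto
        then obtain \<epsilon> where \<epsilon>: "0 < \<epsilon>" "mball_of m w \<epsilon> \<subseteq> U"
          using U(1) unfolding openin_mtopology_of by blast
        obtain z where z: "z \<in> sphere 0 1" "w = \<psi> z" using w \<psi>_im by auto
        obtain y where y: "z = ecis y" using lift[OF z(1)] by blast
        obtain n where "(1/2) ^ n < \<epsilon> / arc_diam 0 1"
          using real_arch_pow_inv[of "\<epsilon> / arc_diam 0 1" "1/2"] \<epsilon>(1) arc_diam_pos[of 0 1] by auto
        then have n: "arc_diam 0 1 / 2 ^ n < \<epsilon>" using arc_diam_pos[of 0 1] by (simp add: field_simps power_divide)
        obtain x where "\<rho> (\<theta> x) y \<le> arc_diam 0 1 / 2 ^ n" using theta_dense by blast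
        then have "mdist m (f (ecis x)) w < \<epsilon>" using n z y by (simp add: f \<rho>_def \<phi>_def)
        then have "f (ecis x) \<in> U"
          using \<epsilon>(2) w f_S S by (auto simp: mdist_commute subset_iff)
        then have "f (ecis x) \<in> S - f ` sphere 0 1" using U(2) f_S by auto
        then show False by auto
      qed
    qed
  qed
  have "homeomorphic_map ?C ?T f"
    using f_cont cptC hausT by (rule continuous_imp_homeomorphic_map) (use f_im f_inj tS in auto)
  moreover have "mdist m (f x) (f y) / mdist m (f x) (f z) \<le> \<eta> (2 * pi * (dist x y / dist x z))"
    if xyz: "x \<in> sphere 0 1" "y \<in> sphere 0 1" "z \<in> sphere 0 1" "x \<noteq> z" for x y z
  proof -
    obtain a where a: "x = ecis a" using lift[OF xyz(1)] by blast
    obtain b where b: "y = ecis b" "\<bar>a - b\<bar> \<le> 1/2" using lift[OF xyz(2)] by blast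
    obtain e where e: "z = ecis e" "\<bar>a - e\<bar> \<le> 1/2" using lift[OF xyz(3)] by blast
    have ae: "0 < \<bar>a - e\<bar>" using a e xyz by auto
    \<comment> \<open>Numerator and denominator use the two opposite bounds of
      \<open>dist_ecis\<close>, and this is the origin of the factor \<open>2 * pi\<close> in the
      gauge.\<close>
    have "\<bar>a - b\<bar> / \<bar>a - e\<bar> \<le> dist x y / (dist x z / (2 * pi))"
      using dist_ecis[OF b(2)] dist_ecis[OF e(2)] ae xyz unfolding a b(1) e(1)
      by (intro frac_le) (auto simp: field_simps)
    also have "\<dots> = 2 * pi * (dist x y / dist x z)" by simp
    finally have *: "\<bar>a - b\<bar> / \<bar>a - e\<bar> \<le> 2 * pi * (dist x y / dist x z)" .
    have "mdist m (f x) (f y) / mdist m (f x) (f z) \<le> \<eta> (\<bar>a - b\<bar> / \<bar>a - e\<bar>)"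
      unfolding a b(1) e(1) \<rho>f using b(2) ae e(2) by (rule theta_quasisymmetric)
    also have "\<dots> \<le> \<eta> (2 * pi * (dist x y / dist x z))" using * by (intro eta_mono) auto
    finally show ?thesis .
  qed
  ultimately have "quasisymmetric (\<lambda>t. \<eta> (2 * pi * t)) (submetric euclidean_metric (sphere (0::complex) 1)) (submetric m S) f"
    unfolding quasisymmetric_def using S by (simp add: mtopology_of_submetric Int_absorb2)
  then show ?thesis using quasicircle_pseudometric_axioms by blast
qed

lemma quasicircle_parametrization:
  assumes k: "1 \<le> k" and N: "4 \<le> N"
  shows "\<exists>\<eta>. homeo_halfline \<eta> \<and> (\<forall>S. S \<subseteq> mspace m \<and>
    subtopology (mtopology_of m) S homeomorphic_space top_of_set (sphere (0::complex) 1) \<and>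
    bounded_turning m k S \<and> separated_card_le m (6 * k) N S \<longrightarrow>
    (\<exists>f. quasisymmetric \<eta> (submetric euclidean_metric (sphere (0::complex) 1)) (submetric m S) f))"
proof -
  \<comment> \<open>The gauge must be fixed before any circle is given. If the locale has no
    instance for \<open>k\<close> and \<open>N\<close>, there is no circle to parametrize and any
    homeomorphism of the half-line will do; the formula in the other branch is doubling.\<close>
  define H where "H = (if \<exists>\<rho>. quasicircle_pseudometric \<rho> k N
    then \<lambda>t. quasicircle_pseudometric.\<eta> k N (2 * pi * t) else (\<lambda>t. 1 * ((1 * t) powr 1 + (1 * t) powr 1)))"
  have "homeo_halfline H"
  proof (cases "\<exists>\<rho>. quasicircle_pseudometric \<rho> k N")
    case True
    then obtain \<rho> where "quasicircle_pseudometric \<rho> k N" by blast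
    then interpret quasicircle_pseudometric \<rho> k N .
    have "H = (\<lambda>t. \<eta> (2 * pi * t))" unfolding H_def if_P[OF True] ..
    then have H: "H = (\<lambda>t. (1 + C) * (k * C) * ((2 * real K ^ 2 * (2 * pi) * t) powr s1 + (2 * real K ^ 2 * (2 * pi) * t) powr s2))"
      unfolding \<eta>_def[abs_def] mult.assoc .
    have "0 < 1 + C" "0 < k * C" "0 < real K" using c(4) k K(2) by auto
    then have "0 < (1 + C) * (k * C)" "0 < 2 * real K ^ 2 * (2 * pi)"
      by (auto intro!: mult_pos_pos)
    then show ?thesis unfolding H using s_pos by (rule homeo_halfline_powr)
  next
    case False
    show ?thesis unfolding H_def if_not_P[OF False] by (rule homeo_halfline_powr) auto
  qed
  moreover have "\<exists>f. quasisymmetric H (submetric euclidean_metric (sphere (0::complex) 1)) (submetric m S) f"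
    if S: "S \<subseteq> mspace m" "subtopology (mtopology_of m) S homeomorphic_space top_of_set (sphere (0::complex) 1)"
      "bounded_turning m k S" "separated_card_le m (6 * k) N S" for S
  proof -
    obtain \<rho> f where \<rho>: "quasicircle_pseudometric \<rho> k N" and
      f: "quasisymmetric (\<lambda>t. quasicircle_pseudometric.\<eta> k N (2 * pi * t))
        (submetric euclidean_metric (sphere (0::complex) 1)) (submetric m S) f"
      using quasicircle_parametrization_aux[OF k N S] by blast
    have "\<exists>\<rho>. quasicircle_pseudometric \<rho> k N" using \<rho> by blast
    then have "H = (\<lambda>t. quasicircle_pseudometric.\<eta> k N (2 * pi * t))" unfolding H_def by (rule if_P)
    then show ?thesis using f by blast
  qed
  ultimately show ?thesis by blast
qed

section \<open>The Sierpinski carpet and its peripheral circles\<close>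

fun linked :: "'a::topological_space set list \<Rightarrow> bool" where
  "linked [] \<longleftrightarrow> True"
| "linked [A] \<longleftrightarrow> connected A"
| "linked (A # B # Cs) \<longleftrightarrow> connected A \<and> A \<inter> B \<noteq> {} \<and> linked (B # Cs)"

lemma connected_linked: "linked Cs \<Longrightarrow> connected (\<Union>(set Cs))"
proof (induction Cs rule: linked.induct)
  case 1
  show ?case by simp
next
  case (2 A)
  then show ?case by simp
next
  case (3 A B Cs)
  have "connected A" "A \<inter> B \<noteq> {}" "linked (B # Cs)" using "3.prems" by simp_all
  moreover have "connected (\<Union>(set (B # Cs)))" using "3.IH" \<open>linked (B # Cs)\<close> .
  moreover have "B \<subseteq> \<Union>(set (B # Cs))" by simp
  ultimately have "connected (A \<union> \<Union>(set (B # Cs)))" by (intro connected_Un) blast+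
  then show ?case by simp
qed

definition digits :: "(nat \<times> nat) set" where
  "digits = {(i, j). i < 3 \<and> j < 3 \<and> (i, j) \<noteq> (1, 1)}"

text \<open>The enumeration walks once around the ring of eight squares, so neighbours in it share a
  side.\<close>

lemma digits_eq: "digits = {(0,0), (1,0), (2,0), (2,1), (2,2), (1,2), (0,2), (0,1)}"
proof (rule Set.set_eqI)
  fix a :: "nat \<times> nat"
  have "(i, j) \<in> digits \<longleftrightarrow> (i, j) \<in> {(0,0), (1,0), (2,0), (2,1), (2,2), (1,2), (0,2), (0,1)}" for i j
    unfolding digits_def mem_Collect_eq case_prod_conv insert_iff empty_iff prod.inject by presburger
  from this[of "fst a" "snd a"] show "a \<in> digits \<longleftrightarrow> a \<in> {(0,0), (1,0), (2,0), (2,1), (2,2), (1,2), (0,2), (0,1)}"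
    unfolding prod.collapse .
qed

definition sub :: "nat \<Rightarrow> nat \<Rightarrow> real \<times> real \<Rightarrow> real \<times> real" where
  "sub i j z = ((fst z + real i) / 3, (snd z + real j) / 3)"

definition level_carpet :: "nat \<Rightarrow> (real \<times> real) set" where
  "level_carpet n = (\<Union>(x, y)\<in>carpet_corners n. {x..x + 1 / 3 ^ n} \<times> {y..y + 1 / 3 ^ n})"

lemma standard_carpet_eq: "standard_carpet = (\<Inter>n. level_carpet n)"
  by (simp add: standard_carpet_def level_carpet_def)

text \<open>The recursion that defines the corners refines at the finest scale. Exchanging it for
  one at the coarsest scale exhibits the carpet as invariant under eight similarities, and all later
  inductions follow these.\<close>

lemma carpet_corners_Suc: "carpet_corners (Suc n) = (\<Union>(i, j)\<in>digits. sub i j ` carpet_corners n)"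
proof (induction n)
  case 0
  show ?case
    by (force simp: digits_def sub_def image_iff)
next
  case (Suc n)
  have "carpet_corners (Suc (Suc n)) =
      {(x + real i / 3 ^ Suc (Suc n), y + real j / 3 ^ Suc (Suc n)) | x y i j.
        (x, y) \<in> carpet_corners (Suc n) \<and> (i, j) \<in> digits}"
    by (simp only: carpet_corners.simps(2)[of "Suc n"] digits_def mem_Collect_eq case_prod_conv)
  also have "\<dots> = {sub k l (x + real i / 3 ^ Suc n, y + real j / 3 ^ Suc n) | k l x y i j.
        (x, y) \<in> carpet_corners n \<and> (i, j) \<in> digits \<and> (k, l) \<in> digits}" (is "?A = ?B")
  proof (intro equalityI subsetI)
    fix z assume "z \<in> ?A"
    then obtain x y i j where z: "z = (x + real i / 3 ^ Suc (Suc n), y + real j / 3 ^ Suc (Suc n))"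
      "(x, y) \<in> carpet_corners (Suc n)" "(i, j) \<in> digits" by blast
    then obtain k l x' y' where kl: "(k, l) \<in> digits" "(x', y') \<in> carpet_corners n" "(x, y) = sub k l (x', y')"
      unfolding Suc by auto
    have "z = sub k l (x' + real i / 3 ^ Suc n, y' + real j / 3 ^ Suc n)"
      using kl(3) z(1) by (simp add: sub_def add_divide_distrib mult.commute)
    then show "z \<in> ?B" using z kl by blast
  next
    fix z assume "z \<in> ?B"
    then obtain k l x y i j where z: "z = sub k l (x + real i / 3 ^ Suc n, y + real j / 3 ^ Suc n)"
      "(x, y) \<in> carpet_corners n" "(i, j) \<in> digits" "(k, l) \<in> digits" by blast
    have "sub k l (x, y) \<in> carpet_corners (Suc n)" unfolding Suc using z by blast
    moreover have "z = (fst (sub k l (x, y)) + real i / 3 ^ Suc (Suc n), snd (sub k l (x, y)) + real j / 3 ^ Suc (Suc n))"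
      using z(1) by (simp add: sub_def add_divide_distrib mult.commute)
    ultimately show "z \<in> ?A" using z(3) by (metis (mono_tags, lifting) mem_Collect_eq prod.collapse)
  qed
  also have "\<dots> = (\<Union>(i, j)\<in>digits. sub i j ` carpet_corners (Suc n))" (is "_ = ?C")
  proof -
    have c: "carpet_corners (Suc n) = {(x + real i / 3 ^ Suc n, y + real j / 3 ^ Suc n) | x y i j.
        (x, y) \<in> carpet_corners n \<and> (i, j) \<in> digits}"
      by (simp only: carpet_corners.simps(2)[of n] digits_def mem_Collect_eq case_prod_conv)
    show ?thesis
    proof (intro equalityI subsetI)
      fix z assume "z \<in> ?B"
      then obtain k l x y i j where "z = sub k l (x + real i / 3 ^ Suc n, y + real j / 3 ^ Suc n)"
        "(x, y) \<in> carpet_corners n" "(i, j) \<in> digits" "(k, l) \<in> digits" by blast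
      then show "z \<in> ?C" unfolding c by blast
    next
      fix z assume "z \<in> ?C"
      then obtain k l w where "(k, l) \<in> digits" "w \<in> carpet_corners (Suc n)" "z = sub k l w" by blast
      then show "z \<in> ?B" unfolding c by blast
    qed
  qed
  finally show ?case .
qed

lemma level_carpet_0: "level_carpet 0 = {0..1} \<times> {0..1}"
  by (simp add: level_carpet_def)

lemma sub_image_square:
  "sub i j ` ({x..x + s} \<times> {y..y + s}) = {(x + real i) / 3..(x + real i) / 3 + s / 3} \<times> {(y + real j) / 3..(y + real j) / 3 + s / 3}"
proof -
  have 1: "(\<lambda>x. (x + real i) / 3) ` {x..x + s} = {(x + real i) / 3..(x + real i) / 3 + s / 3}" for x i
    using image_affinity_atLeastAtMost_div[of 3 "real i / 3" x "x + s"]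
    by (cases "0 \<le> s") (auto simp: add_divide_distrib algebra_simps)
  have "sub i j ` ({x..x + s} \<times> {y..y + s}) =
      ((\<lambda>x. (x + real i) / 3) ` {x..x + s}) \<times> ((\<lambda>y. (y + real j) / 3) ` {y..y + s})"
    unfolding sub_def[abs_def] by (auto simp: image_iff) 
  then show ?thesis unfolding 1 .
qed

lemma level_carpet_Suc: "level_carpet (Suc n) = (\<Union>(i, j)\<in>digits. sub i j ` level_carpet n)"
proof -
  define Q where "Q n p = {fst p..fst p + 1 / 3 ^ n} \<times> {snd p..snd p + 1 / 3 ^ n}" for n :: nat and p :: "real \<times> real"
  have lc: "level_carpet n = (\<Union>p\<in>carpet_corners n. Q n p)" for n
    by (simp add: level_carpet_def Q_def case_prod_unfold)
  have Q: "Q (Suc n) (sub i j p) = sub i j ` Q n p" for i j p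
    using sub_image_square[of i j "fst p" "1 / 3 ^ n" "snd p"] by (simp add: Q_def sub_def mult.commute)
  have "level_carpet (Suc n) = (\<Union>a\<in>digits. \<Union>p\<in>carpet_corners n. Q (Suc n) (sub (fst a) (snd a) p))"
    unfolding lc carpet_corners_Suc by (simp add: case_prod_unfold)
  also have "\<dots> = (\<Union>a\<in>digits. sub (fst a) (snd a) ` level_carpet n)"
    unfolding lc Q image_UN ..
  finally show ?thesis by (simp add: case_prod_unfold)
qed

lemma mem_UN_digits:
  "z \<in> (\<Union>(i, j)\<in>digits. sub i j ` X i j) \<longleftrightarrow> (\<exists>i j w. (i, j) \<in> digits \<and> w \<in> X i j \<and> z = sub i j w)"
  by (auto split: prod.splits) blast

lemma level_carpet_Suc_iff:
  "z \<in> level_carpet (Suc n) \<longleftrightarrow> (\<exists>i j w. (i, j) \<in> digits \<and> w \<in> level_carpet n \<and> z = sub i j w)"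
  unfolding level_carpet_Suc mem_UN_digits ..

lemma sub_unit_square:
  assumes "(i, j) \<in> digits" "z \<in> {0..1} \<times> {0..1}"
  shows "sub i j z \<in> {0..1} \<times> {0..1}"
proof -
  have "i \<le> 2" "j \<le> 2" using assms(1) by (auto simp: digits_def)
  then have "real i \<le> 2" "real j \<le> 2" by simp_all
  moreover have "0 \<le> fst z" "fst z \<le> 1" "0 \<le> snd z" "snd z \<le> 1" using assms(2) by (simp_all add: mem_Times_iff)
  ultimately show ?thesis by (simp add: sub_def mem_Times_iff)
qed

lemma level_carpet_decreasing: "level_carpet (Suc n) \<subseteq> level_carpet n"
proof (induction n)
  case 0
  show ?case
  proof
    fix z assume "z \<in> level_carpet (Suc 0)"
    then obtain i j w where "(i, j) \<in> digits" "w \<in> level_carpet 0" "z = sub i j w"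
      unfolding level_carpet_Suc_iff by blast
    then show "z \<in> level_carpet 0" using sub_unit_square unfolding level_carpet_0 by blast
  qed
next
  case (Suc n)
  show ?case
  proof
    fix z assume "z \<in> level_carpet (Suc (Suc n))"
    then obtain i j w where "(i, j) \<in> digits" "w \<in> level_carpet (Suc n)" "z = sub i j w"
      unfolding level_carpet_Suc_iff[of _ "Suc n"] by blast
    moreover from this have "w \<in> level_carpet n" using Suc by blast
    ultimately show "z \<in> level_carpet (Suc n)" by (subst level_carpet_Suc_iff) blast
  qed
qed

lemma level_carpet_antimono: "m \<le> n \<Longrightarrow> level_carpet n \<subseteq> level_carpet m"
  using level_carpet_decreasing by (rule lift_Suc_antimono_le)

lemma continuous_sub: "continuous_on S (sub i j)"
  unfolding sub_def[abs_def] by (intro continuous_intros) auto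

lemma mem_carpet_iff: "z \<in> standard_carpet \<longleftrightarrow> (\<forall>n. z \<in> level_carpet n)"
  by (simp add: standard_carpet_eq)

lemma sub_carpet:
  assumes "(i, j) \<in> digits" "z \<in> standard_carpet"
  shows "sub i j z \<in> standard_carpet"
  unfolding mem_carpet_iff
proof
  fix n
  have "z \<in> level_carpet n" using assms(2) by (simp add: mem_carpet_iff)
  then have "sub i j z \<in> level_carpet (Suc n)" using assms(1) unfolding level_carpet_Suc_iff by blast
  then show "sub i j z \<in> level_carpet n" using level_carpet_decreasing by blast
qed

text \<open>If all eight rescaled points were outside the carpet, finitely many levels would witness
  this, and the largest of them would contradict the membership of \<open>z\<close> in the next
  level.\<close>

lemma carpet_cases:
  assumes z: "z \<in> standard_carpet"
  obtains i j w where "(i, j) \<in> digits" "w \<in> standard_carpet" "z = sub i j w"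
proof -
  define w where "w a = (3 * fst z - real (fst a), 3 * snd z - real (snd a))" for a :: "nat \<times> nat"
  have zw: "z = sub i j v \<longleftrightarrow> v = w (i, j)" for i j v
    by (auto simp: sub_def w_def prod_eq_iff)
  have "\<exists>a\<in>digits. w a \<in> standard_carpet"
  proof (rule ccontr)
    assume "\<not> ?thesis"
    then have "\<forall>a\<in>digits. \<exists>n. w a \<notin> level_carpet n" unfolding mem_carpet_iff by blast
    then obtain N where N: "\<And>a. a \<in> digits \<Longrightarrow> w a \<notin> level_carpet (N a)" by metis
    define M where "M = Max (N ` digits)"
    have "finite digits" by (simp add: digits_eq)
    then have NM: "N a \<le> M" if "a \<in> digits" for a using that by (simp add: M_def)
    have "z \<in> level_carpet (Suc M)" using z by (simp only: mem_carpet_iff)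
    then obtain i j where "(i, j) \<in> digits" "w (i, j) \<in> level_carpet M"
      unfolding level_carpet_Suc_iff zw by blast
    then show False using N level_carpet_antimono[OF NM] by blast
  qed
  then obtain i j where "(i, j) \<in> digits" "w (i, j) \<in> standard_carpet" by auto
  then show ?thesis using that zw by blast
qed

lemma carpet_subset_square: "standard_carpet \<subseteq> {0..1} \<times> {0..1}"
proof
  fix z assume "z \<in> standard_carpet"
  then have "z \<in> level_carpet 0" by (simp only: mem_carpet_iff)
  then show "z \<in> {0..1} \<times> {0..1}" by (simp only: level_carpet_0)
qed

lemma carpet_bounds:
  assumes "z \<in> standard_carpet"
  shows "0 \<le> fst z" "fst z \<le> 1" "0 \<le> snd z" "snd z \<le> 1"
  using subsetD[OF carpet_subset_square assms] by (simp_all add: mem_Times_iff)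

section \<open>The edge of the square and the connectedness of the carpet\<close>

definition square_edge :: "(real \<times> real) set" where
  "square_edge = {z \<in> {0..1} \<times> {0..1}. fst z = 0 \<or> fst z = 1 \<or> snd z = 0 \<or> snd z = 1}"

lemma third_cases:
  assumes "0 \<le> x" "x \<le> (1::real)"
  obtains i where "i < 3" "0 \<le> 3 * x - real i" "3 * x - real i \<le> 1"
proof -
  consider "x \<le> 1/3" | "1/3 \<le> x" "x \<le> 2/3" | "2/3 \<le> x" by linarith
  then show ?thesis
  proof cases
    case 1
    then show ?thesis using assms by (intro that[of 0]) simp_all
  next
    case 2
    then show ?thesis using assms by (intro that[of 1]) simp_all
  next
    case 3
    then show ?thesis using assms by (intro that[of 2]) simp_all
  qed
qed

lemma square_edge_sub:
  assumes "z \<in> square_edge"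
  shows "\<exists>i j w. (i, j) \<in> digits \<and> w \<in> square_edge \<and> z = sub i j w"
proof -
  obtain x y where z: "z = (x, y)" "0 \<le> x" "x \<le> 1" "0 \<le> y" "y \<le> 1"
    using assms by (auto simp: square_edge_def)
  obtain i where i: "i < 3" "0 \<le> 3 * x - real i" "3 * x - real i \<le> 1" using third_cases z by metis
  obtain j where j: "j < 3" "0 \<le> 3 * y - real j" "3 * y - real j \<le> 1" using third_cases z by metis
  have s: "z = sub k l (3 * x - real k, 3 * y - real l)" for k l by (simp add: sub_def z)
  have e: "x = 0 \<or> x = 1 \<or> y = 0 \<or> y = 1" using assms z by (auto simp: square_edge_def)
  have "\<exists>k l. (k, l) \<in> digits \<and> (3 * x - real k, 3 * y - real l) \<in> square_edge"
    using e
  proof (elim disjE)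
    assume "x = 0"
    then show ?thesis using j by (intro exI[of _ 0] exI[of _ j]) (auto simp: square_edge_def digits_def)
  next
    assume "x = 1"
    then show ?thesis using j by (intro exI[of _ 2] exI[of _ j]) (auto simp: square_edge_def digits_def)
  next
    assume "y = 0"
    then show ?thesis using i by (intro exI[of _ i] exI[of _ 0]) (auto simp: square_edge_def digits_def)
  next
    assume "y = 1"
    then show ?thesis using i by (intro exI[of _ i] exI[of _ 2]) (auto simp: square_edge_def digits_def)
  qed
  then show ?thesis using s by blast
qed

text \<open>Every edge point is the image of an edge point under one of the eight similarities, so
  the inclusion passes from each level to the next.\<close>

lemma square_edge_subset_carpet: "square_edge \<subseteq> standard_carpet"
proof -
  have "square_edge \<subseteq> level_carpet n" for n
  proof (induction n)
    case 0
    then show ?case by (auto simp: level_carpet_0 square_edge_def)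
  next
    case (Suc n)
    show ?case
    proof
      fix z assume "z \<in> square_edge"
      then obtain i j w where "(i, j) \<in> digits" "w \<in> square_edge" "z = sub i j w" using square_edge_sub by blast
      then show "z \<in> level_carpet (Suc n)" using Suc unfolding level_carpet_Suc_iff by blast
    qed
  qed
  then show ?thesis unfolding standard_carpet_eq by (rule INT_greatest)
qed

lemma corners_carpet [simp]:
  "(0, 0) \<in> standard_carpet" "(0, 1) \<in> standard_carpet" "(1, 0) \<in> standard_carpet" "(1, 1) \<in> standard_carpet"
  by (rule subsetD[OF square_edge_subset_carpet], simp add: square_edge_def)+

lemma connected_sub_image: "connected X \<Longrightarrow> connected (sub i j ` X)"
  using continuous_sub by (rule connected_continuous_image)

lemma meet_at:
  assumes "p \<in> X" "q \<in> Y" "sub i j p = sub k l q"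
  shows "sub i j ` X \<inter> sub k l ` Y \<noteq> {}"
proof -
  have "sub i j p \<in> sub i j ` X" using assms(1) by (rule imageI)
  moreover have "sub i j p \<in> sub k l ` Y" unfolding assms(3) using assms(2) by (rule imageI)
  ultimately show ?thesis by blast
qed

text \<open>Consecutive squares of the ring are joined at a common corner. The corners chosen all
  lie on the edge of the unit square, so they are still present when something is removed around the
  centre.\<close>

lemma connected_ring:
  assumes conn: "\<And>i j. (i, j) \<in> digits \<Longrightarrow> connected (X i j)"
    and pts: "(1,0) \<in> X 0 0" "(0,0) \<in> X 1 0" "(1,0) \<in> X 1 0" "(0,0) \<in> X 2 0" "(1,1) \<in> X 2 0"
      "(1,0) \<in> X 2 1" "(1,1) \<in> X 2 1" "(1,0) \<in> X 2 2" "(0,1) \<in> X 2 2" "(1,1) \<in> X 1 2" "(0,1) \<in> X 1 2"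
      "(1,1) \<in> X 0 2" "(0,0) \<in> X 0 2" "(0,1) \<in> X 0 1"
  shows "connected (\<Union>(i, j)\<in>digits. sub i j ` X i j)"
proof -
  let ?l = "[(0,0), (1,0), (2,0), (2,1), (2,2), (1,2), (0,2), (0,1)] :: (nat \<times> nat) list"
  have "linked (map (\<lambda>(i, j). sub i j ` X i j) ?l)"
    unfolding list.map case_prod_conv linked.simps
    by (intro conjI connected_sub_image conn meet_at[OF pts(1,2)] meet_at[OF pts(3,4)] meet_at[OF pts(5,6)]
        meet_at[OF pts(7,8)] meet_at[OF pts(9,10)] meet_at[OF pts(11,12)] meet_at[OF pts(13,14)])
      (simp_all add: digits_eq sub_def)
  then have "connected (\<Union>(set (map (\<lambda>(i, j). sub i j ` X i j) ?l)))" by (rule connected_linked)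
  moreover have "set ?l = digits" by (simp add: digits_eq)
  ultimately show ?thesis by (simp only: set_map)
qed

lemma connected_carpet: "connected standard_carpet"
  and compact_carpet: "compact standard_carpet"
proof -
  have *: "compact (level_carpet n) \<and> connected (level_carpet n)" for n
  proof (induction n)
    case 0
    then show ?case by (auto simp: level_carpet_0 compact_Times intro!: connected_Times)
  next
    case (Suc n)
    have "finite digits" by (simp add: digits_eq)
    then have "compact (level_carpet (Suc n))"
      unfolding level_carpet_Suc using Suc
      by (intro compact_UN) (auto simp: case_prod_unfold intro!: compact_continuous_image continuous_sub)
    moreover have "z \<in> level_carpet n" if "z \<in> standard_carpet" for z using that by (simp add: mem_carpet_iff)
    from corners_carpet[THEN this] have "connected (level_carpet (Suc n))"
      unfolding level_carpet_Suc using Suc by (intro connected_ring) simp_all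
    ultimately show ?case ..
  qed
  have nest: "\<And>m n. m \<le> n \<Longrightarrow> level_carpet n \<subseteq> level_carpet m" by (rule level_carpet_antimono)
  show "connected standard_carpet" unfolding standard_carpet_eq using * nest by (intro connected_nest) auto
  show "compact standard_carpet" unfolding standard_carpet_eq using * by (intro compact_Inter) auto
qed

section \<open>Connectedness after removal of an edge or a corner\<close>

definition above :: "nat \<Rightarrow> (real \<times> real) set" where
  "above k = {z \<in> standard_carpet. 1 / 3 ^ k \<le> snd z}"

lemma above_corners: "(0,1) \<in> above k" "(1,1) \<in> above k"
proof -
  have "1 / 3 ^ k \<le> (1::real)" by (simp add: divide_le_eq)
  then show "(0,1) \<in> above k" "(1,1) \<in> above k" by (simp_all add: above_def)
qed

text \<open>Only the three lower squares lose a strip at the bottom. They are therefore attached at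
  upper corners: the chain starts in the lower middle square, enters the lower left one at height
  1/3, and runs around the ring to the lower right one.\<close>

lemma connected_above: "connected (above k)"
proof (induction k)
  case 0
  have "above 0 = (\<lambda>x. (x, 1)) ` {0..1}"
  proof (intro equalityI subsetI)
    fix z assume "z \<in> above 0"
    then have z: "z \<in> standard_carpet" "1 \<le> snd z" by (simp_all add: above_def)
    then have "z = (fst z, 1)" "fst z \<in> {0..1}" using carpet_bounds[OF z(1)] by (simp_all add: prod_eq_iff)
    then show "z \<in> (\<lambda>x. (x, 1)) ` {0..1}" by (rule image_eqI)
  next
    fix z :: "real \<times> real" assume "z \<in> (\<lambda>x. (x, 1)) ` {0..1}"
    then have "z \<in> square_edge" "snd z = 1" by (auto simp: square_edge_def)
    then show "z \<in> above 0" using subsetD[OF square_edge_subset_carpet] by (simp add: above_def)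
  qed
  then show ?case by (auto intro!: connected_continuous_image continuous_intros)
next
  case (Suc k)
  let ?T = standard_carpet and ?W = "above k"
  let ?l = "[sub 1 0 ` ?W, sub 0 0 ` ?W, sub 0 1 ` ?T, sub 0 2 ` ?T, sub 1 2 ` ?T, sub 2 2 ` ?T, sub 2 1 ` ?T, sub 2 0 ` ?W]"
  have "linked ?l"
    unfolding linked.simps
    by (intro conjI connected_sub_image Suc connected_carpet meet_at[OF above_corners]
        meet_at[OF above_corners(1) corners_carpet(1)] meet_at[OF corners_carpet(2,1)] meet_at[OF corners_carpet(4,2)]
        meet_at[OF corners_carpet(3,4)] meet_at[OF corners_carpet(3) above_corners(2)])
      (simp_all add: sub_def)
  then have "connected (\<Union>(set ?l))" by (rule connected_linked)
  moreover have l: "\<Union>(set ?l) = (\<Union>(i, j)\<in>digits. sub i j ` (if j = 0 then ?W else ?T))"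
    unfolding digits_eq by (simp, blast)
  have "above (Suc k) = \<Union>(set ?l)"
    unfolding l
  proof (intro equalityI subsetI)
    fix z assume z: "z \<in> above (Suc k)"
    then obtain i j w where w: "(i, j) \<in> digits" "w \<in> ?T" "z = sub i j w"
      using carpet_cases unfolding above_def by blast
    have "w \<in> ?W" if "j = 0"
    proof -
      have "1 / 3 ^ Suc k \<le> snd w / 3" using z w(3) that by (simp add: above_def sub_def)
      then show ?thesis using w(2) by (simp add: above_def mult.commute field_simps)
    qed
    then have "w \<in> (if j = 0 then ?W else ?T)" using w(2) by simp
    then show "z \<in> (\<Union>(i, j)\<in>digits. sub i j ` (if j = 0 then ?W else ?T))"
      unfolding mem_UN_digits using w(1,3) by blast
  next
    fix z assume "z \<in> (\<Union>(i, j)\<in>digits. sub i j ` (if j = 0 then ?W else ?T))"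
    then obtain i j w where w': "(i, j) \<in> digits" "w \<in> (if j = 0 then ?W else ?T)" "z = sub i j w"
      unfolding mem_UN_digits by blast
    then have "w \<in> ?T" "j = 0 \<Longrightarrow> w \<in> ?W" by (auto simp: above_def split: if_splits)
    note w = w'(1) this(1) w'(3) this(2)
    have "1 / 3 ^ Suc k \<le> snd z"
    proof (cases "j = 0")
      case True
      have "1 / 3 ^ k \<le> snd w" using w(4)[OF True] by (simp add: above_def)
      then have "1 / 3 ^ k / 3 \<le> snd w / 3" by (rule divide_right_mono) simp
      then show ?thesis using True by (simp add: w(3) sub_def mult.commute)
    next
      case False
      have "1 / 3 ^ Suc k \<le> 1 / (3::real)" by (simp add: divide_simps)
      moreover have "1 / 3 \<le> (snd w + real j) / 3" using carpet_bounds(3)[OF w(2)] False by simp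
      ultimately show ?thesis unfolding w(3) sub_def snd_conv by linarith
    qed
    moreover have "z \<in> ?T" unfolding w(3) using w(1,2) by (rule sub_carpet)
    ultimately show "z \<in> above (Suc k)" by (simp add: above_def)
  qed
  ultimately show ?case by simp
qed

lemma connected_minus_bottom: "connected {z \<in> standard_carpet. snd z \<noteq> 0}"
proof -
  have "{z \<in> standard_carpet. snd z \<noteq> 0} = (\<Union>k. above k)"
  proof (intro equalityI subsetI)
    fix z assume z: "z \<in> {z \<in> standard_carpet. snd z \<noteq> 0}"
    then have "0 < snd z" using carpet_bounds(3)[of z] by auto
    then obtain k where "(1/3) ^ k < snd z" using real_arch_pow_inv[of "snd z" "1/3"] by auto
    then have "z \<in> above k" using z by (auto simp: above_def power_divide)
    then show "z \<in> (\<Union>k. above k)" by blast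
  next
    fix z assume "z \<in> (\<Union>k. above k)"
    then obtain k where k: "z \<in> standard_carpet" "1 / 3 ^ k \<le> snd z" by (auto simp: above_def)
    have "0 < 1 / (3::real) ^ k" by simp
    then have "snd z \<noteq> 0" using k(2) by linarith
    then show "z \<in> {z \<in> standard_carpet. snd z \<noteq> 0}" using k(1) by blast
  qed
  moreover have "(0, 1) \<in> \<Inter>(range above)" using above_corners(1) by blast
  then have "connected (\<Union>(range above))" using connected_above by (intro connected_Union) blast+
  ultimately show ?thesis by simp
qed

text \<open>A map of the square that carries the similarities to one another preserves every level;
  used for the reflections that reduce all edges to the bottom one.\<close>

lemma carpet_invariant:
  assumes "\<And>i j. (i, j) \<in> digits \<Longrightarrow> \<exists>k l. (k, l) \<in> digits \<and> (\<forall>z. h (sub i j z) = sub k l (h z))"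
    and "\<And>z. z \<in> {0..1} \<times> {0..1} \<Longrightarrow> h z \<in> {0..1} \<times> {0..1}" and "z \<in> standard_carpet"
  shows "h z \<in> standard_carpet"
proof -
  have "h ` level_carpet n \<subseteq> level_carpet n" for n
  proof (induction n)
    case 0
    then show ?case using assms(2) unfolding level_carpet_0 by blast
  next
    case (Suc n)
    show ?case
    proof
      fix w assume "w \<in> h ` level_carpet (Suc n)"
      then obtain i j v where v: "(i, j) \<in> digits" "v \<in> level_carpet n" "w = h (sub i j v)"
        unfolding image_iff Bex_def level_carpet_Suc_iff by blast
      obtain k l where "(k, l) \<in> digits" "w = sub k l (h v)" using assms(1)[OF v(1)] v(3) by blast
      moreover have "h v \<in> level_carpet n" using Suc v(2) by blast
      ultimately show "w \<in> level_carpet (Suc n)" unfolding level_carpet_Suc_iff by blast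
    qed
  qed
  then show ?thesis using assms(3) by (auto simp: mem_carpet_iff)
qed

lemma carpet_swap:
  assumes "z \<in> standard_carpet"
  shows "prod.swap z \<in> standard_carpet"
proof -
  have 1: "\<exists>k l. (k, l) \<in> digits \<and> (\<forall>z. prod.swap (sub i j z) = sub k l (prod.swap z))" if "(i, j) \<in> digits" for i j
    using that by (intro exI[of _ j] exI[of _ i]) (auto simp: digits_def sub_def)
  have 2: "prod.swap z \<in> {0..1} \<times> {0..1}" if "z \<in> {0..1} \<times> {0..1}" for z :: "real \<times> real"
    using that by (simp add: mem_Times_iff)
  show ?thesis using 1 2 assms by (rule carpet_invariant)
qed

definition flip :: "real \<times> real \<Rightarrow> real \<times> real" where "flip z = (fst z, 1 - snd z)"

lemma carpet_flip:
  assumes "z \<in> standard_carpet"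
  shows "flip z \<in> standard_carpet"
proof -
  have 1: "\<exists>k l. (k, l) \<in> digits \<and> (\<forall>z. flip (sub i j z) = sub k l (flip z))" if "(i, j) \<in> digits" for i j
  proof (rule exI[of _ i], rule exI[of _ "2 - j"], intro conjI allI)
    show "(i, 2 - j) \<in> digits" using that unfolding digits_def by auto
    have "j \<le> 2" using that by (simp add: digits_def)
    then have "real (2 - j) = 2 - real j" by simp
    then show "flip (sub i j z) = sub i (2 - j) (flip z)" for z by (simp add: flip_def sub_def field_simps)
  qed
  have 2: "flip z \<in> {0..1} \<times> {0..1}" if "z \<in> {0..1} \<times> {0..1}" for z
    using that by (simp add: mem_Times_iff flip_def)
  show ?thesis using 1 2 assms by (rule carpet_invariant)
qed

lemma connected_minus_edge:
  "connected {z \<in> standard_carpet. snd z \<noteq> 0}" "connected {z \<in> standard_carpet. snd z \<noteq> 1}"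
  "connected {z \<in> standard_carpet. fst z \<noteq> 0}" "connected {z \<in> standard_carpet. fst z \<noteq> 1}"
proof -
  let ?A = "{z \<in> standard_carpet. snd z \<noteq> 0}" and ?B = "{z \<in> standard_carpet. snd z \<noteq> 1}"
  show A: "connected ?A" by (rule connected_minus_bottom)
  have ff: "flip (flip z) = z" for z by (simp add: flip_def)
  have "?B = flip ` ?A"
  proof (intro equalityI subsetI)
    fix z assume "z \<in> ?B"
    then have "flip z \<in> ?A" using carpet_flip by (auto simp: flip_def)
    then show "z \<in> flip ` ?A" by (rule image_eqI[of _ _ "flip z", rotated]) (simp only: ff)
  next
    fix z assume "z \<in> flip ` ?A"
    then obtain w where "w \<in> standard_carpet" "snd w \<noteq> 0" "z = flip w" by blast
    then show "z \<in> ?B" using carpet_flip[of w] by (simp add: flip_def)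
  qed
  moreover have "continuous_on ?A flip" unfolding flip_def[abs_def] by (intro continuous_intros)
  then have "connected (flip ` ?A)" using A by (rule connected_continuous_image)
  ultimately show B: "connected ?B" by (simp only:)
  have ss: "prod.swap (prod.swap z) = z" for z :: "real \<times> real" by simp
  have sw: "{z \<in> standard_carpet. fst z \<noteq> c} = prod.swap ` {z \<in> standard_carpet. snd z \<noteq> c}" for c
  proof (intro equalityI subsetI)
    fix z assume "z \<in> {z \<in> standard_carpet. fst z \<noteq> c}"
    then have "prod.swap z \<in> {z \<in> standard_carpet. snd z \<noteq> c}" using carpet_swap by auto
    then show "z \<in> prod.swap ` {z \<in> standard_carpet. snd z \<noteq> c}"
      by (rule image_eqI[of _ _ "prod.swap z", rotated]) (simp only: ss)
  next
    fix z assume "z \<in> prod.swap ` {z \<in> standard_carpet. snd z \<noteq> c}"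
    then obtain w where "w \<in> standard_carpet" "snd w \<noteq> c" "z = prod.swap w" by blast
    then show "z \<in> {z \<in> standard_carpet. fst z \<noteq> c}" using carpet_swap[of w] by simp
  qed
  have cs: "continuous_on X (prod.swap :: real \<times> real \<Rightarrow> real \<times> real)" for X
    unfolding prod.swap_def by (intro continuous_intros)
  show "connected {z \<in> standard_carpet. fst z \<noteq> 0}" "connected {z \<in> standard_carpet. fst z \<noteq> 1}"
    unfolding sw by (rule connected_continuous_image[OF cs A], rule connected_continuous_image[OF cs B])
qed

text \<open>Deleting a corner leaves the union of the two carpets with an edge through that corner
  deleted, and these share the opposite corner.\<close>

lemma connected_minus_corner:
  assumes "a \<in> {0, 1}" "b \<in> {0, 1}"
  shows "connected {z \<in> standard_carpet. z \<noteq> (a, b)}"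
proof -
  have "{z \<in> standard_carpet. z \<noteq> (a, b)} = {z \<in> standard_carpet. fst z \<noteq> a} \<union> {z \<in> standard_carpet. snd z \<noteq> b}"
    unfolding prod_eq_iff by auto
  moreover have "(1 - a, 1 - b) \<in> standard_carpet" "1 - a \<noteq> a" "1 - b \<noteq> b" using assms by auto
  then have "(1 - a, 1 - b) \<in> {z \<in> standard_carpet. fst z \<noteq> a} \<inter> {z \<in> standard_carpet. snd z \<noteq> b}" by auto
  then have "connected ({z \<in> standard_carpet. fst z \<noteq> a} \<union> {z \<in> standard_carpet. snd z \<noteq> b})"
    using assms connected_minus_edge by (intro connected_Un) auto
  ultimately show ?thesis by simp
qed

section \<open>The holes of the carpet\<close>

definition osq :: "real \<Rightarrow> real \<Rightarrow> real \<Rightarrow> (real \<times> real) set" where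
  "osq u v r = {u - r<..<u + r} \<times> {v - r<..<v + r}"

definition csq :: "real \<Rightarrow> real \<Rightarrow> real \<Rightarrow> (real \<times> real) set" where
  "csq u v r = {u - r..u + r} \<times> {v - r..v + r}"

lemma mem_osq: "z \<in> osq u v r \<longleftrightarrow> u - r < fst z \<and> fst z < u + r \<and> v - r < snd z \<and> snd z < v + r"
  by (auto simp: osq_def mem_Times_iff)

lemma mem_csq: "z \<in> csq u v r \<longleftrightarrow> u - r \<le> fst z \<and> fst z \<le> u + r \<and> v - r \<le> snd z \<and> snd z \<le> v + r"
  by (auto simp: csq_def mem_Times_iff)

text \<open>Centre and half the side of a removed square, with the number of similarities that lead
  to it from the central one.\<close>

inductive hole :: "nat \<Rightarrow> real \<Rightarrow> real \<Rightarrow> real \<Rightarrow> bool" where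
  hole_0: "hole 0 (1/2) (1/2) (1/6)"
| hole_Suc: "(i, j) \<in> digits \<Longrightarrow> hole n u v r \<Longrightarrow> hole (Suc n) ((u + real i) / 3) ((v + real j) / 3) (r / 3)"

lemma mem_osq_sub: "sub i j w \<in> osq ((u + real i) / 3) ((v + real j) / 3) (r / 3) \<longleftrightarrow> w \<in> osq u v r"
  and mem_csq_sub: "sub i j w \<in> csq ((u + real i) / 3) ((v + real j) / 3) (r / 3) \<longleftrightarrow> w \<in> csq u v r"
proof -
  have e: "(u + x) / 3 - r / 3 = (u - r + x) / 3" "(u + x) / 3 + r / 3 = (u + r + x) / 3" for u x r :: real
    by (simp_all add: add_divide_distrib diff_divide_distrib)
  have l: "(a + x) / 3 < (b + x) / 3 \<longleftrightarrow> a < b" "(a + x) / 3 \<le> (b + x) / 3 \<longleftrightarrow> a \<le> b" for a b x :: real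
    by auto
  show "sub i j w \<in> osq ((u + real i) / 3) ((v + real j) / 3) (r / 3) \<longleftrightarrow> w \<in> osq u v r"
    unfolding mem_osq sub_def fst_conv snd_conv e l ..
  show "sub i j w \<in> csq ((u + real i) / 3) ((v + real j) / 3) (r / 3) \<longleftrightarrow> w \<in> csq u v r"
    unfolding mem_csq sub_def fst_conv snd_conv e l ..
qed

lemma sub_surj: "\<exists>w. z = sub i j w"
  by (rule exI[of _ "(3 * fst z - real i, 3 * snd z - real j)"]) (simp add: sub_def)

lemma digits_le: "(i, j) \<in> digits \<Longrightarrow> real i \<le> 2 \<and> real j \<le> 2"
  by (auto simp: digits_def)

definition open_square :: "(real \<times> real) set" where
  "open_square = {z. 0 < fst z \<and> fst z < 1 \<and> 0 < snd z \<and> snd z < 1}"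

lemma hole_subset: "hole n u v r \<Longrightarrow> csq u v r \<subseteq> open_square \<and> r = 1 / (6 * 3 ^ n)"
proof (induction rule: hole.induct)
  case hole_0
  show ?case by (auto simp: mem_csq open_square_def)
next
  case (hole_Suc i j n u v r)
  have "z \<in> open_square" if z: "z \<in> csq ((u + real i) / 3) ((v + real j) / 3) (r / 3)" for z
  proof -
    obtain w where w: "z = sub i j w" using sub_surj by blast
    then have "w \<in> open_square" using z mem_csq_sub hole_Suc.IH by blast
    then show ?thesis using digits_le[OF hole_Suc.hyps(1)] by (simp add: w sub_def open_square_def)
  qed
  then show ?case using hole_Suc.IH by (auto simp: mult.commute)
qed

lemma hole_radius_pos: "hole n u v r \<Longrightarrow> 0 < r"
  using hole_subset by fastforce

lemma nat_eq_of_close: "\<bar>real i - real k\<bar> < 1 \<Longrightarrow> i = k"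
  by linarith

text \<open>Two squares of the ring overlap at most in their boundaries, so a point interior to one
  of them has a single address. This ties every noncentral hole to one square.\<close>

lemma sub_eq_interior:
  assumes "w \<in> open_square" "0 \<le> fst v" "fst v \<le> 1" "0 \<le> snd v" "snd v \<le> 1" "sub i j w = sub k l v"
  shows "i = k \<and> j = l \<and> w = v"
proof -
  have e: "fst w + real i = fst v + real k" "snd w + real j = snd v + real l"
    using assms(6) by (simp_all add: sub_def)
  moreover have "0 < fst w" "fst w < 1" "0 < snd w" "snd w < 1" using assms(1) by (simp_all add: open_square_def)
  ultimately have "\<bar>real i - real k\<bar> < 1" "\<bar>real j - real l\<bar> < 1" using assms(2-5) by linarith+
  then have "i = k" "j = l" using nat_eq_of_close by blast+
  then show ?thesis using e by (simp add: prod_eq_iff)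
qed

lemma osq_subset_csq: "osq u v r \<subseteq> csq u v r"
  by (auto simp: mem_osq mem_csq)

lemma middle_digit:
  assumes "0 \<le> x" "x \<le> 1" "1 < x + real i" "x + real i < 2"
  shows "i = 1"
proof -
  have "\<bar>real i - real 1\<bar> < 1" using assms by simp
  then show ?thesis by (rule nat_eq_of_close)
qed

lemma hole_disjoint_carpet: "hole n u v r \<Longrightarrow> z \<in> osq u v r \<Longrightarrow> z \<notin> standard_carpet"
proof (induction arbitrary: z rule: hole.induct)
  case hole_0
  show ?case
  proof
    assume "z \<in> standard_carpet"
    then obtain i j w where w: "(i, j) \<in> digits" "w \<in> standard_carpet" "z = sub i j w" by (rule carpet_cases)
    have "1 < fst w + real i" "fst w + real i < 2" "1 < snd w + real j" "snd w + real j < 2"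
      using hole_0 by (simp_all add: mem_osq w(3) sub_def)
    then have "i = 1" "j = 1" using carpet_bounds[OF w(2)] middle_digit by blast+
    then show False using w(1) by (simp add: digits_def)
  qed
next
  case (hole_Suc i j n u v r)
  obtain w where w: "z = sub i j w" using sub_surj by blast
  then have wo: "w \<in> osq u v r" using hole_Suc.prems mem_osq_sub by blast
  then have wi: "w \<in> open_square" using hole_subset[OF hole_Suc.hyps(2)] osq_subset_csq by blast
  show ?case
  proof
    assume "z \<in> standard_carpet"
    then obtain k l v where v: "(k, l) \<in> digits" "v \<in> standard_carpet" "z = sub k l v" by (rule carpet_cases)
    then have "w = v" using sub_eq_interior[OF wi carpet_bounds[OF v(2)]] w by simp
    then show False using hole_Suc.IH[OF wo] v(2) by simp
  qed
qed

lemma square_edge_sub_carpet: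
  "(i, j) \<in> digits \<Longrightarrow> w \<in> square_edge \<Longrightarrow> sub i j w \<in> standard_carpet"
  using sub_carpet square_edge_subset_carpet by blast

text \<open>Each side of the central hole is a side of an adjacent square of the ring, and the edge
  of that square belongs to its copy of the carpet.\<close>

lemma hole_frontier_carpet: "hole n u v r \<Longrightarrow> csq u v r - osq u v r \<subseteq> standard_carpet"
proof (induction rule: hole.induct)
  case hole_0
  show ?case
  proof
    fix z assume z: "z \<in> csq (1/2) (1/2) (1/6) - osq (1/2) (1/2) (1/6)"
    have s: "z = sub i j (3 * fst z - real i, 3 * snd z - real j)" for i j by (simp add: sub_def)
    have b: "1/3 \<le> fst z" "fst z \<le> 2/3" "1/3 \<le> snd z" "snd z \<le> 2/3" using z by (simp_all add: mem_csq)
    moreover have "fst z = 1/3 \<or> fst z = 2/3 \<or> snd z = 1/3 \<or> snd z = 2/3"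
      using z b by (simp add: mem_osq) linarith
    ultimately consider "fst z = 1/3" | "fst z = 2/3" | "snd z = 1/3" | "snd z = 2/3" by blast
    then show "z \<in> standard_carpet"
    proof cases
      case 1
      have "(3 * fst z - real 0, 3 * snd z - real 1) \<in> square_edge" using 1 b by (simp add: square_edge_def)
      then have "sub 0 1 (3 * fst z - real 0, 3 * snd z - real 1) \<in> standard_carpet"
        by (rule square_edge_sub_carpet[rotated]) (simp add: digits_eq)
      then show ?thesis using s[of 0 1] by (simp only:)
    next
      case 2
      have "(3 * fst z - real 2, 3 * snd z - real 1) \<in> square_edge" using 2 b by (simp add: square_edge_def)
      then have "sub 2 1 (3 * fst z - real 2, 3 * snd z - real 1) \<in> standard_carpet"
        by (rule square_edge_sub_carpet[rotated]) (simp add: digits_eq)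
      then show ?thesis using s[of 2 1] by (simp only:)
    next
      case 3
      have "(3 * fst z - real 1, 3 * snd z - real 0) \<in> square_edge" using 3 b by (simp add: square_edge_def)
      then have "sub 1 0 (3 * fst z - real 1, 3 * snd z - real 0) \<in> standard_carpet"
        by (rule square_edge_sub_carpet[rotated]) (simp add: digits_eq)
      then show ?thesis using s[of 1 0] by (simp only:)
    next
      case 4
      have "(3 * fst z - real 1, 3 * snd z - real 2) \<in> square_edge" using 4 b by (simp add: square_edge_def)
      then have "sub 1 2 (3 * fst z - real 1, 3 * snd z - real 2) \<in> standard_carpet"
        by (rule square_edge_sub_carpet[rotated]) (simp add: digits_eq)
      then show ?thesis using s[of 1 2] by (simp only:)
    qed
  qed
next
  case (hole_Suc i j n u v r)
  show ?case
  proof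
    fix z assume z: "z \<in> csq ((u + real i) / 3) ((v + real j) / 3) (r / 3) - osq ((u + real i) / 3) ((v + real j) / 3) (r / 3)"
    obtain w where w: "z = sub i j w" using sub_surj by blast
    have "w \<in> csq u v r - osq u v r" using z unfolding w Diff_iff mem_osq_sub mem_csq_sub .
    then show "z \<in> standard_carpet" unfolding w using hole_Suc.IH hole_Suc.hyps(1) sub_carpet by blast
  qed
qed

lemma middle_digit_closed:
  assumes "0 < x" "x < 1" "1 \<le> x + real i" "x + real i \<le> 2"
  shows "i = 1"
proof -
  have "\<bar>real i - real 1\<bar> < 1" using assms by simp
  then show ?thesis by (rule nat_eq_of_close)
qed

lemma holes_disjoint_0:
  assumes "(i, j) \<in> digits" "w \<in> open_square" "sub i j w \<in> csq (1/2) (1/2) (1/6)"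
  shows False
proof -
  have "1 \<le> fst w + real i" "fst w + real i \<le> 2" "1 \<le> snd w + real j" "snd w + real j \<le> 2"
    using assms(3) by (simp_all add: mem_csq sub_def)
  then have "i = 1" "j = 1" using assms(2) middle_digit_closed unfolding open_square_def by blast+
  then show False using assms(1) by (simp add: digits_def)
qed

lemma holes_disjoint:
  "hole n u v r \<Longrightarrow> hole m u' v' r' \<Longrightarrow> z \<in> csq u v r \<Longrightarrow> z \<in> csq u' v' r' \<Longrightarrow> u = u' \<and> v = v' \<and> r = r'"
proof (induction arbitrary: m u' v' r' z rule: hole.induct)
  case hole_0
  from hole_0.prems(1) show ?case
  proof cases
    case (hole_Suc i j n u v r)
    obtain w where w: "z = sub i j w" using sub_surj by blast
    have "w \<in> csq u v r" using hole_0.prems(3) unfolding hole_Suc w mem_csq_sub .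
    then have "w \<in> open_square" using hole_subset[OF hole_Suc(6)] by blast
    then show ?thesis using holes_disjoint_0[OF hole_Suc(5)] hole_0.prems(2) unfolding w by blast
  qed simp
next
  case (hole_Suc i j n u v r)
  obtain w where w: "z = sub i j w" using sub_surj by blast
  have wc: "w \<in> csq u v r" using hole_Suc.prems(2) unfolding w mem_csq_sub .
  then have wi: "w \<in> open_square" using hole_subset[OF hole_Suc.hyps(2)] by blast
  from hole_Suc.prems(1) show ?case
  proof cases
    case hole_0
    then show ?thesis using holes_disjoint_0[OF hole_Suc.hyps(1) wi] hole_Suc.prems(3) unfolding w by blast
  next
    case h: (hole_Suc i' j' n' u2 v2 r2)
    obtain w' where w': "z = sub i' j' w'" using sub_surj by blast
    have wc': "w' \<in> csq u2 v2 r2" using hole_Suc.prems(3) unfolding h w' mem_csq_sub .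
    then have "w' \<in> open_square" using hole_subset[OF h(6)] by blast
    then have "i = i' \<and> j = j' \<and> w = w'"
      using w w' by (intro sub_eq_interior[OF wi]) (simp_all add: open_square_def)
    then show ?thesis using hole_Suc.IH[OF h(6) wc] wc' h by simp
  qed
qed

text \<open>A point missing from some level lies in the central hole, or in a square of the ring
  where the rescaled point is missing from the level before. The closed middle square adds nothing
  else, since its boundary is in the carpet.\<close>

lemma carpet_complement:
  assumes "z \<in> {0..1} \<times> {0..1}" "z \<notin> standard_carpet"
  shows "\<exists>n u v r. hole n u v r \<and> z \<in> osq u v r"
proof -
  have "z \<in> {0..1} \<times> {0..1} \<Longrightarrow> z \<notin> level_carpet n \<Longrightarrow> \<exists>n u v r. hole n u v r \<and> z \<in> osq u v r" for n z
  proof (induction n arbitrary: z)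
    case 0
    then show ?case unfolding level_carpet_0 by blast
  next
    case (Suc n)
    show ?case
    proof (cases "z \<in> osq (1/2) (1/2) (1/6)")
      case True
      then show ?thesis using hole_0 by blast
    next
      case False
      have zT: "z \<notin> standard_carpet" using Suc.prems(2) unfolding mem_carpet_iff by blast
      have zb: "0 \<le> fst z" "fst z \<le> 1" "0 \<le> snd z" "snd z \<le> 1" using Suc.prems(1) by (simp_all add: mem_Times_iff)
      obtain i where i: "i < 3" "0 \<le> 3 * fst z - real i" "3 * fst z - real i \<le> 1" using third_cases[OF zb(1,2)] .
      obtain j where j: "j < 3" "0 \<le> 3 * snd z - real j" "3 * snd z - real j \<le> 1" using third_cases[OF zb(3,4)] .
      define w where "w = (3 * fst z - real i, 3 * snd z - real j)"
      have w: "z = sub i j w" by (simp add: sub_def w_def)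
      have d: "(i, j) \<in> digits"
      proof (rule ccontr)
        assume "(i, j) \<notin> digits"
        then have "i = 1" "j = 1" using i(1) j(1) unfolding digits_def by auto
        then have "z \<in> csq (1/2) (1/2) (1/6)" using i j by (simp add: mem_csq)
        then have "z \<in> standard_carpet" using False hole_frontier_carpet[OF hole_0] by blast
        then show False using zT by simp
      qed
      have "w \<notin> level_carpet n" using Suc.prems(2) d w unfolding level_carpet_Suc_iff by blast
      moreover have "w \<in> {0..1} \<times> {0..1}" using i j by (simp add: w_def)
      ultimately obtain m u v r where h: "hole m u v r" "w \<in> osq u v r" using Suc.IH by blast
      have "z \<in> osq ((u + real i) / 3) ((v + real j) / 3) (r / 3)" unfolding w mem_osq_sub by (rule h)
      then show ?thesis using hole_Suc[OF d h(1)] by blast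
    qed
  qed
  then show ?thesis using assms unfolding mem_carpet_iff by blast
qed

lemma dist_sub: "dist (sub i j p) (sub i j q) = dist p q / 3"
proof -
  have "dist (sub i j p) (sub i j q) = sqrt (((fst p - fst q) / 3)\<^sup>2 + ((snd p - snd q) / 3)\<^sup>2)"
    unfolding dist_prod_def sub_def fst_conv snd_conv dist_real_def power2_abs
    by (rule arg_cong[of _ _ sqrt]) (simp add: diff_divide_distrib[symmetric])
  also have "\<dots> = sqrt (((fst p - fst q)\<^sup>2 + (snd p - snd q)\<^sup>2) / 3\<^sup>2)" by (simp add: power_divide add_divide_distrib)
  also have "\<dots> = sqrt ((fst p - fst q)\<^sup>2 + (snd p - snd q)\<^sup>2) / 3" by (simp add: real_sqrt_divide)
  finally show ?thesis unfolding dist_prod_def dist_real_def power2_abs .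
qed

lemma hole_near:
  "p \<in> standard_carpet \<Longrightarrow> \<exists>u v r. hole n u v r \<and> (\<forall>q\<in>csq u v r. dist p q \<le> 2 / 3 ^ n)"
proof (induction n arbitrary: p)
  case 0
  have "dist p q \<le> 2" if "q \<in> csq (1/2) (1/2) (1/6)" for q
  proof -
    have "q \<in> open_square" using that hole_subset[OF hole_0] by blast
    then have "\<bar>fst p - fst q\<bar> \<le> 1" "\<bar>snd p - snd q\<bar> \<le> 1"
      using carpet_bounds[OF 0] by (auto simp: open_square_def)
    moreover have "dist p q \<le> \<bar>fst p - fst q\<bar> + \<bar>snd p - snd q\<bar>"
      unfolding dist_prod_def dist_real_def by (rule sqrt_sum_squares_le_sum_abs[THEN order_trans]) simp
    ultimately show ?thesis by linarith
  qed
  then show ?case using hole_0 by force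
next
  case (Suc n)
  obtain i j w where w: "(i, j) \<in> digits" "w \<in> standard_carpet" "p = sub i j w" using Suc.prems by (rule carpet_cases)
  obtain u v r where h: "hole n u v r" "\<And>q. q \<in> csq u v r \<Longrightarrow> dist w q \<le> 2 / 3 ^ n" using Suc.IH[OF w(2)] by blast
  have "dist p q \<le> 2 / 3 ^ Suc n" if q: "q \<in> csq ((u + real i) / 3) ((v + real j) / 3) (r / 3)" for q
  proof -
    obtain q' where q': "q = sub i j q'" using sub_surj by blast
    have "dist w q' \<le> 2 / 3 ^ n" using h(2) q unfolding q' mem_csq_sub by blast
    then show ?thesis unfolding w(3) q' dist_sub by simp
  qed
  then show ?case using hole_Suc[OF w(1) h(1)] by blast
qed

lemma finite_holes: "finite {(u, v, r). hole n u v r}"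
proof (induction n)
  case 0
  have "{(u, v, r). hole 0 u v r} \<subseteq> {(1/2, 1/2, 1/6)}" by (auto elim: hole.cases)
  then show ?case by (rule finite_subset) simp
next
  case (Suc n)
  have "{(u, v, r). hole (Suc n) u v r} \<subseteq>
      (\<lambda>((i, j), (u, v, r)). ((u + real i) / 3, (v + real j) / 3, r / 3)) ` (digits \<times> {(u, v, r). hole n u v r})"
  proof
    fix q assume "q \<in> {(u, v, r). hole (Suc n) u v r}"
    then obtain u v r where q: "q = (u, v, r)" "hole (Suc n) u v r" by blast
    from q(2) obtain i j u' v' r' where "(i, j) \<in> digits" "hole n u' v' r'" "q = ((u' + real i) / 3, (v' + real j) / 3, r' / 3)"
      unfolding q(1) by (cases rule: hole.cases) blast+
    then show "q \<in> (\<lambda>((i, j), (u, v, r)). ((u + real i) / 3, (v + real j) / 3, r / 3)) ` (digits \<times> {(u, v, r). hole n u v r})"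
      by (intro image_eqI[of _ _ "((i, j), (u', v', r'))"]) simp_all
  qed
  moreover have "finite digits" by (simp add: digits_eq)
  ultimately show ?case using Suc by (meson finite_SigmaI finite_imageI finite_subset)
qed

text \<open>The closed central square takes one corner from each of the four corner copies and one
  edge from each of the four others. What remains of each copy is connected, and the joints of
  \<open>connected_ring\<close> are untouched.\<close>

lemma connected_minus_central_hole: "connected (standard_carpet - csq (1/2) (1/2) (1/6))"
proof -
  let ?T = standard_carpet
  define X where "X i j = {w \<in> ?T. sub i j w \<notin> csq (1/2) (1/2) (1/6)}" for i j
  have X_eq: "X i j = {w \<in> ?T. P w}" if "\<And>w. w \<in> ?T \<Longrightarrow> sub i j w \<notin> csq (1/2) (1/2) (1/6) \<longleftrightarrow> P w" for i j P
    unfolding X_def using that by blast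
  have X: "X 0 0 = {w \<in> ?T. w \<noteq> (1, 1)}" "X 1 0 = {w \<in> ?T. snd w \<noteq> 1}" "X 2 0 = {w \<in> ?T. w \<noteq> (0, 1)}"
    "X 2 1 = {w \<in> ?T. fst w \<noteq> 0}" "X 2 2 = {w \<in> ?T. w \<noteq> (0, 0)}" "X 1 2 = {w \<in> ?T. snd w \<noteq> 0}"
    "X 0 2 = {w \<in> ?T. w \<noteq> (1, 0)}" "X 0 1 = {w \<in> ?T. fst w \<noteq> 1}"
  proof -
    show "X 0 0 = {w \<in> ?T. w \<noteq> (1, 1)}" by (rule X_eq) (frule carpet_bounds(1), frule carpet_bounds(2), frule carpet_bounds(3), frule carpet_bounds(4),
        auto simp: mem_csq sub_def prod_eq_iff)
    show "X 1 0 = {w \<in> ?T. snd w \<noteq> 1}" by (rule X_eq) (frule carpet_bounds(1), frule carpet_bounds(2), frule carpet_bounds(3), frule carpet_bounds(4),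
        auto simp: mem_csq sub_def prod_eq_iff)
    show "X 2 0 = {w \<in> ?T. w \<noteq> (0, 1)}" by (rule X_eq) (frule carpet_bounds(1), frule carpet_bounds(2), frule carpet_bounds(3), frule carpet_bounds(4),
        auto simp: mem_csq sub_def prod_eq_iff)
    show "X 2 1 = {w \<in> ?T. fst w \<noteq> 0}" by (rule X_eq) (frule carpet_bounds(1), frule carpet_bounds(2), frule carpet_bounds(3), frule carpet_bounds(4),
        auto simp: mem_csq sub_def prod_eq_iff)
    show "X 2 2 = {w \<in> ?T. w \<noteq> (0, 0)}" by (rule X_eq) (frule carpet_bounds(1), frule carpet_bounds(2), frule carpet_bounds(3), frule carpet_bounds(4),
        auto simp: mem_csq sub_def prod_eq_iff)
    show "X 1 2 = {w \<in> ?T. snd w \<noteq> 0}" by (rule X_eq) (frule carpet_bounds(1), frule carpet_bounds(2), frule carpet_bounds(3), frule carpet_bounds(4),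
        auto simp: mem_csq sub_def prod_eq_iff)
    show "X 0 2 = {w \<in> ?T. w \<noteq> (1, 0)}" by (rule X_eq) (frule carpet_bounds(1), frule carpet_bounds(2), frule carpet_bounds(3), frule carpet_bounds(4),
        auto simp: mem_csq sub_def prod_eq_iff)
    show "X 0 1 = {w \<in> ?T. fst w \<noteq> 1}" by (rule X_eq) (frule carpet_bounds(1), frule carpet_bounds(2), frule carpet_bounds(3), frule carpet_bounds(4),
        auto simp: mem_csq sub_def prod_eq_iff)
  qed
  have "connected (X i j)" if "(i, j) \<in> digits" for i j
    using that X connected_minus_edge connected_minus_corner[of 1 1] connected_minus_corner[of 0 1]
      connected_minus_corner[of 0 0] connected_minus_corner[of 1 0]
    unfolding digits_eq by (elim insertE) simp_all
  then have "connected (\<Union>(i, j)\<in>digits. sub i j ` X i j)"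
    by (rule connected_ring) (simp_all add: X[simplified])
  moreover have "?T - csq (1/2) (1/2) (1/6) = (\<Union>(i, j)\<in>digits. sub i j ` X i j)"
  proof (intro equalityI subsetI)
    fix z assume z: "z \<in> ?T - csq (1/2) (1/2) (1/6)"
    then have "z \<in> ?T" by blast
    then obtain i j w where w: "(i, j) \<in> digits" "w \<in> ?T" "z = sub i j w" by (rule carpet_cases)
    then have "w \<in> X i j" using z by (simp add: X_def)
    then show "z \<in> (\<Union>(i, j)\<in>digits. sub i j ` X i j)" unfolding mem_UN_digits using w by blast
  next
    fix z assume "z \<in> (\<Union>(i, j)\<in>digits. sub i j ` X i j)"
    then obtain i j w where "(i, j) \<in> digits" "w \<in> X i j" "z = sub i j w" unfolding mem_UN_digits by blast
    then show "z \<in> ?T - csq (1/2) (1/2) (1/6)" using sub_carpet by (simp add: X_def)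
  qed
  ultimately show ?thesis by simp
qed

text \<open>In the inductive step only the copy containing the hole changes, and it keeps its
  corners because the closed hole lies in the open square.\<close>

lemma connected_minus_hole: "hole n u v r \<Longrightarrow> connected (standard_carpet - csq u v r)"
proof (induction rule: hole.induct)
  case hole_0
  show ?case by (rule connected_minus_central_hole)
next
  case (hole_Suc i j n u v r)
  let ?T = standard_carpet and ?c = "csq ((u + real i) / 3) ((v + real j) / 3) (r / 3)"
  define X where "X k l = (if (k, l) = (i, j) then ?T - csq u v r else ?T)" for k l
  note sub_sq = hole_subset[OF hole_Suc.hyps(2), THEN conjunct1]
  have pts: "p \<in> X k l" if "p \<in> {(0,0), (0,1), (1,0), (1,1)}" for p k l
  proof -
    have "p \<notin> open_square" "p \<in> ?T" using that by (auto simp: open_square_def)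
    then show ?thesis using sub_sq by (auto simp: X_def)
  qed
  have "connected (\<Union>(k, l)\<in>digits. sub k l ` X k l)"
    by (rule connected_ring) (simp_all add: pts, simp add: X_def connected_carpet hole_Suc.IH)
  moreover have "?T - ?c = (\<Union>(k, l)\<in>digits. sub k l ` X k l)"
  proof (intro equalityI subsetI)
    fix z assume z: "z \<in> ?T - ?c"
    then have "z \<in> ?T" by blast
    then obtain k l w where w: "(k, l) \<in> digits" "w \<in> ?T" "z = sub k l w" by (rule carpet_cases)
    have "w \<notin> csq u v r" if "(k, l) = (i, j)" using z that w(3) mem_csq_sub[of i j w] by simp
    then have "w \<in> X k l" using w(2) by (simp add: X_def)
    then show "z \<in> (\<Union>(k, l)\<in>digits. sub k l ` X k l)" unfolding mem_UN_digits using w by blast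
  next
    fix z assume "z \<in> (\<Union>(k, l)\<in>digits. sub k l ` X k l)"
    then obtain k l w where w: "(k, l) \<in> digits" "w \<in> X k l" "z = sub k l w" unfolding mem_UN_digits by blast
    have wT: "w \<in> ?T" using w(2) by (simp add: X_def split: if_splits)
    have "z \<notin> ?c"
    proof
      assume zc: "z \<in> ?c"
      obtain w' where w': "z = sub i j w'" using sub_surj by blast
      have "w' \<in> csq u v r" using zc unfolding w' mem_csq_sub .
      moreover from this have "i = k \<and> j = l \<and> w' = w"
        using sub_sq w(3) w' by (intro sub_eq_interior[OF _ carpet_bounds[OF wT]]) auto
      ultimately show False using w(2) by (simp add: X_def)
    qed
    then show "z \<in> ?T - ?c" using sub_carpet[OF w(1) wT] w(3) by simp
  qed
  ultimately show ?case by simp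
qed

section \<open>The peripheral circles of the standard carpet\<close>

lemma homeomorphic_iff_homeomorphic_space:
  "S homeomorphic T \<longleftrightarrow> top_of_set S homeomorphic_space top_of_set T"
proof
  assume "S homeomorphic T"
  then obtain f g where "homeomorphism S T f g" by (auto simp: homeomorphic_def)
  then have "homeomorphic_maps (top_of_set S) (top_of_set T) f g"
    by (force simp: homeomorphism_def homeomorphic_maps_def)
  then show "top_of_set S homeomorphic_space top_of_set T" by (auto simp: homeomorphic_space_def)
next
  assume "top_of_set S homeomorphic_space top_of_set T"
  then obtain f g where "homeomorphic_maps (top_of_set S) (top_of_set T) f g" by (auto simp: homeomorphic_space_def)
  then have "homeomorphism S T f g"
    by (auto simp: homeomorphism_def homeomorphic_maps_def continuous_map_in_subtopology image_subset_iff) force+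
  then show "S homeomorphic T" by (auto simp: homeomorphic_def)
qed

definition square_circle :: "real \<Rightarrow> real \<Rightarrow> real \<Rightarrow> (real \<times> real) set" where
  "square_circle u v r = csq u v r - osq u v r"

lemma frontier_csq: "frontier (csq u v r) = square_circle u v r"
  by (simp add: frontier_def csq_def osq_def square_circle_def closure_Times interior_Times)

lemma frontier_osq: "0 < r \<Longrightarrow> frontier (osq u v r) = square_circle u v r"
  by (simp add: frontier_def csq_def osq_def square_circle_def closure_Times interior_open open_Times closure_greaterThanLessThan)

lemma square_circle_homeomorphic:
  assumes "0 < r"
  shows "square_circle u v r homeomorphic sphere (0::complex) 1"
proof -
  have int: "interior (csq u v r) = osq u v r" by (simp add: csq_def osq_def interior_Times)
  have ne: "(u, v) \<in> osq u v r" using assms by (simp add: mem_osq)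
  have "rel_frontier (csq u v r) homeomorphic rel_frontier (cball (0::complex) 1)"
  proof (rule homeomorphic_rel_frontiers_convex_bounded_sets)
    show "convex (csq u v r)" by (simp add: csq_def convex_Times)
    show "bounded (csq u v r)" by (simp add: csq_def bounded_Times)
    have "aff_dim (csq u v r) = int DIM(real \<times> real)"
      using ne int by (intro aff_dim_nonempty_interior) auto
    moreover have "aff_dim (cball (0::complex) 1) = int DIM(complex)" by (intro aff_dim_nonempty_interior) auto
    ultimately show "aff_dim (csq u v r) = aff_dim (cball (0::complex) 1)" by simp
  qed auto
  moreover have "rel_frontier (csq u v r) = square_circle u v r"
    using rel_frontier_nonempty_interior[of "csq u v r"] ne int by (auto simp: frontier_csq)
  ultimately show ?thesis by simp
qed

lemma square_circle_peripheral:
  assumes h: "hole n u v r"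
  shows "square_circle u v r \<in> peripheral_circles (top_of_set standard_carpet)"
proof -
  have sub: "square_circle u v r \<subseteq> standard_carpet"
    using hole_frontier_carpet[OF h] by (simp add: square_circle_def)
  have "standard_carpet - square_circle u v r = standard_carpet - csq u v r"
    using hole_disjoint_carpet[OF h] osq_subset_csq by (auto simp: square_circle_def)
  then have conn: "connected (standard_carpet - square_circle u v r)" using connected_minus_hole[OF h] by simp
  have "top_of_set (square_circle u v r) homeomorphic_space top_of_set (sphere (0::complex) 1)"
    using square_circle_homeomorphic[OF hole_radius_pos[OF h]] by (simp add: homeomorphic_iff_homeomorphic_space)
  moreover have "subtopology (top_of_set standard_carpet) (square_circle u v r) = top_of_set (square_circle u v r)"
    using sub by (simp add: subtopology_subtopology Int_absorb1)
  ultimately show ?thesis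
    using sub conn by (simp add: peripheral_circles_def connectedin_subtopology)
qed

text \<open>A complementary component of \<open>S\<close> that misses the carpet has its frontier \<open>S\<close> in the carpet,
  so it coincides with a complementary component of the carpet.\<close>

lemma peripheral_circle_cases:
  assumes "S \<in> peripheral_circles (top_of_set standard_carpet)"
  shows "S = square_circle (1/2) (1/2) (1/2) \<or> (\<exists>n u v r. hole n u v r \<and> S = square_circle u v r)"
proof -
  let ?T = standard_carpet
  have ST: "S \<subseteq> ?T" using assms by (auto simp: peripheral_circles_def)
  have st: "subtopology (top_of_set ?T) S = top_of_set S" using ST by (simp add: subtopology_subtopology Int_absorb1)
  have "S homeomorphic sphere (0::complex) 1"
    using assms by (simp add: peripheral_circles_def st homeomorphic_iff_homeomorphic_space)
  moreover have "sphere (0::complex) 1 homeomorphic sphere (0::real \<times> real) 1" by (rule homeomorphic_spheres_gen) auto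
  ultimately have hom: "S homeomorphic sphere (0::real \<times> real) 1" by (rule homeomorphic_trans)
  have "connected (?T - S)" using assms by (simp add: peripheral_circles_def connectedin_subtopology)
  have nc: "\<not> connected (- S)" using Jordan_Brouwer_separation[OF hom] by simp
  have "compact S" using homeomorphic_compactness[OF hom] by simp
  then have "open (- S)" by (simp add: compact_imp_closed open_Compl)
  \<comment> \<open>By the Jordan-Brouwer theorem the complement of \<open>S\<close> has at least
    two components, and the connected set \<open>?T - S\<close> lies in only one of them.\<close>
  obtain U where U: "U \<in> components (- S)" "U \<inter> ?T = {}"
  proof (cases "?T - S = {}")
    case True
    have "- S \<noteq> {}" using nc by auto
    then obtain U where "U \<in> components (- S)" by (metis all_not_in_conv components_eq_empty)
    moreover from this have "U \<subseteq> - S" by (rule in_components_subset)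
    ultimately show ?thesis using that True by blast
  next
    case False
    then have "- S \<noteq> {}" by blast
    then obtain C where C: "C \<in> components (- S)" "?T - S \<subseteq> C"
      using exists_component_superset[of "?T - S" "- S"] \<open>connected (?T - S)\<close> by blast
    have "components (- S) \<noteq> {C}"
    proof
      assume "components (- S) = {C}"
      then have "- S = C" using Union_components[of "- S"] by simp
      then show False using nc in_components_connected[OF C(1)] by simp
    qed
    then obtain U where U: "U \<in> components (- S)" "U \<noteq> C" using C(1) by blast
    then have "U \<inter> C = {}" using C(1) components_nonoverlap by blast
    moreover have "U \<subseteq> - S" using U(1) by (rule in_components_subset)
    ultimately show ?thesis using that[OF U(1)] C(2) by blast
  qed
  have fU: "frontier U = S" using Jordan_Brouwer_frontier[OF hom U(1)] by simp
  have cU: "connected U" "U \<noteq> {}" using U(1) in_components_connected in_components_nonempty by blast+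
  \<comment> \<open>A connected set that meets another set and avoids its frontier lies inside it;
    applied in both directions this gives \<open>U = V\<close>.\<close>
  have same: "S = frontier V" if V: "connected V" "V \<inter> U \<noteq> {}" "V \<inter> ?T = {}" "frontier V \<subseteq> ?T" for V
  proof -
    have "V \<subseteq> U"
    proof (rule ccontr)
      assume "\<not> V \<subseteq> U"
      then have "V \<inter> frontier U \<noteq> {}" using connected_Int_frontier[OF V(1,2)] by blast
      then show False using fU ST V(3) by blast
    qed
    moreover have "U \<subseteq> V"
    proof (rule ccontr)
      assume "\<not> U \<subseteq> V"
      then have "U \<inter> frontier V \<noteq> {}" using connected_Int_frontier[OF cU(1), of V] V(2) by blast
      then show False using V(4) U(2) by blast
    qed
    ultimately show ?thesis using fU by simp
  qed
  obtain z where z: "z \<in> U" using cU(2) by blast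
  have zT: "z \<notin> ?T" using z U(2) by blast
  have unit: "csq (1/2) (1/2) (1/2) = {0..1} \<times> {0..1}" by (simp add: csq_def)
  show ?thesis
  proof (cases "z \<in> csq (1/2) (1/2) (1/2)")
    case True
    then obtain n u v r where h: "hole n u v r" "z \<in> osq u v r" using carpet_complement[of z] zT unfolding unit by blast
    have "S = frontier (osq u v r)"
    proof (rule same)
      show "connected (osq u v r)" unfolding osq_def by (intro connected_Times) auto
      show "osq u v r \<inter> U \<noteq> {}" using h(2) z by blast
      show "osq u v r \<inter> ?T = {}" using hole_disjoint_carpet[OF h(1)] by blast
      show "frontier (osq u v r) \<subseteq> ?T"
        using hole_frontier_carpet[OF h(1)] frontier_osq[OF hole_radius_pos[OF h(1)]] by (simp add: square_circle_def)
    qed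
    then show ?thesis using frontier_osq[OF hole_radius_pos[OF h(1)]] h(1) by blast
  next
    case False
    have "S = frontier (- csq (1/2) (1/2) (1/2))"
    proof (rule same)
      show "connected (- csq (1/2) (1/2) (1/2))"
        by (rule connected_complement_bounded_convex) (auto simp: csq_def convex_Times bounded_Times)
      show "- csq (1/2) (1/2) (1/2) \<inter> U \<noteq> {}" using False z by blast
      show "- csq (1/2) (1/2) (1/2) \<inter> ?T = {}" using carpet_subset_square unfolding unit by blast
      have "square_circle (1/2) (1/2) (1/2) \<subseteq> square_edge"
        by (auto simp: square_circle_def mem_csq mem_osq square_edge_def)
      then show "frontier (- csq (1/2) (1/2) (1/2)) \<subseteq> ?T"
        using square_edge_subset_carpet by (simp add: frontier_complement frontier_csq)
    qed
    then show ?thesis by (simp add: frontier_complement frontier_csq)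
  qed
qed

lemma carpet_circles_disjoint:
  assumes "S \<in> peripheral_circles (top_of_set standard_carpet)" "S' \<in> peripheral_circles (top_of_set standard_carpet)" "S \<noteq> S'"
  shows "S \<inter> S' = {}"
proof -
  have outer: "square_circle (1/2) (1/2) (1/2) \<inter> square_circle u v r = {}" if "hole n u v r" for n u v r
  proof -
    have "square_circle u v r \<subseteq> open_square" using hole_subset[OF that] by (auto simp: square_circle_def)
    moreover have "open_square \<subseteq> osq (1/2) (1/2) (1/2)" by (auto simp: open_square_def mem_osq)
    ultimately show ?thesis unfolding square_circle_def[of "1/2"] by blast
  qed
  have inner: "square_circle u v r \<inter> square_circle u' v' r' = {}"
    if "hole n u v r" "hole n' u' v' r'" "square_circle u v r \<noteq> square_circle u' v' r'" for n u v r n' u' v' r'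
  proof (rule ccontr)
    assume "square_circle u v r \<inter> square_circle u' v' r' \<noteq> {}"
    then obtain z where "z \<in> csq u v r" "z \<in> csq u' v' r'" by (auto simp: square_circle_def)
    then show False using holes_disjoint[OF that(1,2)] that(3) by blast
  qed
  show ?thesis
    using peripheral_circle_cases[OF assms(1)] peripheral_circle_cases[OF assms(2)]
  proof (elim disjE exE conjE)
    assume "S = square_circle (1/2) (1/2) (1/2)" "S' = square_circle (1/2) (1/2) (1/2)"
    then show ?thesis using assms(3) by simp
  next
    fix n u v r assume "S = square_circle (1/2) (1/2) (1/2)" "hole n u v r" "S' = square_circle u v r"
    then show ?thesis using outer by simp
  next
    fix n u v r assume "S' = square_circle (1/2) (1/2) (1/2)" "hole n u v r" "S = square_circle u v r"
    then show ?thesis using outer by (simp add: Int_commute)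
  next
    fix n u v r n' u' v' r'
    assume "hole n u v r" "S = square_circle u v r" "hole n' u' v' r'" "S' = square_circle u' v' r'"
    then show ?thesis using inner assms(3) by simp
  qed
qed

text \<open>Holes of level \<open>n\<close> have diameter at most \<open>(1/3) ^ n\<close>, so large
  circles come from finitely many levels, and each level has finitely many holes.\<close>

lemma carpet_circles_null:
  assumes "0 < e"
  shows "finite {S \<in> peripheral_circles (top_of_set standard_carpet). \<exists>x\<in>S. \<exists>y\<in>S. e \<le> dist x y}"
proof -
  obtain N where N: "(1/3) ^ N < e" using real_arch_pow_inv[OF assms, of "1/3"] by auto
  have small: "dist x y < e" if h: "hole n u v r" "N \<le> n" and xy: "x \<in> square_circle u v r" "y \<in> square_circle u v r" for n u v r x y
  proof -
    have r: "r = 1 / (6 * 3 ^ n)" using hole_subset[OF h(1)] by blast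
    have "\<bar>fst x - fst y\<bar> \<le> 2 * r" "\<bar>snd x - snd y\<bar> \<le> 2 * r"
      using xy unfolding square_circle_def Diff_iff mem_csq by linarith+
    moreover have "dist x y \<le> \<bar>fst x - fst y\<bar> + \<bar>snd x - snd y\<bar>"
      unfolding dist_prod_def dist_real_def by (rule sqrt_sum_squares_le_sum_abs[THEN order_trans]) simp
    ultimately have "dist x y \<le> 4 * r" by linarith
    also have "\<dots> = 2/3 * (1/3) ^ n" unfolding r by (simp add: power_divide)
    also have "\<dots> \<le> 1 * (1/3) ^ n" by (intro mult_right_mono) auto
    also have "\<dots> = (1/3) ^ n" by simp
    also have "\<dots> \<le> (1/3) ^ N" using h(2) by (intro power_decreasing) auto
    finally show ?thesis using N by linarith
  qed
  let ?F = "insert (square_circle (1/2) (1/2) (1/2)) ((\<lambda>(u, v, r). square_circle u v r) ` (\<Union>n<N. {(u, v, r). hole n u v r}))"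
  have "{S \<in> peripheral_circles (top_of_set standard_carpet). \<exists>x\<in>S. \<exists>y\<in>S. e \<le> dist x y} \<subseteq> ?F"
  proof
    fix S assume S: "S \<in> {S \<in> peripheral_circles (top_of_set standard_carpet). \<exists>x\<in>S. \<exists>y\<in>S. e \<le> dist x y}"
    then obtain x y where xy: "x \<in> S" "y \<in> S" "e \<le> dist x y" by blast
    from S have "S = square_circle (1/2) (1/2) (1/2) \<or> (\<exists>n u v r. hole n u v r \<and> S = square_circle u v r)"
      using peripheral_circle_cases by blast
    then show "S \<in> ?F"
    proof (elim disjE exE conjE)
      fix n u v r assume h: "hole n u v r" "S = square_circle u v r"
      have "n < N" using small[OF h(1) _ xy(1,2)[unfolded h(2)]] xy(3) by (meson not_le)
      then have "(u, v, r) \<in> (\<Union>n<N. {(u, v, r). hole n u v r})" using h(1) by blast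
      then have "(\<lambda>(u, v, r). square_circle u v r) (u, v, r) \<in> (\<lambda>(u, v, r). square_circle u v r) ` (\<Union>n<N. {(u, v, r). hole n u v r})"
        by (rule imageI)
      then show ?thesis unfolding h(2) by simp
    qed simp
  qed
  moreover have "finite ?F" using finite_holes by simp
  ultimately show ?thesis by (rule finite_subset)
qed

lemma carpet_circles_dense:
  assumes "p \<in> standard_carpet" "0 < e"
  shows "\<exists>S\<in>peripheral_circles (top_of_set standard_carpet). S \<subseteq> ball p e"
proof -
  have "0 < e / 2" using assms(2) by simp
  then obtain n where n: "(1/3) ^ n < e / 2" using real_arch_pow_inv[of "e / 2" "1/3"] by auto
  obtain u v r where h: "hole n u v r" "\<forall>q\<in>csq u v r. dist p q \<le> 2 / 3 ^ n" using hole_near[OF assms(1)] by blast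
  have "2 / 3 ^ n < e" using n by (simp add: power_divide)
  then have "square_circle u v r \<subseteq> ball p e" using h(2) unfolding square_circle_def by (force simp: subset_iff)
  then show ?thesis using square_circle_peripheral[OF h(1)] by blast
qed

section \<open>Carpets with an expanding family of homeomorphisms\<close>

lemma peripheral_circles_image:
  assumes g: "homeomorphic_map X Y g" and S: "S \<in> peripheral_circles X"
  shows "g ` S \<in> peripheral_circles Y"
proof -
  have SX: "S \<subseteq> topspace X" and circ: "subtopology X S homeomorphic_space top_of_set (sphere (0::complex) 1)"
    and conn: "connectedin X (topspace X - S)" using S by (auto simp: peripheral_circles_def)
  have im: "g ` topspace X = topspace Y" and inj: "inj_on g (topspace X)"
    using homeomorphic_imp_surjective_map[OF g] homeomorphic_imp_injective_map[OF g] by auto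
  have gS: "g ` S \<subseteq> topspace Y" using im SX by blast
  have "homeomorphic_map (subtopology X S) (subtopology Y (g ` S)) g"
    by (rule homeomorphic_map_subtopologies[OF g]) (use SX gS in \<open>simp add: Int_absorb1\<close>)
  then have "subtopology Y (g ` S) homeomorphic_space subtopology X S"
    using homeomorphic_map_imp_homeomorphic_space homeomorphic_space_sym by blast
  then have "subtopology Y (g ` S) homeomorphic_space top_of_set (sphere (0::complex) 1)"
    using circ homeomorphic_space_trans by blast
  moreover have "g ` (topspace X - S) = topspace Y - g ` S"
    using inj_on_image_set_diff[OF inj _ SX, of "topspace X"] im by simp
  then have "connectedin Y (topspace Y - g ` S)"
    using homeomorphic_map_connectedness[OF g, of "topspace X - S"] conn by simp
  ultimately show ?thesis using gS by (simp add: peripheral_circles_def)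
qed

lemma homeomorphic_map_inverse:
  assumes "homeomorphic_map X Y g"
  shows "\<exists>h. homeomorphic_map Y X h \<and> (\<forall>x\<in>topspace X. h (g x) = x) \<and> (\<forall>y\<in>topspace Y. g (h y) = y)"
proof -
  obtain h where h: "homeomorphic_maps X Y g h" using assms unfolding homeomorphic_map_maps by blast
  then have "homeomorphic_map Y X h" using homeomorphic_maps_map by blast
  then show ?thesis using h unfolding homeomorphic_maps_def by blast
qed

text \<open>By compactness a parametrization and its inverse are uniformly continuous: close points
  of \<open>S\<close> have close parameters, and a short parameter arc has a small image.\<close>

lemma circle_uniformly_locally_connected:
  assumes S: "S \<subseteq> mspace m" and hom: "subtopology (mtopology_of m) S homeomorphic_space top_of_set (sphere (0::complex) 1)"
    and "0 < \<epsilon>"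
  shows "\<exists>\<delta>>0. \<forall>u\<in>S. \<forall>v\<in>S. mdist m u v < \<delta> \<longrightarrow>
    (\<exists>E\<subseteq>S. connectedin (mtopology_of m) E \<and> u \<in> E \<and> v \<in> E \<and> (\<forall>w\<in>E. mdist m u w < \<epsilon>))"
proof -
  let ?C = "submetric euclidean_metric (sphere (0::complex) 1)" and ?S = "submetric m S"
  have tC: "mtopology_of ?C = top_of_set (sphere 0 1)" by (simp add: mtopology_of_submetric)
  have tS: "mtopology_of ?S = subtopology (mtopology_of m) S" by (simp add: mtopology_of_submetric)
  have mS: "mspace ?S = S" using S by auto
  have "top_of_set (sphere (0::complex) 1) homeomorphic_space subtopology (mtopology_of m) S"
    using hom homeomorphic_space_sym by blast
  then obtain \<psi> where \<psi>: "homeomorphic_map (mtopology_of ?C) (mtopology_of ?S) \<psi>"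
    unfolding homeomorphic_space tC tS by blast
  obtain \<xi> where \<xi>: "homeomorphic_map (mtopology_of ?S) (mtopology_of ?C) \<xi>"
    "\<forall>x\<in>topspace (mtopology_of ?C). \<xi> (\<psi> x) = x" "\<forall>y\<in>topspace (mtopology_of ?S). \<psi> (\<xi> y) = y"
    using homeomorphic_map_inverse[OF \<psi>] by blast
  have \<xi>3: "\<psi> (\<xi> y) = y" if "y \<in> S" for y using \<xi>(3) that mS by simp
  have cC: "compact_space (mtopology_of ?C)" unfolding tC by (simp add: compact_space_subtopology)
  have cS: "compact_space (mtopology_of ?S)"
    using homeomorphic_compact_space[OF homeomorphic_map_imp_homeomorphic_space[OF \<psi>]] cC by simp
  have u\<psi>: "uniformly_continuous_map ?C ?S \<psi>" and u\<xi>: "uniformly_continuous_map ?S ?C \<xi>"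
    using cC cS homeomorphic_imp_continuous_map[OF \<psi>] homeomorphic_imp_continuous_map[OF \<xi>(1)]
    by (blast intro: continuous_imp_uniformly_continuous_map)+
  have \<psi>m: "\<psi> x \<in> S" if "x \<in> sphere 0 1" for x using u\<psi> that mS by (auto simp: uniformly_continuous_map_def)
  have \<xi>m: "\<xi> y \<in> sphere 0 1" if "y \<in> S" for y using u\<xi> that mS by (auto simp: uniformly_continuous_map_def)
  obtain \<delta>1 where \<delta>1: "0 < \<delta>1" "\<And>x y. x \<in> sphere 0 1 \<Longrightarrow> y \<in> sphere 0 1 \<Longrightarrow> dist y x < \<delta>1 \<Longrightarrow> mdist m (\<psi> y) (\<psi> x) < \<epsilon>"
  proof -
    have "\<forall>e>0. \<exists>d>0. \<forall>x\<in>sphere 0 1. \<forall>y\<in>sphere 0 1. dist y x < d \<longrightarrow> mdist m (\<psi> y) (\<psi> x) < e"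
      using u\<psi> unfolding uniformly_continuous_map_def mS mdist_submetric mdist_euclidean_metric mspace_submetric
        mspace_euclidean_metric Int_UNIV_right by (rule conjunct2)
    then show ?thesis using that \<open>0 < \<epsilon>\<close> by blast
  qed
  \<comment> \<open>7 exceeds \<open>2 * pi\<close>, the Lipschitz constant of \<open>ecis\<close>
    in \<open>dist_ecis\<close>.\<close>
  have "0 < \<delta>1 / 7" using \<delta>1 by simp
  then obtain \<delta> where \<delta>: "0 < \<delta>" "\<And>x y. x \<in> S \<Longrightarrow> y \<in> S \<Longrightarrow> mdist m y x < \<delta> \<Longrightarrow> dist (\<xi> y) (\<xi> x) < \<delta>1 / 7"
  proof -
    have "\<forall>e>0. \<exists>d>0. \<forall>x\<in>S. \<forall>y\<in>S. mdist m y x < d \<longrightarrow> dist (\<xi> y) (\<xi> x) < e"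
      using u\<xi> unfolding uniformly_continuous_map_def mS mdist_submetric mdist_euclidean_metric by (rule conjunct2)
    then show ?thesis using that \<open>0 < \<delta>1 / 7\<close> by blast
  qed
  have "\<exists>E\<subseteq>S. connectedin (mtopology_of m) E \<and> u \<in> E \<and> v \<in> E \<and> (\<forall>w\<in>E. mdist m u w < \<epsilon>)"
    if uv: "u \<in> S" "v \<in> S" "mdist m u v < \<delta>" for u v
  proof -
    define s where "s = Arg (\<xi> u) / (2 * pi)"
    have s: "ecis s = \<xi> u" unfolding s_def by (rule ecis_surj[OF \<xi>m[OF uv(1)]])
    obtain t where t: "ecis t = \<xi> v" "\<bar>s - t\<bar> \<le> 1/2"
      using ecis_lift[of "Arg (\<xi> v) / (2 * pi)" s] ecis_surj[OF \<xi>m[OF uv(2)]] by auto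
    have st: "\<bar>s - t\<bar> < \<delta>1 / 7"
      using dist_ecis(1)[OF t(2)] \<delta>(2)[OF uv(2,1,3)] unfolding s t(1) by linarith
    define I where "I = ecis ` {min s t..max s t}"
    have I: "I \<subseteq> sphere 0 1" by (auto simp: I_def)
    have "connected I" unfolding I_def by (intro connected_continuous_image continuous_intros) auto
    then have "connectedin (mtopology_of ?C) I" using I by (simp add: tC connectedin_subtopology)
    then have "connectedin (mtopology_of ?S) (\<psi> ` I)"
      using connectedin_continuous_map_image[OF homeomorphic_imp_continuous_map[OF \<psi>]] by blast
    then have "connectedin (mtopology_of m) (\<psi> ` I)" unfolding tS by (simp add: connectedin_subtopology)
    moreover have "\<psi> ` I \<subseteq> S" using I \<psi>m by blast
    moreover have "ecis s \<in> I" "ecis t \<in> I" unfolding I_def by auto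
    then have "u \<in> \<psi> ` I" "v \<in> \<psi> ` I" unfolding s t(1) using \<xi>3[OF uv(1)] \<xi>3[OF uv(2)] by (metis imageI)+
    moreover have "mdist m u w < \<epsilon>" if w: "w \<in> \<psi> ` I" for w
    proof -
      obtain a where a: "a \<in> {min s t..max s t}" "w = \<psi> (ecis a)" using w unfolding I_def by blast
      have "\<bar>s - a\<bar> \<le> \<bar>s - t\<bar>" using a(1) by (auto simp: min_def max_def split: if_splits)
      then have sa: "\<bar>s - a\<bar> < \<delta>1 / 7" "\<bar>s - a\<bar> \<le> 1/2" using st t(2) by linarith+
      have "dist (ecis s) (ecis a) \<le> 2 * pi * \<bar>s - a\<bar>" using dist_ecis(2)[OF sa(2)] .
      also have "\<dots> \<le> 7 * \<bar>s - a\<bar>" using pi_less_4 pi_approx by (intro mult_right_mono) auto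
      also have "\<dots> < \<delta>1" using sa(1) by simp
      finally have "dist (ecis s) (ecis a) < \<delta>1" .
      then have "mdist m (\<psi> (ecis s)) w < \<epsilon>" unfolding a(2) by (intro \<delta>1(2)) auto
      then show ?thesis unfolding s \<xi>3[OF uv(1)] .
    qed
    ultimately show ?thesis by blast
  qed
  then show ?thesis using \<delta>(1) by blast
qed

text \<open>All that is kept of the group is \<open>expand\<close>. Its last clause says that the
  preimage of the ball of radius \<open>1 / L\<close> around \<open>g x\<close> lies in the ball of
  radius \<open>r\<close> around \<open>x\<close>; this is what allows sets found at unit size to be
  pulled back. \<open>\<Delta>\<close> bounds both the distances and the admissible radii.\<close>

locale self_similar_carpet =
  fixes m :: "'a metric" and \<S> :: "'a set set" and L \<Delta> :: real
  assumes compact: "compact_space (mtopology_of m)"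
    and circles: "\<S> = peripheral_circles (mtopology_of m)"
    and disjoint: "S \<in> \<S> \<Longrightarrow> S' \<in> \<S> \<Longrightarrow> S \<noteq> S' \<Longrightarrow> S \<inter> S' = {}"
    and null: "0 < e \<Longrightarrow> finite {S \<in> \<S>. \<exists>x\<in>S. \<exists>y\<in>S. e \<le> mdist m x y}"
    and dense: "openin (mtopology_of m) U \<Longrightarrow> U \<noteq> {} \<Longrightarrow> \<exists>S\<in>\<S>. S \<subseteq> U"
    and L: "1 \<le> L" and \<Delta>: "0 < \<Delta>"
    and diam: "x \<in> mspace m \<Longrightarrow> y \<in> mspace m \<Longrightarrow> mdist m x y \<le> \<Delta>"
    and expand: "x \<in> mspace m \<Longrightarrow> 0 < r \<Longrightarrow> r \<le> \<Delta> \<Longrightarrow>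
      \<exists>g. homeomorphic_map (mtopology_of m) (mtopology_of m) g \<and>
        (\<forall>y\<in>mspace m. \<forall>z\<in>mspace m. mdist m x y < r \<and> mdist m x z < r \<longrightarrow>
           mdist m y z / (L * r) \<le> mdist m (g y) (g z) \<and> mdist m (g y) (g z) \<le> L * mdist m y z / r) \<and>
        (\<forall>y\<in>mspace m. r \<le> mdist m x y \<longrightarrow> 1 / L \<le> mdist m (g x) (g y))"
begin

lemma circle_subset: "S \<in> \<S> \<Longrightarrow> S \<subseteq> mspace m"
  by (auto simp: circles peripheral_circles_def)

lemma circle_hom: "S \<in> \<S> \<Longrightarrow> subtopology (mtopology_of m) S homeomorphic_space top_of_set (sphere (0::complex) 1)"
  by (auto simp: circles peripheral_circles_def)

lemma circle_compact: "S \<in> \<S> \<Longrightarrow> compactin (mtopology_of m) S"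
proof -
  assume S: "S \<in> \<S>"
  have "compact_space (top_of_set (sphere (0::complex) 1))" by (simp add: compact_space_subtopology)
  then show ?thesis
    using homeomorphic_compact_space[OF circle_hom[OF S]] circle_subset[OF S] by (simp add: compactin_subspace)
qed

lemma circle_connected: "S \<in> \<S> \<Longrightarrow> connectedin (mtopology_of m) S"
proof -
  assume S: "S \<in> \<S>"
  have "connected (sphere (0::complex) 1)" by (rule connected_sphere) simp
  then have "connected_space (top_of_set (sphere (0::complex) 1))" using connectedin_iff_connected[of "sphere (0::complex) 1"] by (simp add: connectedin_def)
  then show ?thesis using homeomorphic_connected_space[OF circle_hom[OF S]] circle_subset[OF S] by (simp add: connectedin_def)
qed

lemma two_points: "S \<in> \<S> \<Longrightarrow> \<exists>x\<in>S. \<exists>y\<in>S. 0 < mdist m x y"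
proof -
  assume S: "S \<in> \<S>"
  obtain h where h: "homeomorphic_map (top_of_set (sphere (0::complex) 1)) (subtopology (mtopology_of m) S) h"
    using circle_hom[OF S] homeomorphic_space_sym homeomorphic_space by blast
  have "inj_on h (sphere 0 1)" "h ` sphere 0 1 = S"
    using homeomorphic_imp_injective_map[OF h] homeomorphic_imp_surjective_map[OF h] circle_subset[OF S] by auto
  moreover have "(1::complex) \<in> sphere 0 1" "(-1::complex) \<in> sphere 0 1" by simp_all
  moreover have "(1::complex) \<noteq> -1" by (simp add: complex_eq_iff)
  ultimately have "h 1 \<in> S" "h (-1) \<in> S" "h 1 \<noteq> h (-1)" using inj_onD[of h "sphere 0 1" 1 "-1"] by blast+
  moreover from this have "0 < mdist m (h 1) (h (-1))"
    using mdist_zero[of "h 1" m "h (-1)"] circle_subset[OF S] by (metis less_eq_real_def mdist_nonneg subsetD)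
  ultimately show ?thesis by blast
qed

text \<open>By \<open>null\<close> this family is finite, so a positive constant available for each
  of its members is available for all at once (\<open>finite_common_bound\<close>).\<close>

definition large :: "real \<Rightarrow> 'a set set" where
  "large e = {S \<in> \<S>. \<exists>x\<in>S. \<exists>y\<in>S. e \<le> mdist m x y}"

lemma large_image:
  assumes g: "homeomorphic_map (mtopology_of m) (mtopology_of m) g" and S: "S \<in> \<S>"
    and "x \<in> S" "y \<in> S" "e \<le> mdist m (g x) (g y)"
  shows "g ` S \<in> large e"
proof -
  have "g ` S \<in> \<S>" using peripheral_circles_image[OF g] S by (simp add: circles)
  then show ?thesis unfolding large_def using assms(3-5) by blast
qed

lemma finite_common_bound:
  fixes Q :: "'c \<Rightarrow> real \<Rightarrow> bool"
  assumes "finite F" "\<And>i. i \<in> F \<Longrightarrow> \<exists>\<delta>>0. Q i \<delta>" "\<And>i \<delta> \<delta>'. Q i \<delta> \<Longrightarrow> 0 < \<delta>' \<Longrightarrow> \<delta>' \<le> \<delta> \<Longrightarrow> Q i \<delta>'"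
  shows "\<exists>\<delta>>0. \<forall>i\<in>F. Q i \<delta>"
  using assms(1,2)
proof (induction F rule: finite_induct)
  case empty
  then show ?case using zero_less_one by blast
next
  case (insert i F)
  then obtain a b where "0 < a" "\<forall>i\<in>F. Q i a" "0 < b" "Q i b" by (metis insertI1 insertI2)
  then show ?case using assms(3) by (intro exI[of _ "min a b"]) (auto intro: assms(3))
qed

lemma homeomorphism_bij:
  assumes "homeomorphic_map (mtopology_of m) (mtopology_of m) g" "x \<in> mspace m"
  shows "g x \<in> mspace m"
  using homeomorphic_imp_surjective_map[OF assms(1)] assms(2) by auto

text \<open>The scale is \<open>r = lam * mdist m x y\<close>. A circle within \<open>r\<close> of
  \<open>x\<close> serves as its own connected set. Otherwise its blow-up reaches distance
  \<open>1 / L\<close> from \<open>g x\<close> and is one of finitely many large circles; a small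
  connected set joining \<open>g x\<close> to \<open>g y\<close> there pulls back into the ball of
  radius \<open>r\<close>.\<close>

lemma bounded_turning_circles: "\<exists>k\<ge>1. \<forall>S\<in>\<S>. bounded_turning m k S"
proof -
  let ?e = "1 / L"
  have e: "0 < ?e" using L by simp
  have "\<exists>\<delta>>0. \<forall>S\<in>large ?e. \<forall>u\<in>S. \<forall>v\<in>S. mdist m u v < \<delta> \<longrightarrow>
      (\<exists>E\<subseteq>S. connectedin (mtopology_of m) E \<and> u \<in> E \<and> v \<in> E \<and> (\<forall>w\<in>E. mdist m u w < ?e))"
  proof (rule finite_common_bound)
    show "finite (large ?e)" unfolding large_def by (rule null[OF e])
  next
    fix S assume "S \<in> large ?e"
    then have "S \<in> \<S>" by (simp add: large_def)
    then show "\<exists>\<delta>>0. \<forall>u\<in>S. \<forall>v\<in>S. mdist m u v < \<delta> \<longrightarrow>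
        (\<exists>E\<subseteq>S. connectedin (mtopology_of m) E \<and> u \<in> E \<and> v \<in> E \<and> (\<forall>w\<in>E. mdist m u w < ?e))"
      using e by (intro circle_uniformly_locally_connected circle_subset circle_hom)
  qed force
  then obtain \<delta> where \<delta>: "0 < \<delta>" "\<And>S u v. S \<in> large ?e \<Longrightarrow> u \<in> S \<Longrightarrow> v \<in> S \<Longrightarrow> mdist m u v < \<delta> \<Longrightarrow>
      \<exists>E\<subseteq>S. connectedin (mtopology_of m) E \<and> u \<in> E \<and> v \<in> E \<and> (\<forall>w\<in>E. mdist m u w < ?e)"
    by metis
  \<comment> \<open>The blow-up at scale \<open>r\<close> brings \<open>x\<close> and
    \<open>y\<close> within \<open>L / lam\<close>, which must be below
    \<open>\<delta>\<close>.\<close>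
  define lam where "lam = L / \<delta> + 1"
  have "0 < L / \<delta>" using L \<delta>(1) by (simp add: divide_pos_pos)
  then have lam: "1 < lam" by (simp add: lam_def)
  have Llam: "L / lam < \<delta>" using L \<delta>(1) lam by (simp add: lam_def field_simps)
  have "bounded_turning m (2 * lam) S" if S: "S \<in> \<S>" for S
    unfolding bounded_turning_def
  proof (intro ballI)
    fix x y assume xy: "x \<in> S" "y \<in> S"
    have SZ: "S \<subseteq> mspace m" by (rule circle_subset[OF S])
    define r where "r = lam * mdist m x y"
    let ?goal = "\<exists>E\<subseteq>S. connectedin (mtopology_of m) E \<and> x \<in> E \<and> y \<in> E \<and> (\<forall>u\<in>E. \<forall>v\<in>E. mdist m u v \<le> 2 * lam * mdist m x y)"
    have whole: ?goal if "\<And>w. w \<in> S \<Longrightarrow> mdist m x w \<le> r"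
    proof (intro exI[of _ S] conjI ballI)
      fix u v assume "u \<in> S" "v \<in> S"
      then have "mdist m u v \<le> mdist m u x + mdist m x v" "mdist m u x \<le> r" "mdist m x v \<le> r"
        using mdist_triangle[of u m x v] SZ xy that mdist_commute[of m u x] by auto
      then show "mdist m u v \<le> 2 * lam * mdist m x y" by (simp add: r_def)
    qed (use circle_connected[OF S] xy in auto)
    show "\<exists>E\<subseteq>S. connectedin (mtopology_of m) E \<and> x \<in> E \<and> y \<in> E \<and> (\<forall>u\<in>E. \<forall>v\<in>E. mdist m u v \<le> 2 * lam * mdist m x y)"
    proof (cases "x = y")
      case True
      then show ?thesis using xy SZ by (intro exI[of _ "{x}"]) (auto simp: connectedin_sing mdist_self)
    next
      case False
      then have d: "0 < mdist m x y" using mdist_zero[of x m y] xy SZ by (metis less_eq_real_def mdist_nonneg subsetD)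
      show ?thesis
      proof (cases "\<forall>w\<in>S. mdist m x w \<le> r")
        case True
        then show ?thesis using whole by blast
      next
        case False
        then obtain w where w: "w \<in> S" "r < mdist m x w" by force
        have Z: "w \<in> mspace m" "x \<in> mspace m" using w(1) xy SZ by blast+
        have r: "0 < r" "r \<le> \<Delta>" using diam[OF Z(2,1)] w(2) d lam by (simp_all add: r_def)
        obtain g where g: "homeomorphic_map (mtopology_of m) (mtopology_of m) g"
          "\<And>y z. y \<in> mspace m \<Longrightarrow> z \<in> mspace m \<Longrightarrow> mdist m x y < r \<Longrightarrow> mdist m x z < r \<Longrightarrow>
             mdist m (g y) (g z) \<le> L * mdist m y z / r"
          "\<And>y. y \<in> mspace m \<Longrightarrow> r \<le> mdist m x y \<Longrightarrow> 1 / L \<le> mdist m (g x) (g y)"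
          using expand[of x r] r xy SZ by blast
        have gS: "g ` S \<in> large ?e"
          unfolding large_def using peripheral_circles_image[OF g(1)] S g(3)[of w] w xy SZ by (auto simp: circles)
        have "mdist m x y < r" using d lam by (simp add: r_def)
        then have "mdist m (g x) (g y) \<le> L * mdist m x y / r"
          using g(2)[of x y] xy SZ r(1) mdist_self[of x m] by auto
        also have "\<dots> = L / lam" using d by (simp add: r_def)
        finally have "mdist m (g x) (g y) < \<delta>" using Llam by linarith
        then obtain E where E: "E \<subseteq> g ` S" "connectedin (mtopology_of m) E" "g x \<in> E" "g y \<in> E"
          "\<And>w. w \<in> E \<Longrightarrow> mdist m (g x) w < ?e"
          using \<delta>(2)[OF gS, of "g x" "g y"] xy by blast
        obtain h where h: "homeomorphic_map (mtopology_of m) (mtopology_of m) h"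
          "\<And>x. x \<in> mspace m \<Longrightarrow> h (g x) = x" "\<And>x. x \<in> mspace m \<Longrightarrow> g (h x) = x"
          using homeomorphic_map_inverse[OF g(1)] unfolding topspace_mtopology_of by blast
        have hE: "h ` E \<subseteq> S" using E(1) h(2) SZ by force
        have EZ: "E \<subseteq> mspace m" using connectedin_subset_topspace[OF E(2)] by simp
        have near: "mdist m x u < r" if "u \<in> h ` E" for u
        proof -
          obtain v where v: "v \<in> E" "u = h v" using \<open>u \<in> h ` E\<close> by blast
          have "u \<in> mspace m" "g u = v" using that hE SZ h(3) v EZ by auto
          then show ?thesis using g(3)[of u] E(5)[OF v(1)] by fastforce
        qed
        show ?thesis
        proof (intro exI[of _ "h ` E"] conjI ballI hE)
          show "connectedin (mtopology_of m) (h ` E)"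
            using connectedin_continuous_map_image[OF homeomorphic_imp_continuous_map[OF h(1)] E(2)] .
          show "x \<in> h ` E" "y \<in> h ` E" using E(3,4) h(2) xy SZ by (metis imageI subsetD)+
          fix u v assume uv: "u \<in> h ` E" "v \<in> h ` E"
          have "mdist m u v \<le> mdist m u x + mdist m x v"
            using uv hE SZ xy by (intro mdist_triangle) auto
          then show "mdist m u v \<le> 2 * lam * mdist m x y"
            using near[OF uv(1)] near[OF uv(2)] mdist_commute[of m u x] by (simp add: r_def)
        qed
      qed
    qed
  qed
  then show ?thesis using lam by (intro exI[of _ "2 * lam"]) auto
qed

lemma finite_net: "0 < e \<Longrightarrow> \<exists>F\<subseteq>mspace m. finite F \<and> (\<forall>x\<in>mspace m. \<exists>y\<in>F. mdist m y x < e)"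
proof -
  assume e: "0 < e"
  have "compactin (mtopology_of m) (mspace m)" using compact by (simp add: compact_space_def)
  then have "Metric_space.mtotally_bounded (mspace m) (mdist m) (mspace m)"
    unfolding mtopology_of_def by (intro Metric_space.compactin_imp_mtotally_bounded) auto
  then have "\<exists>K. finite K \<and> K \<subseteq> mspace m \<and> mspace m \<subseteq> (\<Union>x\<in>K. mball_of m x e)"
    using e unfolding Metric_space.mtotally_bounded_def[OF Metric_space_mspace_mdist] mball_of_def by simp
  then obtain F where F: "finite F" "F \<subseteq> mspace m" "mspace m \<subseteq> (\<Union>x\<in>F. mball_of m x e)" by blast
  have "\<exists>y\<in>F. mdist m y x < e" if "x \<in> mspace m" for x
  proof -
    obtain y where "y \<in> F" "x \<in> mball_of m y e" using F(3) \<open>x \<in> mspace m\<close> by blast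
    then show ?thesis by auto
  qed
  then show ?thesis using F(1,2) by blast
qed

lemma separated_card_bound: "0 < e \<Longrightarrow> \<exists>N::nat. \<forall>F\<subseteq>mspace m. finite F \<and> (\<forall>a\<in>F. \<forall>b\<in>F. a \<noteq> b \<longrightarrow> e \<le> mdist m a b) \<longrightarrow> card F \<le> N"
proof -
  assume e: "0 < e"
  then obtain K where K: "K \<subseteq> mspace m" "finite K" "\<And>x. x \<in> mspace m \<Longrightarrow> \<exists>y\<in>K. mdist m y x < e / 2"
    using finite_net[of "e / 2"] by auto
  have "card F \<le> card K" if F: "F \<subseteq> mspace m" "\<forall>a\<in>F. \<forall>b\<in>F. a \<noteq> b \<longrightarrow> e \<le> mdist m a b" for F
  proof -
    obtain c where c: "\<And>x. x \<in> F \<Longrightarrow> c x \<in> K \<and> mdist m (c x) x < e / 2" using K(3) F(1) by (metis subsetD)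
    have "inj_on c F"
    proof (rule inj_onI, rule ccontr)
      fix a b assume ab: "a \<in> F" "b \<in> F" "c a = c b" "a \<noteq> b"
      have "mdist m a b \<le> mdist m a (c a) + mdist m (c a) b"
        using ab F(1) c K(1) by (intro mdist_triangle) auto
      then show False using c[OF ab(1)] c[OF ab(2)] ab F(2) mdist_commute[of m a "c a"] by fastforce
    qed
    then show ?thesis using c K(2) by (intro card_inj_on_le) auto
  qed
  then show ?thesis by blast
qed

text \<open>A set with distances at most \<open>R\<close> lies in an open ball of radius
  \<open>2 * R\<close>. The blow-up at that scale makes it separated by
  \<open>1 / (2 * L * q)\<close>, and compactness bounds its cardinality. If \<open>2 * R\<close>
  exceeds \<open>\<Delta>\<close>, the set is already separated by
  \<open>\<Delta> / (2 * q)\<close>.\<close>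

lemma separated_card_le_subsets: "0 < q \<Longrightarrow> \<exists>N. \<forall>S\<subseteq>mspace m. separated_card_le m q N S"
proof -
  assume q: "0 < q"
  have "0 < 1 / (2 * L * q)" "0 < \<Delta> / (2 * q)" using q L \<Delta> by auto
  note pos = this
  obtain N1 :: nat where N10: "\<forall>F\<subseteq>mspace m. finite F \<and> (\<forall>a\<in>F. \<forall>b\<in>F. a \<noteq> b \<longrightarrow> 1 / (2 * L * q) \<le> mdist m a b) \<longrightarrow> card F \<le> N1"
    using separated_card_bound[OF pos(1)] by (rule exE)
  have N1: "card F \<le> N1" if "F \<subseteq> mspace m" "finite F" "\<And>a b. a \<in> F \<Longrightarrow> b \<in> F \<Longrightarrow> a \<noteq> b \<Longrightarrow> 1 / (2 * L * q) \<le> mdist m a b" for F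
    using N10[rule_format, of F] that by simp
  obtain N2 :: nat where N20: "\<forall>F\<subseteq>mspace m. finite F \<and> (\<forall>a\<in>F. \<forall>b\<in>F. a \<noteq> b \<longrightarrow> \<Delta> / (2 * q) \<le> mdist m a b) \<longrightarrow> card F \<le> N2"
    using separated_card_bound[OF pos(2)] by (rule exE)
  have N2: "card F \<le> N2" if "F \<subseteq> mspace m" "finite F" "\<And>a b. a \<in> F \<Longrightarrow> b \<in> F \<Longrightarrow> a \<noteq> b \<Longrightarrow> \<Delta> / (2 * q) \<le> mdist m a b" for F
    using N20[rule_format, of F] that by simp
  have "card F \<le> max N1 N2" if F: "finite F" "F \<subseteq> mspace m" "0 < R" "\<And>a b. a \<in> F \<Longrightarrow> b \<in> F \<Longrightarrow> mdist m a b \<le> R"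
    "\<And>a b. a \<in> F \<Longrightarrow> b \<in> F \<Longrightarrow> a \<noteq> b \<Longrightarrow> R / q \<le> mdist m a b" for F R
  proof (cases "F = {}")
    case False
    then obtain x where x: "x \<in> F" by blast
    show ?thesis
    proof (cases "2 * R \<le> \<Delta>")
      case True
      obtain g where g: "homeomorphic_map (mtopology_of m) (mtopology_of m) g"
        "\<And>y z. y \<in> mspace m \<Longrightarrow> z \<in> mspace m \<Longrightarrow> mdist m x y < 2 * R \<Longrightarrow> mdist m x z < 2 * R \<Longrightarrow>
           mdist m y z / (L * (2 * R)) \<le> mdist m (g y) (g z)"
      proof -
        have "x \<in> mspace m" "0 < 2 * R" using x F(2,3) by auto
        from expand[OF this True] show ?thesis using that by blast
      qed
      have "inj_on g F" using homeomorphic_imp_injective_map[OF g(1)] F(2) by (auto intro: inj_on_subset)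
      moreover have "card (g ` F) \<le> N1"
      proof (rule N1)
        show "g ` F \<subseteq> mspace m" using F(2) homeomorphism_bij[OF g(1)] by blast
        fix a b assume "a \<in> g ` F" "b \<in> g ` F" "a \<noteq> b"
        then obtain u v where uv: "u \<in> F" "v \<in> F" "a = g u" "b = g v" "u \<noteq> v" by blast
        have "mdist m x u < 2 * R" "mdist m x v < 2 * R" using F(3) F(4)[OF x uv(1)] F(4)[OF x uv(2)] by auto
        then have "mdist m u v / (L * (2 * R)) \<le> mdist m a b"
          unfolding uv(3,4) using uv F(2) by (intro g(2)) auto
        moreover have "(R / q) / (L * (2 * R)) \<le> mdist m u v / (L * (2 * R))"
          using F(3) F(5)[OF uv(1,2,5)] L by (intro divide_right_mono) auto
        moreover have "(R / q) / (L * (2 * R)) = 1 / (2 * L * q)" using F(3) by (simp add: field_simps)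
        ultimately show "1 / (2 * L * q) \<le> mdist m a b" by linarith
      qed (use F(1) in simp)
      ultimately show ?thesis by (simp add: card_image)
    next
      case False
      have "card F \<le> N2"
      proof (rule N2[OF F(2,1)])
        fix a b assume "a \<in> F" "b \<in> F" "a \<noteq> b"
        then have "R / q \<le> mdist m a b" by (rule F(5))
        moreover have "\<Delta> / (2 * q) \<le> R / q" using False q by (simp add: field_simps)
        ultimately show "\<Delta> / (2 * q) \<le> mdist m a b" by linarith
      qed
      then show ?thesis by simp
    qed
  qed simp
  then have "\<forall>S\<subseteq>mspace m. separated_card_le m q (max N1 N2) S"
    unfolding separated_card_le_def by (meson subset_trans)
  then show ?thesis by blast
qed

lemma separated_card_le_mono: "separated_card_le m q N S \<Longrightarrow> N \<le> N' \<Longrightarrow> separated_card_le m q N' S"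
  unfolding separated_card_le_def by (meson order_trans)

theorem circles_uniform_quasicircles: "uniform_quasicircles m \<S>"
proof -
  obtain k where k: "1 \<le> k" "\<And>S. S \<in> \<S> \<Longrightarrow> bounded_turning m k S" using bounded_turning_circles by blast
  then obtain N where N: "\<And>S. S \<subseteq> mspace m \<Longrightarrow> separated_card_le m (6 * k) N S"
    using separated_card_le_subsets[of "6 * k"] by auto
  have N4: "4 \<le> max 4 N" by simp
  obtain \<eta> where \<eta>: "homeo_halfline \<eta>" "\<And>S. S \<subseteq> mspace m \<and>
    subtopology (mtopology_of m) S homeomorphic_space top_of_set (sphere (0::complex) 1) \<and>
    bounded_turning m k S \<and> separated_card_le m (6 * k) (max 4 N) S \<Longrightarrow>
    (\<exists>f. quasisymmetric \<eta> (submetric euclidean_metric (sphere (0::complex) 1)) (submetric m S) f)"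
    using quasicircle_parametrization[OF k(1) N4, of m] by blast
  have "\<exists>f. quasisymmetric \<eta> (submetric euclidean_metric (sphere (0::complex) 1)) (submetric m S) f" if "S \<in> \<S>" for S
    using circle_subset[OF that] circle_hom[OF that] k(2)[OF that] separated_card_le_mono[OF N, of S "max 4 N"]
    by (intro \<eta>(2) conjI) auto
  then show ?thesis unfolding uniform_quasicircles_def using \<eta>(1) by blast
qed


text \<open>The gap is a Lebesgue number for the cover of \<open>S\<close> by the single open set
  \<open>mspace m - S'\<close>.\<close>

lemma disjoint_circles_gap:
  assumes "S \<in> \<S>" "S' \<in> \<S>" "S \<noteq> S'"
  shows "\<exists>\<delta>>0. \<forall>x\<in>S. \<forall>y\<in>S'. \<delta> \<le> mdist m x y"
proof -
  have SZ: "S \<subseteq> mspace m" "S' \<subseteq> mspace m" using circle_subset assms by blast+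
  have "closedin (mtopology_of m) S'"
    using circle_compact[OF assms(2)] Hausdorff_space_mtopology_of by (rule compactin_imp_closedin[rotated])
  then have op: "openin (mtopology_of m) (mspace m - S')" using openin_diff[OF openin_topspace] by force
  have "S \<inter> S' = {}" using disjoint assms by blast
  then have "S \<subseteq> \<Union>{mspace m - S'}" using SZ by blast
  moreover have "compactin (mtopology_of m) S" by (rule circle_compact[OF assms(1)])
  ultimately have "\<exists>\<epsilon>>0. \<forall>x\<in>S. \<exists>U\<in>{mspace m - S'}. mball_of m x \<epsilon> \<subseteq> U"
    unfolding mtopology_of_def mball_of_def
    by (intro Metric_space.lebesgue_number[OF Metric_space_mspace_mdist]) (use op in \<open>auto simp: mtopology_of_def\<close>)
  then obtain \<epsilon> where \<epsilon>: "0 < \<epsilon>" "\<And>x. x \<in> S \<Longrightarrow> mball_of m x \<epsilon> \<subseteq> mspace m - S'" by blast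
  have "\<epsilon> \<le> mdist m x y" if "x \<in> S" "y \<in> S'" for x y
  proof (rule ccontr)
    assume "\<not> \<epsilon> \<le> mdist m x y"
    then have "y \<in> mball_of m x \<epsilon>" using that SZ by auto
    then show False using \<epsilon>(2)[OF that(1)] that(2) by blast
  qed
  then show ?thesis using \<epsilon>(1) by blast
qed

text \<open>If both circles were large compared with \<open>mdist m x y\<close>, both would leave
  the ball of radius \<open>r\<close> around \<open>x\<close>. Their blow-ups would be distinct
  members of a finite family of disjoint circles, hence \<open>\<delta>\<close> apart, although
  \<open>g x\<close> and \<open>g y\<close> are closer than that.\<close>

lemma separation_aux:
  "\<exists>s>0. \<forall>S\<in>\<S>. \<forall>S'\<in>\<S>. S \<noteq> S' \<longrightarrow> (\<forall>x\<in>S. \<forall>y\<in>S'.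
     (\<forall>u\<in>S. \<forall>v\<in>S. mdist m u v \<le> mdist m x y / s) \<or> (\<forall>u\<in>S'. \<forall>v\<in>S'. mdist m u v \<le> mdist m x y / s))"
proof -
  let ?e = "1 / (2 * L)"
  have e: "0 < ?e" "?e \<le> 1 / L" using L by (auto simp: field_simps)
  have "\<exists>\<delta>>0. \<forall>i\<in>{(S, S'). S \<in> large ?e \<and> S' \<in> large ?e \<and> S \<noteq> S'}. \<forall>x\<in>fst i. \<forall>y\<in>snd i. \<delta> \<le> mdist m x y"
  proof (rule finite_common_bound)
    have "finite (large ?e)" unfolding large_def by (rule null[OF e(1)])
    then have "finite (large ?e \<times> large ?e)" by simp
    then show "finite {(S, S'). S \<in> large ?e \<and> S' \<in> large ?e \<and> S \<noteq> S'}" by (rule rev_finite_subset) auto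
    show "\<exists>\<delta>>0. \<forall>x\<in>fst i. \<forall>y\<in>snd i. \<delta> \<le> mdist m x y"
      if "i \<in> {(S, S'). S \<in> large ?e \<and> S' \<in> large ?e \<and> S \<noteq> S'}" for i
      using that by (auto simp: large_def intro!: disjoint_circles_gap)
  qed (meson order_trans)
  then obtain \<delta> where \<delta>: "0 < \<delta>" "\<And>S S' x y. S \<in> large ?e \<Longrightarrow> S' \<in> large ?e \<Longrightarrow> S \<noteq> S' \<Longrightarrow> x \<in> S \<Longrightarrow> y \<in> S' \<Longrightarrow> \<delta> \<le> mdist m x y"
    by fastforce
  \<comment> \<open>The first term makes \<open>L / lam\<close> smaller than the gap. The second
    makes it at most \<open>1 / (2 * L)\<close>, the amount lost when the distance to
    \<open>g w'\<close> is measured from \<open>g y\<close> instead of \<open>g x\<close>; this is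
    why \<open>?e\<close> is half of \<open>1 / L\<close>.\<close>
  define lam where "lam = L / \<delta> + 2 * L * L + 1"
  have p: "0 < L / \<delta>" "0 < L * L" using L \<delta>(1) by simp_all
  then have lam: "1 < lam" unfolding lam_def by linarith
  have "L < \<delta> * lam" using L \<delta>(1) by (simp add: lam_def field_simps add_pos_pos)
  then have lam1: "L / lam < \<delta>" using lam by (simp add: field_simps)
  have "L * (2 * L) \<le> lam" using p unfolding lam_def by simp
  then have lam2: "L / lam \<le> ?e" using lam L by (simp add: field_simps)
  have main: "(\<forall>u\<in>S. \<forall>v\<in>S. mdist m u v \<le> 2 * lam * mdist m x y) \<or> (\<forall>u\<in>S'. \<forall>v\<in>S'. mdist m u v \<le> 2 * lam * mdist m x y)"
    if S: "S \<in> \<S>" "S' \<in> \<S>" "S \<noteq> S'" and xy: "x \<in> S" "y \<in> S'" for S S' x y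
  proof (rule ccontr)
    assume neg: "\<not> ?thesis"
    have SZ: "S \<subseteq> mspace m" "S' \<subseteq> mspace m" using circle_subset S by blast+
    then have Z: "x \<in> mspace m" "y \<in> mspace m" using xy by blast+
    have "x \<noteq> y" using disjoint[OF S] xy by blast
    then have d: "0 < mdist m x y" using mdist_zero[of x m y] Z by (metis less_eq_real_def mdist_nonneg)
    define r where "r = lam * mdist m x y"
    have far: "\<exists>w\<in>T. r \<le> mdist m x w" if "T \<subseteq> mspace m" "\<not> (\<forall>u\<in>T. \<forall>v\<in>T. mdist m u v \<le> 2 * lam * mdist m x y)" for T
    proof (rule ccontr)
      assume "\<not> ?thesis"
      then have *: "mdist m x w < r" if "w \<in> T" for w using that by force
      have "mdist m u v \<le> 2 * lam * mdist m x y" if "u \<in> T" "v \<in> T" for u v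
      proof -
        have "mdist m u v \<le> mdist m u x + mdist m x v" using that \<open>T \<subseteq> _\<close> Z by (intro mdist_triangle) auto
        then show ?thesis using *[OF that(1)] *[OF that(2)] mdist_commute[of m u x] by (simp add: r_def)
      qed
      then show False using that(2) by blast
    qed
    obtain w where w: "w \<in> S" "r \<le> mdist m x w" using far[OF SZ(1)] neg by blast
    obtain w' where w': "w' \<in> S'" "r \<le> mdist m x w'" using far[OF SZ(2)] neg by blast
    have wZ: "w \<in> mspace m" "w' \<in> mspace m" using w w' SZ by blast+
    have r: "0 < r" "r \<le> \<Delta>" using d lam w(2) diam[OF Z(1) wZ(1)] by (auto simp: r_def)
    obtain g where g: "homeomorphic_map (mtopology_of m) (mtopology_of m) g"
      "\<And>y z. y \<in> mspace m \<Longrightarrow> z \<in> mspace m \<Longrightarrow> mdist m x y < r \<Longrightarrow> mdist m x z < r \<Longrightarrow>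
         mdist m (g y) (g z) \<le> L * mdist m y z / r"
      "\<And>y. y \<in> mspace m \<Longrightarrow> r \<le> mdist m x y \<Longrightarrow> 1 / L \<le> mdist m (g x) (g y)"
      using expand[OF Z(1) r] by blast
    note gZ = homeomorphism_bij[OF g(1)]
    have "mdist m x y < r" using d lam by (simp add: r_def)
    then have "mdist m (g x) (g y) \<le> L * mdist m x y / r" using g(2)[OF Z] r(1) mdist_self[OF Z(1)] by simp
    also have "\<dots> = L / lam" using d by (simp add: r_def)
    finally have gxy: "mdist m (g x) (g y) \<le> L / lam" .
    have 1: "g ` S \<in> large ?e"
      using order_trans[OF e(2) g(3)[OF wZ(1) w(2)]] by (rule large_image[OF g(1) S(1) xy(1) w(1)])
    have "1 / L \<le> mdist m (g x) (g w')" by (rule g(3)[OF wZ(2) w'(2)])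
    also have "\<dots> \<le> mdist m (g x) (g y) + mdist m (g y) (g w')" using Z wZ by (intro mdist_triangle gZ)
    finally have "1 / L \<le> ?e + mdist m (g y) (g w')" using gxy lam2 by linarith
    moreover have "1 / L = ?e + ?e" using L by (simp add: field_simps)
    ultimately have "?e \<le> mdist m (g y) (g w')" by linarith
    then have 2: "g ` S' \<in> large ?e" by (rule large_image[OF g(1) S(2) xy(2) w'(1)])
    have inj: "inj_on g (mspace m)" using homeomorphic_imp_injective_map[OF g(1)] by simp
    have "g ` S \<noteq> g ` S'" using inj_on_image_eq_iff[OF inj SZ] S(3) by simp
    then have "\<delta> \<le> mdist m (g x) (g y)" using \<delta>(2)[OF 1 2] xy by blast
    then show False using gxy lam1 by linarith
  qed
  have "0 < 1 / (2 * lam)" using lam by simp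
  moreover have "mdist m x y / (1 / (2 * lam)) = 2 * lam * mdist m x y" for x y by simp
  ultimately show ?thesis using main by (intro exI[of _ "1 / (2 * lam)"]) (simp only: simp_thms, blast)
qed

lemma le_mdiam:
  assumes "S \<subseteq> mspace m" "x \<in> S" "y \<in> S"
  shows "mdist m x y \<le> mdiam m S"
proof -
  have "bdd_above ((\<lambda>(x, y). mdist m x y) ` (S \<times> S))"
    by (rule bdd_aboveI2[where M = \<Delta>]) (use diam assms(1) in auto)
  from cSUP_upper[OF _ this, of "(x, y)"] show ?thesis unfolding mdiam_def using assms(2,3) by simp
qed

lemma mdiam_le: "S \<noteq> {} \<Longrightarrow> (\<And>x y. x \<in> S \<Longrightarrow> y \<in> S \<Longrightarrow> mdist m x y \<le> b) \<Longrightarrow> mdiam m S \<le> b"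
  unfolding mdiam_def by (rule cSUP_least) auto

theorem circles_relatively_separated: "uniformly_relatively_separated m \<S>"
proof -
  from separation_aux obtain s where s: "0 < s \<and> (\<forall>S\<in>\<S>. \<forall>S'\<in>\<S>. S \<noteq> S' \<longrightarrow> (\<forall>x\<in>S. \<forall>y\<in>S'.
     (\<forall>u\<in>S. \<forall>v\<in>S. mdist m u v \<le> mdist m x y / s) \<or> (\<forall>u\<in>S'. \<forall>v\<in>S'. mdist m u v \<le> mdist m x y / s)))"
    by (rule exE)
  note s1 = conjunct1[OF s] and s2 = conjunct2[OF s, THEN bspec, THEN bspec, THEN mp, THEN bspec, THEN bspec]
  have "s * min (mdiam m S) (mdiam m S') \<le> msetdist m S S'" if S: "S \<in> \<S>" "S' \<in> \<S>" "S \<noteq> S'" for S S'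
    unfolding msetdist_def
  proof (rule cINF_greatest)
    show "S \<times> S' \<noteq> {}" using two_points[OF S(1)] two_points[OF S(2)] by auto
    fix i assume "i \<in> S \<times> S'"
    then obtain x y where i: "i = (x, y)" "x \<in> S" "y \<in> S'" by blast
    have "mdiam m S \<le> mdist m x y / s \<or> mdiam m S' \<le> mdist m x y / s"
      using s2[OF S i(2,3)] mdiam_le[of S "mdist m x y / s"] mdiam_le[of S' "mdist m x y / s"] i by blast
    then have "min (mdiam m S) (mdiam m S') \<le> mdist m x y / s" by linarith
    then have "s * min (mdiam m S) (mdiam m S') \<le> mdist m x y" using s1 by (simp add: field_simps)
    then show "s * min (mdiam m S) (mdiam m S') \<le> (case i of (x, y) \<Rightarrow> mdist m x y)" by (simp add: i(1))
  qed
  then show ?thesis unfolding uniformly_relatively_separated_def using s1 by blast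
qed

text \<open>Density gives a circle near each point of a finite net, and the smallest of these
  finitely many sizes serves for all points.\<close>

lemma large_circles_everywhere:
  "0 < e \<Longrightarrow> \<exists>c>0. \<forall>z\<in>mspace m. \<exists>S\<in>\<S>. (\<forall>w\<in>S. mdist m z w < e) \<and> (\<exists>a\<in>S. \<exists>b\<in>S. c \<le> mdist m a b)"
proof -
  assume e: "0 < e"
  then obtain F where F: "F \<subseteq> mspace m" "finite F" "\<And>x. x \<in> mspace m \<Longrightarrow> \<exists>y\<in>F. mdist m y x < e / 2"
    using finite_net[of "e / 2"] by auto
  have "\<exists>c>0. \<forall>y\<in>F. \<exists>S\<in>\<S>. (\<forall>w\<in>S. mdist m y w < e / 2) \<and> (\<exists>a\<in>S. \<exists>b\<in>S. c \<le> mdist m a b)"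
  proof (rule finite_common_bound[OF F(2)])
    fix y assume "y \<in> F"
    then have y: "y \<in> mspace m" using F(1) by blast
    have "openin (mtopology_of m) (mball_of m y (e / 2))"
      by (simp add: mtopology_of_def mball_of_def Metric_space.openin_mball)
    moreover have "y \<in> mball_of m y (e / 2)" using y e by (simp add: mdist_self)
    ultimately obtain S where S: "S \<in> \<S>" "S \<subseteq> mball_of m y (e / 2)" using dense by blast
    obtain a b where "a \<in> S" "b \<in> S" "0 < mdist m a b" using two_points[OF S(1)] by blast
    moreover have "\<forall>w\<in>S. mdist m y w < e / 2" using S(2) by auto
    ultimately show "\<exists>c>0. \<exists>S\<in>\<S>. (\<forall>w\<in>S. mdist m y w < e / 2) \<and> (\<exists>a\<in>S. \<exists>b\<in>S. c \<le> mdist m a b)"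
      using S(1) by blast
  qed (meson order_trans)
  then obtain c where c: "0 < c" "\<And>y. y \<in> F \<Longrightarrow> \<exists>S\<in>\<S>. (\<forall>w\<in>S. mdist m y w < e / 2) \<and> (\<exists>a\<in>S. \<exists>b\<in>S. c \<le> mdist m a b)"
    by blast
  have "\<exists>S\<in>\<S>. (\<forall>w\<in>S. mdist m z w < e) \<and> (\<exists>a\<in>S. \<exists>b\<in>S. c \<le> mdist m a b)" if z: "z \<in> mspace m" for z
  proof -
    obtain y where y: "y \<in> F" "mdist m y z < e / 2" using F(3)[OF z] by blast
    obtain S where S: "S \<in> \<S>" "\<forall>w\<in>S. mdist m y w < e / 2" "\<exists>a\<in>S. \<exists>b\<in>S. c \<le> mdist m a b" using c(2)[OF y(1)] by blast
    have "mdist m z w < e" if "w \<in> S" for w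
    proof -
      have "mdist m z w \<le> mdist m z y + mdist m y w"
        using that circle_subset[OF S(1)] z y(1) F(1) by (intro mdist_triangle) auto
      moreover have "mdist m y w < e / 2" using S(2) that by blast
      ultimately show ?thesis using y(2) mdist_commute[of m z y] by linarith
    qed
    then show ?thesis using S by blast
  qed
  then show ?thesis using c(1) by blast
qed

text \<open>A circle of definite size in the ball of radius \<open>1 / L\<close> around
  \<open>g x\<close> pulls back into the ball of radius \<open>r\<close> around \<open>x\<close>,
  and the upper bound of \<open>expand\<close> keeps its diameter above a multiple of
  \<open>r\<close>.\<close>

theorem circles_all_scales: "mdiam m (mspace m) \<le> \<Delta> \<Longrightarrow> occur_on_all_locations_and_scales m \<S>"
proof -
  assume \<Delta>': "mdiam m (mspace m) \<le> \<Delta>"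
  have "0 < 1 / L" using L by simp
  from large_circles_everywhere[OF this] obtain c where
    c0: "0 < c \<and> (\<forall>z\<in>mspace m. \<exists>S\<in>\<S>. (\<forall>w\<in>S. mdist m z w < 1 / L) \<and> (\<exists>a\<in>S. \<exists>b\<in>S. c \<le> mdist m a b))"
    by (rule exE)
  note c = conjunct1[OF c0] conjunct2[OF c0, THEN bspec]
  have "\<exists>S\<in>\<S>. S \<subseteq> mball_of m x r \<and> c / L * r \<le> mdiam m S" if x: "x \<in> mspace m" and r: "0 < r" "r \<le> mdiam m (mspace m)" for x r
  proof -
    have "r \<le> \<Delta>" using r \<Delta>' by simp
    then obtain g where g: "homeomorphic_map (mtopology_of m) (mtopology_of m) g"
      "\<And>y z. y \<in> mspace m \<Longrightarrow> z \<in> mspace m \<Longrightarrow> mdist m x y < r \<Longrightarrow> mdist m x z < r \<Longrightarrow>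
         mdist m (g y) (g z) \<le> L * mdist m y z / r"
      "\<And>y. y \<in> mspace m \<Longrightarrow> r \<le> mdist m x y \<Longrightarrow> 1 / L \<le> mdist m (g x) (g y)"
      using expand[OF x r(1)] by blast
    obtain h where h: "homeomorphic_map (mtopology_of m) (mtopology_of m) h" "\<And>x. x \<in> mspace m \<Longrightarrow> g (h x) = x"
      using homeomorphic_map_inverse[OF g(1)] unfolding topspace_mtopology_of by blast
    obtain S where S0: "S \<in> \<S>" "\<forall>w\<in>S. mdist m (g x) w < 1 / L" "\<exists>a\<in>S. \<exists>b\<in>S. c \<le> mdist m a b"
      using c(2)[OF homeomorphism_bij[OF g(1) x]] by blast
    then obtain a b where ab: "a \<in> S" "b \<in> S" "c \<le> mdist m a b" by blast
    note S = S0(1) bspec[OF S0(2)] ab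
    have hS: "h ` S \<in> \<S>" using peripheral_circles_image[OF h(1)] S(1) unfolding circles by blast
    have SZ: "w \<in> mspace m" "h w \<in> mspace m" if "w \<in> S" for w
      using that circle_subset[OF S(1)] homeomorphism_bij[OF h(1)] by blast+
    have near: "mdist m x (h w) < r" if "w \<in> S" for w
    proof (rule ccontr)
      assume "\<not> ?thesis"
      then have "1 / L \<le> mdist m (g x) (g (h w))" using SZ[OF that] by (intro g(3)) auto
      then show False using S(2)[OF that] h(2) SZ(1)[OF that] by simp
    qed
    have "c \<le> L * mdist m (h a) (h b) / r"
      using g(2)[OF SZ(2)[OF S(3)] SZ(2)[OF S(4)] near[OF S(3)] near[OF S(4)]] h(2) SZ(1) S(3,4,5) by simp
    then have "c / L * r \<le> mdist m (h a) (h b)" using r(1) L by (simp add: field_simps)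
    also have "\<dots> \<le> mdiam m (h ` S)" using circle_subset[OF hS] S(3,4) by (intro le_mdiam) auto
    finally have "c / L * r \<le> mdiam m (h ` S)" .
    moreover have "h ` S \<subseteq> mball_of m x r" using near SZ x by auto
    ultimately show ?thesis using hS by blast
  qed
  moreover have "0 < c / L" using c(1) L by simp
  ultimately show ?thesis unfolding occur_on_all_locations_and_scales_def by blast
qed

end

section \<open>Hyperbolic groups and their boundaries\<close>

context
  fixes G :: "('a, 'b) monoid_scheme" (structure) and A :: "'a set"
  assumes G: "group G" and A: "symmetric_generating_set G A"
begin

interpretation group G by (rule G)

section \<open>Left translations as isometries of the Cayley graph\<close>

definition transl :: "'a \<Rightarrow> ('a \<Rightarrow> real) \<Rightarrow> 'a \<Rightarrow> real" where
  "transl g x = (\<lambda>v. if v \<in> carrier G then x (inv g \<otimes> v) else 0)"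

lemma supp_transl:
  assumes "g \<in> carrier G" "supp x \<subseteq> carrier G"
  shows "supp (transl g x) = (\<lambda>v. g \<otimes> v) ` supp x"
proof (intro equalityI subsetI)
  fix v assume "v \<in> supp (transl g x)"
  then have v: "v \<in> carrier G" "x (inv g \<otimes> v) \<noteq> 0" by (auto simp: supp_def transl_def split: if_splits)
  then have "v = g \<otimes> (inv g \<otimes> v)" using assms(1) by (simp flip: m_assoc)
  then show "v \<in> (\<lambda>v. g \<otimes> v) ` supp x" using v by (intro image_eqI[of _ _ "inv g \<otimes> v"]) (simp_all add: supp_def)
next
  fix v assume "v \<in> (\<lambda>v. g \<otimes> v) ` supp x"
  then obtain w where w: "w \<in> supp x" "v = g \<otimes> w" by blast
  then have "w \<in> carrier G" using assms(2) by blast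
  moreover from this have "inv g \<otimes> v = w" using assms(1) w(2) by (simp flip: m_assoc)
  ultimately show "v \<in> supp (transl g x)" using w assms(1) by (simp add: supp_def transl_def)
qed

lemma transl_apply: "g \<in> carrier G \<Longrightarrow> v \<in> carrier G \<Longrightarrow> transl g x (g \<otimes> v) = x v"
  by (simp add: transl_def flip: m_assoc)

lemma inj_on_mult_left: "g \<in> carrier G \<Longrightarrow> inj_on (\<lambda>v. g \<otimes> v) (carrier G)"
  by (simp add: inj_on_multc inj_on_cmult)

lemma cayley_edges_transl:
  assumes "g \<in> carrier G" "(h, k) \<in> cayley_edges G A"
  shows "(g \<otimes> h, g \<otimes> k) \<in> cayley_edges G A"
proof -
  obtain a where a: "h \<in> carrier G" "a \<in> A" "k = h \<otimes> a" using assms(2) by (auto simp: cayley_edges_def)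
  then have "a \<in> carrier G" using A by (auto simp: symmetric_generating_set_def)
  then have "g \<otimes> k = (g \<otimes> h) \<otimes> a" using a assms(1) by (simp add: m_assoc)
  then show ?thesis using a assms(1) by (auto simp: cayley_edges_def)
qed

lemma cayley_walk_transl:
  assumes "g \<in> carrier G" "(h, k) \<in> cayley_edges G A ^^ n"
  shows "(g \<otimes> h, g \<otimes> k) \<in> cayley_edges G A ^^ n"
  using assms(2)
proof (induction n arbitrary: k)
  case (Suc n)
  then obtain l where l: "(h, l) \<in> cayley_edges G A ^^ n" "(l, k) \<in> cayley_edges G A" by auto
  show ?case using Suc.IH[OF l(1)] cayley_edges_transl[OF assms(1) l(2)] by auto
qed simp

lemma word_dist_transl_le:
  assumes "g \<in> carrier G" "h \<in> carrier G" "k \<in> carrier G"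
  shows "word_dist G A (g \<otimes> h) (g \<otimes> k) \<le> word_dist G A h k"
  by (rule word_dist_le[OF G A cayley_walk_transl[OF assms(1) word_dist_walk[OF G A assms(2,3)]]])

lemma word_dist_transl:
  assumes "g \<in> carrier G" "h \<in> carrier G" "k \<in> carrier G"
  shows "word_dist G A (g \<otimes> h) (g \<otimes> k) = word_dist G A h k"
proof -
  have "word_dist G A (inv g \<otimes> (g \<otimes> h)) (inv g \<otimes> (g \<otimes> k)) \<le> word_dist G A (g \<otimes> h) (g \<otimes> k)"
    using assms by (intro word_dist_transl_le) auto
  then have "word_dist G A h k \<le> word_dist G A (g \<otimes> h) (g \<otimes> k)" using assms by (simp flip: m_assoc)
  then show ?thesis using word_dist_transl_le[OF assms] by (rule antisym[rotated])
qed

lemma cayley_simplices_transl: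
  assumes "g \<in> carrier G" "e \<in> cayley_simplices G A"
  shows "(\<lambda>v. g \<otimes> v) ` e \<in> cayley_simplices G A"
proof -
  consider h where "h \<in> carrier G" "e = {h}" | h k where "(h, k) \<in> cayley_edges G A" "e = {h, k}"
    using assms(2) by (auto simp: cayley_simplices_def)
  then show ?thesis
  proof cases
    case 1
    then show ?thesis using assms(1) by (auto simp: cayley_simplices_def)
  next
    case 2
    then show ?thesis using cayley_edges_transl[OF assms(1) 2(1)] by (auto simp: cayley_simplices_def)
  qed
qed

lemma transl_inv:
  assumes "g \<in> carrier G" "supp x \<subseteq> carrier G"
  shows "transl (inv g) (transl g x) = x"
proof
  fix v
  show "transl (inv g) (transl g x) v = x v"
  proof (cases "v \<in> carrier G")
    case True
    then show ?thesis using assms(1) by (simp add: transl_def flip: m_assoc)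
  next
    case False
    then have "x v = 0" using assms(2) by (auto simp: supp_def)
    then show ?thesis using False by (simp add: transl_def)
  qed
qed

lemma transl_points:
  assumes g: "g \<in> carrier G" and x: "x \<in> cayley_points G A"
  shows "transl g x \<in> cayley_points G A"
proof -
  have c: "supp x \<subseteq> carrier G" by (rule cayley_pointsD(4)[OF G A x])
  have "(\<Sum>v\<in>supp (transl g x). transl g x v) = (\<Sum>v\<in>supp x. transl g x (g \<otimes> v))"
    unfolding supp_transl[OF g c] using inj_on_subset[OF inj_on_mult_left[OF g] c] by (simp add: sum.reindex)
  also have "\<dots> = (\<Sum>v\<in>supp x. x v)" using c transl_apply[OF g] by (intro sum.cong) auto
  finally have "(\<Sum>v\<in>supp (transl g x). transl g x v) = 1" using cayley_pointsD(7)[OF G A x] by simp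
  moreover have "0 \<le> transl g x v" for v using cayley_pointsD(5)[OF G A x] by (simp add: transl_def)
  moreover have "supp (transl g x) \<in> cayley_simplices G A"
    unfolding supp_transl[OF g c] using cayley_pointsD(1)[OF G A x] by (rule cayley_simplices_transl[OF g])
  ultimately show ?thesis by (simp add: cayley_points_def)
qed

lemma cayley_dist_transl_le:
  assumes g: "g \<in> carrier G" and x: "x \<in> cayley_points G A" and y: "y \<in> cayley_points G A"
  shows "cayley_dist G A (transl g x) (transl g y) \<le> cayley_dist G A x y"
proof -
  have c: "supp x \<subseteq> carrier G" "supp y \<subseteq> carrier G" using cayley_pointsD(4)[OF G A] x y by blast+
  note gx = transl_points[OF g x] and gy = transl_points[OF g y]
  have u: "supp (transl g x) \<union> supp (transl g y) = (\<lambda>v. g \<otimes> v) ` (supp x \<union> supp y)"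
    unfolding supp_transl[OF g c(1)] supp_transl[OF g c(2)] image_Un ..
  show ?thesis
  proof (cases "supp x \<union> supp y \<in> cayley_simplices G A")
    case True
    obtain v where v: "v \<in> supp x" using cayley_pointsD(3)[OF G A x] by blast
    then have vc: "v \<in> carrier G" using c by blast
    have "cayley_dist G A (transl g x) (transl g y) = \<bar>transl g x (g \<otimes> v) - transl g y (g \<otimes> v)\<bar>"
    proof (rule cayley_dist_edge[OF G A gx gy])
      show "(\<lambda>v. g \<otimes> v) ` (supp x \<union> supp y) \<in> cayley_simplices G A" using cayley_simplices_transl[OF g True] .
      show "g \<otimes> v \<in> (\<lambda>v. g \<otimes> v) ` (supp x \<union> supp y)" using v by blast
    qed (use u in blast)+
    also have "\<dots> = cayley_dist G A x y"
      unfolding transl_apply[OF g vc] using cayley_dist_edge[OF G A x y True _ _, of v] v by simp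
    finally show ?thesis by simp
  next
    case False
    then obtain h k where hk: "h \<in> supp x" "k \<in> supp y"
      "cayley_dist G A x y = (1 - x h) + real (word_dist G A h k) + (1 - y k)"
      using cayley_dist_far(1)[OF G A x y] by blast
    then have hc: "h \<in> carrier G" "k \<in> carrier G" using c by blast+
    have "cayley_dist G A (transl g x) (transl g y) \<le> (1 - transl g x (g \<otimes> h)) +
        real (word_dist G A (g \<otimes> h) (g \<otimes> k)) + (1 - transl g y (g \<otimes> k))"
      by (rule cayley_dist_le[OF G A gx gy])
        (use hk supp_transl[OF g c(1)] supp_transl[OF g c(2)] in blast)+
    then show ?thesis unfolding transl_apply[OF g hc(1)] transl_apply[OF g hc(2)] word_dist_transl[OF g hc] using hk by simp
  qed
qed

lemma cayley_dist_transl: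
  assumes g: "g \<in> carrier G" and x: "x \<in> cayley_points G A" and y: "y \<in> cayley_points G A"
  shows "cayley_dist G A (transl g x) (transl g y) = cayley_dist G A x y"
proof -
  have "cayley_dist G A (transl (inv g) (transl g x)) (transl (inv g) (transl g y)) \<le> cayley_dist G A (transl g x) (transl g y)"
    using g x y by (intro cayley_dist_transl_le transl_points) auto
  then have "cayley_dist G A x y \<le> cayley_dist G A (transl g x) (transl g y)"
    using transl_inv[OF g] cayley_pointsD(4)[OF G A] x y by simp
  then show ?thesis using cayley_dist_transl_le[OF assms] by (rule antisym[rotated])
qed

section \<open>Vertices and geodesics\<close>

definition vertex :: "'a \<Rightarrow> 'a \<Rightarrow> real" where
  "vertex g = (\<lambda>v. if v = g then 1 else 0)"

lemma supp_vertex: "supp (vertex g) = {g}"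
  by (auto simp: supp_def vertex_def)

lemma vertex_points: "g \<in> carrier G \<Longrightarrow> vertex g \<in> cayley_points G A"
  by (auto simp: cayley_points_def supp_vertex cayley_simplices_def) (auto simp: vertex_def)

lemma transl_vertex: "g \<in> carrier G \<Longrightarrow> h \<in> carrier G \<Longrightarrow> transl g (vertex h) = vertex (g \<otimes> h)"
proof
  fix v assume g: "g \<in> carrier G" "h \<in> carrier G"
  show "transl g (vertex h) v = vertex (g \<otimes> h) v"
    using g inv_solve_left'[of "inv g" h v] by (auto simp: transl_def vertex_def m_assoc[symmetric])
qed

lemma cayley_dist_vertex_le:
  assumes "g \<in> carrier G" "h \<in> carrier G"
  shows "cayley_dist G A (vertex g) (vertex h) \<le> real (word_dist G A g h)"
proof -
  have "cayley_dist G A (vertex g) (vertex h) \<le> (1 - vertex g g) + real (word_dist G A g h) + (1 - vertex h h)"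
    by (rule cayley_dist_le[OF G A vertex_points[OF assms(1)] vertex_points[OF assms(2)]]) (simp_all add: supp_vertex)
  then show ?thesis by (simp add: vertex_def)
qed

lemma cayley_dist_vertex:
  assumes g: "g \<in> carrier G" and h: "h \<in> carrier G"
  shows "cayley_dist G A (vertex g) (vertex h) = real (word_dist G A g h)"
proof (cases "supp (vertex g) \<union> supp (vertex h) \<in> cayley_simplices G A")
  case True
  show ?thesis
  proof (cases "g = h")
    case True
    then show ?thesis
      using cayley_dist_vertex_le[OF assms] cayley_dist_nonneg[OF G A, of "vertex g" "vertex h"] word_dist_refl[OF G A, of h]
      by (simp only: of_nat_0)
  next
    case False
    have "word_dist G A g h = 1"
      using word_dist_simplex(1)[OF G A True, of g h] False by (simp add: supp_vertex)
    moreover have "cayley_dist G A (vertex g) (vertex h) = \<bar>vertex g g - vertex h g\<bar>"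
      by (rule cayley_dist_edge[OF G A vertex_points[OF g] vertex_points[OF h]
            \<open>supp (vertex g) \<union> supp (vertex h) \<in> _\<close> Un_upper1 Un_upper2]) (simp add: supp_vertex)
    ultimately show ?thesis using False by (simp add: vertex_def)
  qed
next
  case False
  then show ?thesis
  proof -
    have "\<exists>g'\<in>{g}. \<exists>h'\<in>{h}. cayley_dist G A (vertex g) (vertex h) =
        (1 - vertex g g') + real (word_dist G A g' h') + (1 - vertex h h')"
      using cayley_dist_far(1)[OF G A vertex_points[OF g] vertex_points[OF h] False] unfolding supp_vertex .
    then show ?thesis by (simp add: vertex_def)
  qed
qed

lemma cayley_dist_to_vertex:
  assumes x: "x \<in> cayley_points G A" and g: "g \<in> supp x"
  shows "cayley_dist G A x (vertex g) \<le> 1"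
proof -
  have "g \<in> carrier G" using cayley_pointsD(4)[OF G A x] g by blast
  then have "cayley_dist G A x (vertex g) \<le> (1 - x g) + real (word_dist G A g g) + (1 - vertex g g)"
    using g by (intro cayley_dist_le[OF G A x vertex_points]) (simp_all add: supp_vertex)
  then show ?thesis using cayley_pointsD(5)[OF G A x, of g] word_dist_refl[OF G A] by (simp add: vertex_def)
qed

text \<open>Since \<open>w\<close> may lie inside an edge, a shortest walk to a vertex
  \<open>h\<close> of that edge is followed for \<open>t\<close> steps. Passing between
  \<open>w\<close> and \<open>h\<close> twice costs 2. The extra 1 in the premise guarantees that
  the walk has at least \<open>t\<close> steps.\<close>

lemma geodesic_vertex:
  assumes w: "w \<in> cayley_points G A" and t: "real t + 1 \<le> cayley_dist G A (vertex \<one>) w"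
  obtains q where "q \<in> carrier G" "cayley_dist G A (vertex \<one>) (vertex q) = real t"
    "cayley_dist G A (vertex q) w \<le> cayley_dist G A (vertex \<one>) w - real t + 2"
proof -
  obtain h where h: "h \<in> supp w" using cayley_pointsD(3)[OF G A w] by blast
  then have hc: "h \<in> carrier G" using cayley_pointsD(4)[OF G A w] by blast
  note o = vertex_points[OF one_closed] and vh = vertex_points[OF hc]
  define N where "N = word_dist G A \<one> h"
  have N: "cayley_dist G A (vertex \<one>) (vertex h) = real N" using cayley_dist_vertex[OF one_closed hc] by (simp add: N_def)
  have wh: "cayley_dist G A w (vertex h) \<le> 1" using cayley_dist_to_vertex[OF w h] .
  have hw: "cayley_dist G A (vertex h) w \<le> 1" using wh cayley_dist_commute[OF G A] by metis
  have "cayley_dist G A (vertex \<one>) w \<le> real N + 1"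
    using cayley_dist_triangle[OF G A o vh w] N hw by linarith
  then have "t \<le> N" using t by linarith
  have N': "real N \<le> cayley_dist G A (vertex \<one>) w + 1"
    using cayley_dist_triangle[OF G A o w vh] N wh by linarith
  have "(\<one>, h) \<in> cayley_edges G A ^^ (t + (N - t))"
    using word_dist_walk[OF G A one_closed hc] \<open>t \<le> N\<close> by (simp add: N_def)
  then obtain q where q: "(\<one>, q) \<in> cayley_edges G A ^^ t" "(q, h) \<in> cayley_edges G A ^^ (N - t)"
    unfolding relpow_add by blast
  have qc: "q \<in> carrier G"
  proof (cases t)
    case 0
    then show ?thesis using q(1) by auto
  next
    case (Suc s)
    then show ?thesis using q(1) cayley_edges_carrier[OF G A] by auto
  qed
  have a: "word_dist G A \<one> q \<le> t" "word_dist G A q h \<le> N - t"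
    using word_dist_le[OF G A] q by blast+
  moreover have "N \<le> word_dist G A \<one> q + word_dist G A q h"
    unfolding N_def using word_dist_triangle[OF G A one_closed qc hc] .
  ultimately have "word_dist G A \<one> q = t" using \<open>t \<le> N\<close> by linarith
  then have 1: "cayley_dist G A (vertex \<one>) (vertex q) = real t" using cayley_dist_vertex[OF one_closed qc] by simp
  have "cayley_dist G A (vertex q) (vertex h) \<le> real N - real t"
  proof -
    have "word_dist G A q h + t \<le> N" using a(2) \<open>t \<le> N\<close> by linarith
    then have "real (word_dist G A q h) + real t \<le> real N" by linarith
    then show ?thesis using cayley_dist_vertex[OF qc hc] by linarith
  qed
  then have "cayley_dist G A (vertex q) w \<le> cayley_dist G A (vertex \<one>) w - real t + 2"
    using cayley_dist_triangle[OF G A vertex_points[OF qc] vh w] hw N' by linarith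
  then show ?thesis using that qc 1 by blast
qed

end

text \<open>The last premise is \<open>x - c \<le> y\<close> in terms of the real numbers below
  \<open>x\<close>. For finite \<open>x\<close> it is tested at \<open>x - 1\<close>, hence the
  exponent \<open>c + 1\<close>; for infinite \<open>x\<close> it forces \<open>y\<close> to be
  infinite.\<close>

lemma exp_minus_compare:
  assumes "1 < \<Lambda>" "0 \<le> x" "\<And>s. ereal s < x \<Longrightarrow> ereal (s - c) \<le> y"
  shows "exp_minus \<Lambda> y \<le> \<Lambda> powr (c + 1) * exp_minus \<Lambda> x"
proof (cases x)
  case (real b)
  then have "ereal (b - 1) < x" by simp
  then have y: "ereal (b - 1 - c) \<le> y" by (rule assms(3))
  show ?thesis
  proof (cases y)
    case (real e)
    then have "- e \<le> c + 1 + - b" using y by simp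
    then have "\<Lambda> powr (- e) \<le> \<Lambda> powr (c + 1 + - b)" using assms(1) by (intro powr_mono) auto
    then have "\<Lambda> powr (- e) \<le> \<Lambda> powr (c + 1) * \<Lambda> powr (- b)"
      unfolding powr_add[of \<Lambda> "c + 1" "- b", symmetric] .
    then show ?thesis using real \<open>x = ereal b\<close> by (simp add: exp_minus_def)
  next
    case PInf
    then show ?thesis by (simp add: exp_minus_def)
  next
    case MInf
    then show ?thesis using y by simp
  qed
next
  case PInf
  have "y = \<infinity>"
  proof (rule ereal_top)
    fix B
    have "ereal (B + c - c) \<le> y" by (rule assms(3)) (simp add: PInf)
    then show "ereal B \<le> y" by simp
  qed
  then show ?thesis by (simp add: exp_minus_def)
next
  case MInf
  then show ?thesis using assms(2) by simp
qed

lemma eventually_sequentially_prod: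
  "eventually (\<lambda>(i, j). Q i j) (sequentially \<times>\<^sub>F sequentially) \<longleftrightarrow> (\<exists>N. \<forall>i\<ge>N. \<forall>j\<ge>N. Q i j)"
  unfolding eventually_prod_sequentially by auto

locale hyperbolic_cayley = group G for G :: "('a, 'b) monoid_scheme" (structure) +
  fixes A :: "'a set" and \<delta> :: real
  assumes A: "symmetric_generating_set G A" and \<delta>: "0 \<le> \<delta>"
    and hyp: "p \<in> cayley_points G A \<Longrightarrow> x \<in> cayley_points G A \<Longrightarrow> y \<in> cayley_points G A \<Longrightarrow> z \<in> cayley_points G A \<Longrightarrow>
      min (gromov_product (cayley_graph G A) p x y) (gromov_product (cayley_graph G A) p y z) - \<delta>
        \<le> gromov_product (cayley_graph G A) p x z"
begin

lemma G: "group G" by (rule is_group)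

abbreviation P where "P \<equiv> cayley_points G A"
abbreviation d where "d \<equiv> cayley_dist G A"
abbreviation gp where "gp \<equiv> gromov_product (cayley_graph G A)"
abbreviation tr where "tr \<equiv> transl G"
abbreviation orig where "orig \<equiv> vertex \<one>"

lemma mX: "mspace (cayley_graph G A) = P" "mdist (cayley_graph G A) = d"
  using mspace_cayley_graph[OF G A] mdist_cayley_graph[OF G A] by auto

lemma gp_def: "gp p x y = (d x p + d y p - d x y) / 2"
  by (simp add: gromov_product_def mX)

lemmas d_commute = cayley_dist_commute[OF G A]
lemmas d_triangle = cayley_dist_triangle[OF G A]
lemmas d_nonneg = cayley_dist_nonneg[OF G A]

lemma d_self: "x \<in> P \<Longrightarrow> d x x = 0"
  using mdist_zero[of x "cayley_graph G A" x] by (simp add: mX)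

lemma gp_commute: "gp p x y = gp p y x"
  by (simp add: gp_def d_commute[of x y])

lemma gp_nonneg: "p \<in> P \<Longrightarrow> x \<in> P \<Longrightarrow> y \<in> P \<Longrightarrow> 0 \<le> gp p x y"
  using d_triangle[of x p y] by (simp add: gp_def d_commute[of p y])

lemma gp_le: "p \<in> P \<Longrightarrow> x \<in> P \<Longrightarrow> y \<in> P \<Longrightarrow> gp p x y \<le> d x p"
  using d_triangle[of y x p] by (simp add: gp_def d_commute[of y x])

lemma gp_base:
  assumes "p \<in> P" "q \<in> P" "x \<in> P" "y \<in> P"
  shows "gp p x y \<le> gp q x y + d p q"
proof -
  show ?thesis
    using d_triangle[OF assms(3,2,1)] d_triangle[OF assms(4,2,1)] unfolding gp_def d_commute[of p q] by argo
qed

lemma gp_transl: "g \<in> carrier G \<Longrightarrow> p \<in> P \<Longrightarrow> x \<in> P \<Longrightarrow> y \<in> P \<Longrightarrow> gp (tr g p) (tr g x) (tr g y) = gp p x y"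
  by (simp add: gp_def cayley_dist_transl[OF G A])

lemma orig_P: "orig \<in> P" by (rule vertex_points[OF G A one_closed])

lemma tr_P: "g \<in> carrier G \<Longrightarrow> x \<in> P \<Longrightarrow> tr g x \<in> P" by (rule transl_points[OF G A])

lemma tr_inv: "g \<in> carrier G \<Longrightarrow> x \<in> P \<Longrightarrow> tr (inv g) (tr g x) = x"
  using cayley_pointsD(4)[OF G A] by (intro transl_inv[OF G A]) auto

lemma inv_tr: "g \<in> carrier G \<Longrightarrow> x \<in> P \<Longrightarrow> tr g (tr (inv g) x) = x"
  using tr_inv[of "inv g" x] by simp

text \<open>Convergence at infinity for the base point at the identity only; by
  \<open>gp_base\<close> another base point changes Gromov products by a bounded amount.\<close>

definition conv :: "(nat \<Rightarrow> 'a \<Rightarrow> real) \<Rightarrow> bool" where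
  "conv u \<longleftrightarrow> range u \<subseteq> P \<and> (\<forall>C. \<exists>N. \<forall>i\<ge>N. \<forall>j\<ge>N. C \<le> gp orig (u i) (u j))"

definition eqv :: "(nat \<Rightarrow> 'a \<Rightarrow> real) \<Rightarrow> (nat \<Rightarrow> 'a \<Rightarrow> real) \<Rightarrow> bool" where
  "eqv u v \<longleftrightarrow> (\<forall>C. \<exists>N. \<forall>i\<ge>N. C \<le> gp orig (u i) (v i))"

lemma convD: "conv u \<Longrightarrow> u i \<in> P"
  by (auto simp: conv_def)

lemma converges_iff: "converges_to_infinity (cayley_graph G A) u \<longleftrightarrow> conv u"
proof
  assume u: "converges_to_infinity (cayley_graph G A) u"
  then have r: "range u \<subseteq> P" by (simp add: converges_to_infinity_def mX)
  have "filterlim (\<lambda>(i, j). gp orig (u i) (u j)) at_top (sequentially \<times>\<^sub>F sequentially)"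
    using u orig_P by (auto simp: converges_to_infinity_def mX)
  then have "\<forall>C. eventually (\<lambda>(i, j). C \<le> gp orig (u i) (u j)) (sequentially \<times>\<^sub>F sequentially)"
    by (simp add: filterlim_at_top case_prod_unfold)
  then show "conv u" using r unfolding conv_def eventually_sequentially_prod by blast
next
  assume u: "conv u"
  have "filterlim (\<lambda>(i, j). gp p (u i) (u j)) at_top (sequentially \<times>\<^sub>F sequentially)" if p: "p \<in> P" for p
  proof -
    have "\<exists>N. \<forall>i\<ge>N. \<forall>j\<ge>N. C \<le> gp p (u i) (u j)" for C
    proof -
      obtain N where N: "\<forall>i\<ge>N. \<forall>j\<ge>N. C + d orig p \<le> gp orig (u i) (u j)" using u unfolding conv_def by blast
      have "C \<le> gp p (u i) (u j)" if "N \<le> i" "N \<le> j" for i j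
        using N that gp_base[OF orig_P p convD[OF u] convD[OF u], of i j] by force
      then show ?thesis by blast
    qed
    then have "eventually (\<lambda>(i, j). C \<le> gp p (u i) (u j)) (sequentially \<times>\<^sub>F sequentially)" for C
      unfolding eventually_sequentially_prod .
    then show ?thesis by (simp add: filterlim_at_top case_prod_unfold)
  qed
  then show "converges_to_infinity (cayley_graph G A) u"
    using u by (simp add: converges_to_infinity_def mX conv_def)
qed

lemma equivalent_iff:
  assumes "conv u" "conv v"
  shows "equivalent_at_infinity (cayley_graph G A) u v \<longleftrightarrow> eqv u v"
proof
  assume "equivalent_at_infinity (cayley_graph G A) u v"
  then have "filterlim (\<lambda>i. gp orig (u i) (v i)) at_top sequentially"
    using orig_P by (simp add: equivalent_at_infinity_def mX)
  then show "eqv u v" by (simp add: filterlim_at_top eventually_sequentially eqv_def)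
next
  assume uv: "eqv u v"
  have "filterlim (\<lambda>i. gp p (u i) (v i)) at_top sequentially" if p: "p \<in> P" for p
    unfolding filterlim_at_top eventually_sequentially
  proof
    fix C
    obtain N where N: "\<forall>i\<ge>N. C + d orig p \<le> gp orig (u i) (v i)" using uv unfolding eqv_def by blast
    have "C \<le> gp p (u i) (v i)" if "N \<le> i" for i
      using N that gp_base[OF orig_P p convD[OF assms(1)] convD[OF assms(2)], of i i] by force
    then show "\<exists>N. \<forall>i\<ge>N. C \<le> gp p (u i) (v i)" by blast
  qed
  then show "equivalent_at_infinity (cayley_graph G A) u v" by (simp add: equivalent_at_infinity_def mX)
qed

lemma conv_bound: "conv u \<Longrightarrow> \<exists>N. \<forall>i\<ge>N. \<forall>j\<ge>N. C \<le> gp orig (u i) (u j)"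
  by (simp add: conv_def)

lemma eqv_bound: "eqv u v \<Longrightarrow> \<exists>N. \<forall>i\<ge>N. C \<le> gp orig (u i) (v i)"
  by (simp add: eqv_def)

lemma eqv_refl: "conv u \<Longrightarrow> eqv u u"
  unfolding eqv_def
proof
  fix C assume "conv u"
  then obtain N where "\<forall>i\<ge>N. \<forall>j\<ge>N. C \<le> gp orig (u i) (u j)" using conv_bound by blast
  then show "\<exists>N. \<forall>i\<ge>N. C \<le> gp orig (u i) (u i)" by (intro exI[of _ N]) simp
qed

lemma eqv_sym: "eqv u v \<Longrightarrow> eqv v u"
  unfolding eqv_def by (simp add: gp_commute)

lemma eqv_trans:
  assumes "conv u" "conv v" "conv w" "eqv u v" "eqv v w"
  shows "eqv u w"
  unfolding eqv_def
proof
  fix C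
  obtain N where N: "\<forall>i\<ge>N. C + \<delta> \<le> gp orig (u i) (v i)" using eqv_bound[OF assms(4)] by blast
  obtain M where M: "\<forall>i\<ge>M. C + \<delta> \<le> gp orig (v i) (w i)" using eqv_bound[OF assms(5)] by blast
  have "C \<le> gp orig (u i) (w i)" if i: "max N M \<le> i" for i
  proof -
    have "C + \<delta> \<le> gp orig (u i) (v i)" "C + \<delta> \<le> gp orig (v i) (w i)" using N M i by auto
    then show ?thesis using hyp[OF orig_P convD[OF assms(1)] convD[OF assms(2)] convD[OF assms(3)], of i i i] by linarith
  qed
  then show "\<exists>N. \<forall>i\<ge>N. C \<le> gp orig (u i) (w i)" by blast
qed

section \<open>The boundary and the action of the group on it\<close>

abbreviation bd where "bd \<equiv> gromov_boundary (cayley_graph G A)"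

lemma boundary_iff: "a \<in> bd \<longleftrightarrow> (\<exists>u. conv u \<and> a = {v. conv v \<and> eqv u v})"
proof -
  have "{(u, v). conv u \<and> conv v \<and> equivalent_at_infinity (cayley_graph G A) u v} `` {u} = {v. conv v \<and> eqv u v}"
    if "conv u" for u using that equivalent_iff by auto
  then show ?thesis unfolding gromov_boundary_def quotient_def converges_iff by auto
qed

lemma boundary_nonempty: "a \<in> bd \<Longrightarrow> \<exists>u. u \<in> a"
proof -
  assume "a \<in> bd"
  then obtain u where u: "conv u" "a = {v. conv v \<and> eqv u v}" by (auto simp only: boundary_iff)
  then have "u \<in> a" using eqv_refl by simp
  then show ?thesis by blast
qed

lemma boundary_conv: "a \<in> bd \<Longrightarrow> u \<in> a \<Longrightarrow> conv u"
  by (auto simp only: boundary_iff)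

lemma boundary_eqv:
  assumes "a \<in> bd" "u \<in> a" "v \<in> a"
  shows "eqv u v"
proof -
  obtain w where w: "conv w" "a = {v. conv v \<and> eqv w v}" using assms(1) by (auto simp only: boundary_iff)
  have "conv u" "eqv w u" "conv v" "eqv w v" using assms(2,3) unfolding w(2) by simp_all
  then show ?thesis using eqv_trans[OF _ w(1)] eqv_sym by simp
qed

lemma conv_tr: "g \<in> carrier G \<Longrightarrow> conv u \<Longrightarrow> conv (\<lambda>i. tr g (u i))"
proof -
  assume g: "g \<in> carrier G" and u: "conv u"
  have "\<exists>N. \<forall>i\<ge>N. \<forall>j\<ge>N. C \<le> gp orig (tr g (u i)) (tr g (u j))" for C
  proof -
    obtain N where N: "\<forall>i\<ge>N. \<forall>j\<ge>N. C + d (tr g orig) orig \<le> gp orig (u i) (u j)" using conv_bound[OF u] by blast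
    have "C \<le> gp orig (tr g (u i)) (tr g (u j))" if "N \<le> i" "N \<le> j" for i j
      using N that gp_base[OF tr_P[OF g orig_P] orig_P tr_P[OF g convD[OF u]] tr_P[OF g convD[OF u]], of i j]
        gp_transl[OF g orig_P convD[OF u] convD[OF u], of i j] by force
    then show ?thesis by blast
  qed
  then show ?thesis using tr_P[OF g convD[OF u]] by (auto simp: conv_def)
qed

lemma eqv_tr: "g \<in> carrier G \<Longrightarrow> conv u \<Longrightarrow> conv v \<Longrightarrow> eqv u v \<Longrightarrow> eqv (\<lambda>i. tr g (u i)) (\<lambda>i. tr g (v i))"
proof -
  assume g: "g \<in> carrier G" and uv: "conv u" "conv v" "eqv u v"
  have "\<exists>N. \<forall>i\<ge>N. C \<le> gp orig (tr g (u i)) (tr g (v i))" for C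
  proof -
    obtain N where N: "\<forall>i\<ge>N. C + d (tr g orig) orig \<le> gp orig (u i) (v i)" using eqv_bound[OF uv(3)] by blast
    have "C \<le> gp orig (tr g (u i)) (tr g (v i))" if "N \<le> i" for i
      using N that gp_base[OF tr_P[OF g orig_P] orig_P tr_P[OF g convD[OF uv(1)]] tr_P[OF g convD[OF uv(2)]], of i i]
        gp_transl[OF g orig_P convD[OF uv(1)] convD[OF uv(2)], of i i] by force
    then show ?thesis by blast
  qed
  then show ?thesis by (simp add: eqv_def)
qed

definition act :: "'a \<Rightarrow> (nat \<Rightarrow> 'a \<Rightarrow> real) set \<Rightarrow> (nat \<Rightarrow> 'a \<Rightarrow> real) set" where
  "act g a = (\<lambda>u i. tr g (u i)) ` a"

lemma act_inv: "g \<in> carrier G \<Longrightarrow> a \<in> bd \<Longrightarrow> act (inv g) (act g a) = a"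
proof -
  assume g: "g \<in> carrier G" and a: "a \<in> bd"
  have "(\<lambda>i. tr (inv g) (tr g (u i))) = u" if "u \<in> a" for u
    using tr_inv[OF g convD[OF boundary_conv[OF a that]]] by blast
  then show ?thesis by (simp add: act_def image_image)
qed

text \<open>The translate of a class is again a full class, because the inverse translation brings
  every equivalent sequence back.\<close>

lemma act_boundary: "g \<in> carrier G \<Longrightarrow> a \<in> bd \<Longrightarrow> act g a \<in> bd"
proof -
  assume g: "g \<in> carrier G" and "a \<in> bd"
  then obtain u where u: "conv u" "a = {v. conv v \<and> eqv u v}" unfolding boundary_iff by blast
  have "act g a = {v. conv v \<and> eqv (\<lambda>i. tr g (u i)) v}"
  proof (intro equalityI subsetI)
    fix w assume "w \<in> act g a"
    then obtain v where "conv v" "eqv u v" "w = (\<lambda>i. tr g (v i))" unfolding act_def u(2) by blast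
    then show "w \<in> {v. conv v \<and> eqv (\<lambda>i. tr g (u i)) v}" using conv_tr[OF g] eqv_tr[OF g u(1)] by blast
  next
    fix w assume "w \<in> {v. conv v \<and> eqv (\<lambda>i. tr g (u i)) v}"
    then have w: "conv w" "eqv (\<lambda>i. tr g (u i)) w" by blast+
    define v where "v = (\<lambda>i. tr (inv g) (w i))"
    have "eqv (\<lambda>i. tr (inv g) (tr g (u i))) v"
      unfolding v_def using g w conv_tr[OF g u(1)] by (intro eqv_tr) auto
    moreover have "(\<lambda>i. tr (inv g) (tr g (u i))) = u" using tr_inv[OF g convD[OF u(1)]] by blast
    moreover have "conv v" unfolding v_def using g w(1) by (intro conv_tr) auto
    ultimately have "v \<in> a" unfolding u(2) by simp
    moreover have "w = (\<lambda>i. tr g (v i))" using inv_tr[OF g convD[OF w(1)]] by (simp add: v_def)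
    ultimately show "w \<in> act g a" unfolding act_def by blast
  qed
  then show ?thesis unfolding boundary_iff using conv_tr[OF g u(1)] by blast
qed

section \<open>Gromov products at infinity\<close>

abbreviation BP where "BP \<equiv> boundary_gromov_product (cayley_graph G A)"

text \<open>With \<open>le_BP\<close> this reduces the supremum of lower limits to real
  inequalities: strict lower bounds are unpacked here and weak ones are rebuilt there.\<close>

lemma less_BP:
  assumes "ereal s < BP p a b"
  shows "\<exists>u\<in>a. \<exists>v\<in>b. \<exists>N. \<forall>i\<ge>N. \<forall>j\<ge>N. s < gp p (u i) (v j)"
proof -
  obtain u v where uv: "u \<in> a" "v \<in> b"
    "ereal s < Liminf (sequentially \<times>\<^sub>F sequentially) (\<lambda>(i, j). ereal (gp p (u i) (v j)))"
    using assms unfolding boundary_gromov_product_def less_SUP_iff by auto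
  have "eventually (\<lambda>x. ereal s < (case x of (i, j) \<Rightarrow> ereal (gp p (u i) (v j)))) (sequentially \<times>\<^sub>F sequentially)"
    using uv(3) by (rule less_LiminfD)
  then have "eventually (\<lambda>(i, j). s < gp p (u i) (v j)) (sequentially \<times>\<^sub>F sequentially)"
    by (simp add: case_prod_unfold)
  then show ?thesis unfolding eventually_sequentially_prod using uv by blast
qed

lemma le_BP:
  assumes "u \<in> a" "v \<in> b" "\<And>i j. N \<le> i \<Longrightarrow> N \<le> j \<Longrightarrow> s \<le> gp p (u i) (v j)"
  shows "ereal s \<le> BP p a b"
proof -
  have "eventually (\<lambda>(i, j). s \<le> gp p (u i) (v j)) (sequentially \<times>\<^sub>F sequentially)"
    unfolding eventually_sequentially_prod using assms(3) by blast
  then have "eventually (\<lambda>x. ereal s \<le> (case x of (i, j) \<Rightarrow> ereal (gp p (u i) (v j)))) (sequentially \<times>\<^sub>F sequentially)"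
    by (simp add: case_prod_unfold)
  then have "ereal s \<le> Liminf (sequentially \<times>\<^sub>F sequentially) (\<lambda>(i, j). ereal (gp p (u i) (v j)))"
    by (rule Liminf_bounded)
  also have "\<dots> \<le> BP p a b"
    unfolding boundary_gromov_product_def by (rule SUP_upper2[of "(u, v)"]) (use assms(1,2) in auto)
  finally show ?thesis .
qed

lemma BP_nonneg:
  assumes "p \<in> P" "a \<in> bd" "b \<in> bd"
  shows "0 \<le> BP p a b"
proof -
  obtain u v where uv: "u \<in> a" "v \<in> b" using boundary_nonempty assms by blast
  have "ereal 0 \<le> BP p a b"
    using uv(1,2)
    by (rule le_BP[where N = 0]) (use assms uv boundary_conv convD in \<open>blast intro: gp_nonneg\<close>)
  then show ?thesis by (simp add: zero_ereal_def)
qed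

lemma BP_shift:
  assumes "a \<in> bd" "b \<in> bd" and s: "ereal s < BP p a b"
    and *: "\<And>u v. u \<in> a \<Longrightarrow> v \<in> b \<Longrightarrow> \<exists>N. \<forall>i\<ge>N. \<forall>j\<ge>N. gp p (u i) (v j) \<le> gp q (u i) (v j) + c"
  shows "ereal (s - c) \<le> BP q a b"
proof -
  obtain u v N where uv: "u \<in> a" "v \<in> b" "\<forall>i\<ge>N. \<forall>j\<ge>N. s < gp p (u i) (v j)" using less_BP[OF s] by blast
  obtain M where M: "\<forall>i\<ge>M. \<forall>j\<ge>M. gp p (u i) (v j) \<le> gp q (u i) (v j) + c" using *[OF uv(1,2)] by blast
  show ?thesis using uv(1,2)
  proof (rule le_BP[where N = "max N M"])
    fix i j assume "max N M \<le> i" "max N M \<le> j"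
    then have "s < gp p (u i) (v j)" "gp p (u i) (v j) \<le> gp q (u i) (v j) + c" using uv(3) M by auto
    then show "s - c \<le> gp q (u i) (v j)" by linarith
  qed
qed

lemma BP_base:
  assumes "a \<in> bd" "b \<in> bd" "p \<in> P" "q \<in> P" "ereal s < BP p a b"
  shows "ereal (s - d p q) \<le> BP q a b"
  using assms(1,2,5)
proof (rule BP_shift)
  fix u v assume "u \<in> a" "v \<in> b"
  then have "conv u" "conv v" using boundary_conv assms by blast+
  then show "\<exists>N. \<forall>i\<ge>N. \<forall>j\<ge>N. gp p (u i) (v j) \<le> gp q (u i) (v j) + d p q"
    using gp_base[OF assms(3,4)] convD by blast
qed

lemma BP_act:
  assumes g: "g \<in> carrier G" and p: "p \<in> P" and ab: "a \<in> bd" "b \<in> bd"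
  shows "BP (tr g p) (act g a) (act g b) = BP p a b"
proof -
  have "BP (tr g p) (act g a) (act g b) = (SUP (u, v)\<in>a \<times> b. Liminf (sequentially \<times>\<^sub>F sequentially)
      (\<lambda>(i, j). ereal (gp (tr g p) (tr g (u i)) (tr g (v j)))))"
  proof -
    have "act g a \<times> act g b = (\<lambda>(u, v). ((\<lambda>i. tr g (u i)), (\<lambda>i. tr g (v i)))) ` (a \<times> b)"
      unfolding act_def by auto
    then show ?thesis unfolding boundary_gromov_product_def by (simp add: image_image case_prod_unfold)
  qed
  also have "\<dots> = BP p a b"
    unfolding boundary_gromov_product_def
  proof (rule SUP_cong[OF refl])
    fix x assume "x \<in> a \<times> b"
    then obtain u v where x: "x = (u, v)" "u \<in> a" "v \<in> b" by blast
    have "gp (tr g p) (tr g (u i)) (tr g (v j)) = gp p (u i) (v j)" for i j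
      using x ab boundary_conv convD by (intro gp_transl[OF g p]) blast+
    then show "(case x of (u, v) \<Rightarrow> Liminf (sequentially \<times>\<^sub>F sequentially)
          (\<lambda>(i, j). ereal (gp (tr g p) (tr g (u i)) (tr g (v j))))) =
        (case x of (u, v) \<Rightarrow> Liminf (sequentially \<times>\<^sub>F sequentially) (\<lambda>(i, j). ereal (gp p (u i) (v j))))"
      by (simp add: x(1))
  qed
  finally show ?thesis .
qed

text \<open>The supremum only provides some representatives. Others are reached along the chain
  \<open>u i\<close>, \<open>u' k\<close>, \<open>v' k\<close>, \<open>v j\<close>; its outer
  products can be made as large as desired, so just two uses of hyperbolicity cost
  \<open>\<delta>\<close> each.\<close>

lemma gp_of_less_BP:
  assumes ab: "a \<in> bd" "b \<in> bd" and u: "u \<in> a" and v: "v \<in> b" and s: "ereal s < BP orig a b"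
  shows "\<exists>N. \<forall>i\<ge>N. \<forall>j\<ge>N. s - 2 * \<delta> \<le> gp orig (u i) (v j)"
proof -
  obtain u' v' N0 where uv': "u' \<in> a" "v' \<in> b" "\<forall>i\<ge>N0. \<forall>j\<ge>N0. s < gp orig (u' i) (v' j)" using less_BP[OF s] by blast
  have cu: "conv u" "conv u'" and cv: "conv v" "conv v'" using boundary_conv ab u v uv' by blast+
  obtain N1 where N1: "\<forall>i\<ge>N1. \<forall>j\<ge>N1. s + \<delta> \<le> gp orig (u i) (u j)" using conv_bound[OF cu(1)] by blast
  obtain N2 where N2: "\<forall>i\<ge>N2. s + \<delta> \<le> gp orig (u i) (u' i)"
    using eqv_bound[OF boundary_eqv[OF ab(1) u uv'(1)]] by blast
  obtain N3 where N3: "\<forall>i\<ge>N3. \<forall>j\<ge>N3. s + \<delta> \<le> gp orig (v i) (v j)" using conv_bound[OF cv(1)] by blast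
  obtain N4 where N4: "\<forall>i\<ge>N4. s + \<delta> \<le> gp orig (v i) (v' i)"
    using eqv_bound[OF boundary_eqv[OF ab(2) v uv'(2)]] by blast
  define k where "k = N0 + N1 + N2 + N3 + N4"
  have k: "N0 \<le> k" "N1 \<le> k" "N2 \<le> k" "N3 \<le> k" "N4 \<le> k" by (auto simp: k_def)
  have "s - 2 * \<delta> \<le> gp orig (u i) (v j)" if ij: "k \<le> i" "k \<le> j" for i j
  proof -
    have 1: "s \<le> gp orig (u i) (u' k)"
    proof -
      have "s + \<delta> \<le> gp orig (u i) (u k)" "s + \<delta> \<le> gp orig (u k) (u' k)" using N1 N2 k ij by auto
      then show ?thesis using hyp[OF orig_P convD[OF cu(1)] convD[OF cu(1)] convD[OF cu(2)], of i k k] by linarith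
    qed
    have 2: "s \<le> gp orig (v' k) (v j)"
    proof -
      have "s + \<delta> \<le> gp orig (v j) (v k)" "s + \<delta> \<le> gp orig (v k) (v' k)" using N3 N4 k ij by auto
      then show ?thesis
        using hyp[OF orig_P convD[OF cv(1)] convD[OF cv(1)] convD[OF cv(2)], of j k k] gp_commute[of orig "v' k" "v j"] by linarith
    qed
    have 3: "s < gp orig (u' k) (v' k)" using uv'(3) k by blast
    have "s - \<delta> \<le> gp orig (u i) (v' k)"
      using hyp[OF orig_P convD[OF cu(1)] convD[OF cu(2)] convD[OF cv(2)], of i k k] 1 3 by linarith
    then show ?thesis
      using hyp[OF orig_P convD[OF cu(1)] convD[OF cv(2)] convD[OF cv(1)], of i k j] 2 \<delta> by linarith
  qed
  then show ?thesis by blast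
qed

lemma less_BP_self: "a \<in> bd \<Longrightarrow> ereal s < BP orig a a"
proof -
  assume a: "a \<in> bd"
  obtain u where u: "u \<in> a" using boundary_nonempty[OF a] by blast
  obtain N where N: "\<forall>i\<ge>N. \<forall>j\<ge>N. s + 1 \<le> gp orig (u i) (u j)" using conv_bound[OF boundary_conv[OF a u]] by blast
  have "ereal (s + 1) \<le> BP orig a a" using u u by (rule le_BP[where N = N]) (use N in blast)
  moreover have "ereal s < ereal (s + 1)" by simp
  ultimately show ?thesis by (rule less_le_trans[rotated])
qed

text \<open>By the identity \<open>gq\<close>, passing from the identity to \<open>q\<close> as base
  point changes a product by \<open>t\<close> minus the products of \<open>q\<close> with the two
  points. Near \<open>a\<close> those products are \<open>t\<close> up to a bounded error, which
  gives the first two claims. The third also covers points that may be far from \<open>a\<close>: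
  they do not acquire a large product with \<open>a\<close> at \<open>q\<close>.\<close>

lemma rescale:
  assumes a: "a \<in> bd"
  obtains q where "q \<in> carrier G"
    "\<And>b c s. b \<in> bd \<Longrightarrow> c \<in> bd \<Longrightarrow> ereal (real t + 2 * \<delta>) < BP orig a b \<Longrightarrow> ereal (real t + 2 * \<delta>) < BP orig a c \<Longrightarrow>
      ereal s < BP orig b c \<Longrightarrow> ereal (s - real t) \<le> BP (vertex q) b c"
    "\<And>b c s. b \<in> bd \<Longrightarrow> c \<in> bd \<Longrightarrow> ereal (real t + 2 * \<delta>) < BP orig a b \<Longrightarrow> ereal (real t + 2 * \<delta>) < BP orig a c \<Longrightarrow>
      ereal s < BP (vertex q) b c \<Longrightarrow> ereal (s - (2 + 4 * \<delta> - real t)) \<le> BP orig b c"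
    "\<And>b s. b \<in> bd \<Longrightarrow> ereal s < BP (vertex q) a b \<Longrightarrow> s \<le> 1 + 3 * \<delta> \<or> ereal (s + real t - 2 - 5 * \<delta>) \<le> BP orig a b"
proof -
  obtain w where w: "w \<in> a" using boundary_nonempty[OF a] by blast
  have cw: "conv w" by (rule boundary_conv[OF a w])
  \<comment> \<open>The margin covers both uses of \<open>W\<close>: its distance from the identity
    must exceed \<open>t + 1\<close>, and its products with later terms must be at least
    \<open>t\<close>.\<close>
  obtain n where n: "\<forall>i\<ge>n. \<forall>j\<ge>n. real t + 2 * \<delta> + 2 \<le> gp orig (w i) (w j)" using conv_bound[OF cw] by blast
  define W where "W = w n"
  have W: "W \<in> P" unfolding W_def by (rule convD[OF cw])
  have "real t + 2 * \<delta> + 2 \<le> gp orig W W" unfolding W_def using n by blast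
  also have "\<dots> = d orig W" by (simp add: gp_def d_self[OF W] d_commute[of orig W])
  finally have "real t + 1 \<le> d orig W" using \<delta> by linarith
  then obtain q where q: "q \<in> carrier G" "d orig (vertex q) = real t" "d (vertex q) W \<le> d orig W - real t + 2"
    using geodesic_vertex[OF G A W] by blast
  let ?q = "vertex q"
  have Q: "?q \<in> P" by (rule vertex_points[OF G A q(1)])
  have qW: "real t - 1 \<le> gp orig ?q W"
    using q(2,3) by (simp add: gp_def d_commute[of ?q orig] d_commute[of W orig])
  \<comment> \<open>The upper bound is the distance of \<open>q\<close> from the identity. The lower
    bound comes from the chain \<open>?q\<close>, \<open>W\<close>, a late term of \<open>w\<close>,
    \<open>v j\<close>.\<close>
  have near: "\<exists>N. \<forall>j\<ge>N. real t - 1 - 2 * \<delta> \<le> gp orig ?q (v j) \<and> gp orig ?q (v j) \<le> real t"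
    if b: "b \<in> bd" "ereal (real t + 2 * \<delta>) < BP orig a b" and v: "v \<in> b" for b v
  proof -
    have cv: "conv v" by (rule boundary_conv[OF b(1) v])
    obtain N where N: "\<forall>i\<ge>N. \<forall>j\<ge>N. real t + 2 * \<delta> - 2 * \<delta> \<le> gp orig (w i) (v j)"
      using gp_of_less_BP[OF a b(1) w v b(2)] by blast
    have "real t - 1 - 2 * \<delta> \<le> gp orig ?q (v j) \<and> gp orig ?q (v j) \<le> real t" if j: "N \<le> j" for j
    proof
      let ?i = "max N n"
      have "real t \<le> gp orig (w ?i) (v j)" using N j by force
      moreover have "real t + 2 * \<delta> + 2 \<le> gp orig W (w ?i)" unfolding W_def using n by simp
      ultimately have "real t - \<delta> \<le> gp orig W (v j)"
        using hyp[OF orig_P W convD[OF cw] convD[OF cv], of ?i j] \<delta> by linarith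
      then show "real t - 1 - 2 * \<delta> \<le> gp orig ?q (v j)"
        using hyp[OF orig_P Q W convD[OF cv], of j] qW \<delta> by linarith
      show "gp orig ?q (v j) \<le> real t"
        using gp_le[OF orig_P Q convD[OF cv]] q(2) by (simp add: d_commute[of ?q orig])
    qed
    then show ?thesis by blast
  qed
  have dq: "d x ?q = d x orig + real t - 2 * gp orig ?q x" for x
    using q(2) unfolding gp_def[of orig ?q x] d_commute[of ?q orig] d_commute[of ?q x] by argo
  have gq: "gp ?q x y = gp orig x y + real t - gp orig ?q x - gp orig ?q y" for x y
    unfolding gp_def[of ?q x y] dq gp_def[of orig x y] by (simp add: field_simps)
  have both: "\<exists>N. \<forall>i\<ge>N. \<forall>j\<ge>N. gp orig (u i) (v j) \<le> gp ?q (u i) (v j) + real t \<and>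
      gp ?q (u i) (v j) \<le> gp orig (u i) (v j) + (2 + 4 * \<delta> - real t)"
    if bc: "b \<in> bd" "c \<in> bd" "ereal (real t + 2 * \<delta>) < BP orig a b" "ereal (real t + 2 * \<delta>) < BP orig a c"
      and uv: "u \<in> b" "v \<in> c" for b c u v
  proof -
    obtain N where N: "\<forall>j\<ge>N. real t - 1 - 2 * \<delta> \<le> gp orig ?q (u j) \<and> gp orig ?q (u j) \<le> real t"
      using near[OF bc(1,3) uv(1)] by blast
    obtain M where M: "\<forall>j\<ge>M. real t - 1 - 2 * \<delta> \<le> gp orig ?q (v j) \<and> gp orig ?q (v j) \<le> real t"
      using near[OF bc(2,4) uv(2)] by blast
    have "gp orig (u i) (v j) \<le> gp ?q (u i) (v j) + real t \<and>
        gp ?q (u i) (v j) \<le> gp orig (u i) (v j) + (2 + 4 * \<delta> - real t)" if "max N M \<le> i" "max N M \<le> j" for i j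
      using N[rule_format, of i] M[rule_format, of j] that gq[of "u i" "v j"] by auto
    then show ?thesis by blast
  qed
  show ?thesis
  proof (rule that[OF q(1)])
    fix b c s assume bc: "b \<in> bd" "c \<in> bd" "ereal (real t + 2 * \<delta>) < BP orig a b" "ereal (real t + 2 * \<delta>) < BP orig a c"
    { assume "ereal s < BP orig b c"
      then show "ereal (s - real t) \<le> BP ?q b c"
      proof (rule BP_shift[OF bc(1,2)])
        fix u v assume uv: "u \<in> b" "v \<in> c"
        show "\<exists>N. \<forall>i\<ge>N. \<forall>j\<ge>N. gp orig (u i) (v j) \<le> gp ?q (u i) (v j) + real t"
          using both[OF bc uv] by blast
      qed }
    { assume "ereal s < BP ?q b c"
      then show "ereal (s - (2 + 4 * \<delta> - real t)) \<le> BP orig b c"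
      proof (rule BP_shift[OF bc(1,2)])
        fix u v assume uv: "u \<in> b" "v \<in> c"
        show "\<exists>N. \<forall>i\<ge>N. \<forall>j\<ge>N. gp ?q (u i) (v j) \<le> gp orig (u i) (v j) + (2 + 4 * \<delta> - real t)"
          using both[OF bc uv] by blast
      qed }
  next
    fix b s assume b: "b \<in> bd" "ereal s < BP ?q a b"
    obtain u v N where uv: "u \<in> a" "v \<in> b" "\<forall>i\<ge>N. \<forall>j\<ge>N. s < gp ?q (u i) (v j)" using less_BP[OF b(2)] by blast
    obtain M where M: "\<forall>j\<ge>M. real t - 1 - 2 * \<delta> \<le> gp orig ?q (u j) \<and> gp orig ?q (u j) \<le> real t"
      using near[OF a less_BP_self[OF a] uv(1)] by blast
    have c: "conv u" "conv v" using boundary_conv a b uv by blast+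
    show "s \<le> 1 + 3 * \<delta> \<or> ereal (s + real t - 2 - 5 * \<delta>) \<le> BP orig a b"
    proof (cases "s \<le> 1 + 3 * \<delta>")
      case False
      \<comment> \<open>If the minimum in the inequality below were
        \<open>gp orig (u i) (v j)\<close>, then \<open>gq\<close> would force
        \<open>s < 1 + 3 * \<delta>\<close>. So it is the product of \<open>q\<close> with
        \<open>u i\<close>, and the product of \<open>q\<close> with \<open>v j\<close> is close to
        \<open>t\<close> from below as well.\<close>
      have "s + real t - 2 - 5 * \<delta> \<le> gp orig (u i) (v j)" if ij: "max N M \<le> i" "max N M \<le> j" for i j
      proof -
        have "s < gp ?q (u i) (v j)" using uv(3) ij by auto
        moreover have "real t - 1 - 2 * \<delta> \<le> gp orig ?q (u i)" using M ij by auto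
        moreover have "min (gp orig ?q (u i)) (gp orig (u i) (v j)) - \<delta> \<le> gp orig ?q (v j)"
          by (rule hyp[OF orig_P Q convD[OF c(1)] convD[OF c(2)]])
        ultimately show ?thesis using False gq[of "u i" "v j"] by linarith
      qed
      then have "ereal (s + real t - 2 - 5 * \<delta>) \<le> BP orig a b" using uv(1,2) by (rule le_BP[rotated 2])
      then show ?thesis ..
    qed simp
  qed
qed

end

section \<open>Visual metrics under the action\<close>

lemma exp_minus_less_imp:
  assumes "1 < \<Lambda>" "0 \<le> x" "exp_minus \<Lambda> x < \<Lambda> powr (- s)"
  shows "ereal s < x"
proof (cases x)
  case (real b)
  then have "\<Lambda> powr (- b) < \<Lambda> powr (- s)" using assms(3) by (simp add: exp_minus_def)
  then have "- b < - s" using assms(1) powr_less_cancel_iff by blast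
  then show ?thesis using real by simp
qed (use assms(2) in simp_all)

lemma exp_minus_le:
  assumes "1 < \<Lambda>" "ereal s \<le> x"
  shows "exp_minus \<Lambda> x \<le> \<Lambda> powr (- s)"
proof (cases x)
  case (real b)
  then have "\<Lambda> powr (- b) \<le> \<Lambda> powr (- s)" using assms by (intro powr_mono) auto
  then show ?thesis using real by (simp add: exp_minus_def)
qed (use assms(2) in \<open>simp_all add: exp_minus_def\<close>)

lemma exp_minus_ge:
  assumes "1 < \<Lambda>" "0 \<le> x" "\<And>s. ereal s < x \<Longrightarrow> s \<le> b"
  shows "\<Lambda> powr (- b) \<le> exp_minus \<Lambda> x"
proof (cases x)
  case (real y)
  have "y \<le> b"
  proof (rule field_le_epsilon)
    fix e :: real assume "0 < e"
    then have "ereal (y - e) < x" using real by simp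
    then show "y \<le> b + e" using assms(3)[of "y - e"] by simp
  qed
  then have "\<Lambda> powr (- b) \<le> \<Lambda> powr (- y)" using assms(1) by (intro powr_mono) auto
  then show ?thesis using real by (simp add: exp_minus_def)
next
  case PInf
  then show ?thesis using assms(3)[of "b + 1"] by simp
qed (use assms(2) in simp)

text \<open>The exponent must be a natural number because it counts steps of a geodesic in the word
  metric; rounding costs a factor \<open>\<Lambda>\<close>.\<close>

lemma powr_floor:
  assumes "1 < \<Lambda>" "0 < y" "y \<le> 1"
  obtains t :: nat where "y \<le> \<Lambda> powr (- real t)" "\<Lambda> powr (- real t) \<le> \<Lambda> * y"
proof -
  define \<tau> where "\<tau> = - log \<Lambda> y"
  have y: "\<Lambda> powr (- \<tau>) = y" using assms by (simp add: \<tau>_def)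
  have "0 \<le> \<tau>" using assms by (simp add: \<tau>_def)
  define t where "t = nat \<lfloor>\<tau>\<rfloor>"
  have t: "real t \<le> \<tau>" "\<tau> < real t + 1" using \<open>0 \<le> \<tau>\<close> by (simp_all add: t_def)
  have "y \<le> \<Lambda> powr (- real t)" unfolding y[symmetric] using t assms(1) by (intro powr_mono) auto
  moreover have "\<Lambda> powr (- real t) \<le> \<Lambda> powr (1 + - \<tau>)" using t assms(1) by (intro powr_mono) auto
  then have "\<Lambda> powr (- real t) \<le> \<Lambda> * y" unfolding powr_add using assms(1) y by simp
  ultimately show ?thesis using that by blast
qed

context hyperbolic_cayley
begin

text \<open>Moving the base point to the identity changes products by at most a distance, hence the
  bounds by the factor \<open>E\<close>; all factors are merged into one constant.\<close>

lemma visual_metric_normalized: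
  assumes "visual_metric (cayley_graph G A) m"
  obtains K \<Lambda> where "1 \<le> K" "1 < \<Lambda>" "mspace m = bd"
    "\<And>a b. a \<in> bd \<Longrightarrow> b \<in> bd \<Longrightarrow> exp_minus \<Lambda> (BP orig a b) \<le> K * mdist m a b"
    "\<And>a b. a \<in> bd \<Longrightarrow> b \<in> bd \<Longrightarrow> mdist m a b \<le> K * exp_minus \<Lambda> (BP orig a b)"
proof -
  obtain p C \<Lambda> where v: "mspace m = bd" "p \<in> P" "1 \<le> C" "1 < \<Lambda>"
    "\<And>a b. a \<in> bd \<Longrightarrow> b \<in> bd \<Longrightarrow> inverse C * exp_minus \<Lambda> (BP p a b) \<le> mdist m a b"
    "\<And>a b. a \<in> bd \<Longrightarrow> b \<in> bd \<Longrightarrow> mdist m a b \<le> C * exp_minus \<Lambda> (BP p a b)"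
    using assms unfolding visual_metric_def mX by auto
  define E where "E = \<Lambda> powr (d p orig + 1)"
  have "\<Lambda> powr 0 \<le> E" unfolding E_def using v(4) d_nonneg[of p orig] by (intro powr_mono) auto
  then have E: "1 \<le> E" using v(4) by simp
  have CE: "1 \<le> C * E" using v(3) E mult_mono[of 1 C 1 E] by simp
  have 1: "exp_minus \<Lambda> (BP orig a b) \<le> C * E * mdist m a b" if ab: "a \<in> bd" "b \<in> bd" for a b
  proof -
    have "exp_minus \<Lambda> (BP orig a b) \<le> E * exp_minus \<Lambda> (BP p a b)"
      unfolding E_def using v(4) BP_nonneg[OF v(2) ab] BP_base[OF ab v(2) orig_P] by (rule exp_minus_compare)
    also have "exp_minus \<Lambda> (BP p a b) \<le> C * mdist m a b" using v(5)[OF ab] v(3) by (simp add: field_simps)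
    finally show ?thesis using E by (simp add: mult_ac mult_left_mono)
  qed
  have 2: "mdist m a b \<le> C * E * exp_minus \<Lambda> (BP orig a b)" if ab: "a \<in> bd" "b \<in> bd" for a b
  proof -
    have "exp_minus \<Lambda> (BP p a b) \<le> E * exp_minus \<Lambda> (BP orig a b)"
      unfolding E_def d_commute[of p orig] using v(4) BP_nonneg[OF orig_P ab] BP_base[OF ab orig_P v(2)] by (rule exp_minus_compare)
    then have "C * exp_minus \<Lambda> (BP p a b) \<le> C * (E * exp_minus \<Lambda> (BP orig a b))" using v(3) by (intro mult_left_mono) auto
    then show ?thesis using v(6)[OF ab] by (simp add: mult.assoc)
  qed
  show ?thesis using that[OF CE v(4,1) 1 2] .
qed

context
  fixes m :: "(nat \<Rightarrow> 'a \<Rightarrow> real) set metric" and K \<Lambda> :: real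
  assumes K: "1 \<le> K" and \<Lambda>: "1 < \<Lambda>" and space: "mspace m = bd"
    and lower: "\<And>a b. a \<in> bd \<Longrightarrow> b \<in> bd \<Longrightarrow> exp_minus \<Lambda> (BP orig a b) \<le> K * mdist m a b"
    and upper: "\<And>a b. a \<in> bd \<Longrightarrow> b \<in> bd \<Longrightarrow> mdist m a b \<le> K * exp_minus \<Lambda> (BP orig a b)"
begin

text \<open>Acting by \<open>g\<close> amounts to moving the base point by the inverse of
  \<open>g\<close>, so products change by a bounded amount depending on \<open>g\<close>.\<close>

lemma act_Lipschitz:
  assumes g: "g \<in> carrier G"
  shows "\<exists>M>0. \<forall>a\<in>bd. \<forall>b\<in>bd. mdist m (act g a) (act g b) \<le> M * mdist m a b"
proof -
  let ?o = "tr (inv g) orig"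
  have o: "?o \<in> P" using g by (intro tr_P orig_P) auto
  have go: "tr g ?o = orig" by (rule inv_tr[OF g orig_P])
  define E where "E = \<Lambda> powr (d orig ?o + 1)"
  have E: "0 < E" using \<Lambda> by (simp add: E_def)
  have "mdist m (act g a) (act g b) \<le> (K * E * K) * mdist m a b" if ab: "a \<in> bd" "b \<in> bd" for a b
  proof -
    have "mdist m (act g a) (act g b) \<le> K * exp_minus \<Lambda> (BP orig (act g a) (act g b))"
      using ab by (intro upper act_boundary[OF g])
    also have "BP orig (act g a) (act g b) = BP ?o a b" using BP_act[OF g o ab] go by simp
    also have "exp_minus \<Lambda> (BP ?o a b) \<le> E * exp_minus \<Lambda> (BP orig a b)"
      unfolding E_def using \<Lambda> BP_nonneg[OF orig_P ab] BP_base[OF ab orig_P o] by (rule exp_minus_compare)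
    also have "\<dots> \<le> E * (K * mdist m a b)" using E lower[OF ab] by (intro mult_left_mono) auto
    finally show ?thesis using K by (simp add: mult_ac)
  qed
  moreover have "0 < K * E * K" using K E by simp
  ultimately show ?thesis by blast
qed

lemma continuous_act: "g \<in> carrier G \<Longrightarrow> continuous_map (mtopology_of m) (mtopology_of m) (act g)"
  unfolding continuous_map_mtopology_of
proof (intro conjI ballI allI impI)
  assume g: "g \<in> carrier G"
  show "act g \<in> mspace m \<rightarrow> mspace m" using act_boundary[OF g] by (simp add: space)
  obtain M where M: "0 < M" "\<forall>a\<in>bd. \<forall>b\<in>bd. mdist m (act g a) (act g b) \<le> M * mdist m a b" using act_Lipschitz[OF g] by blast
  fix x and \<epsilon> :: real assume x: "x \<in> mspace m" "0 < \<epsilon>"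
  have "mdist m (act g x) (act g y) < \<epsilon>" if y: "y \<in> mspace m" "mdist m x y < \<epsilon> / M" for y
  proof -
    have "mdist m (act g x) (act g y) \<le> M * mdist m x y" using M(2) x(1) y(1) by (simp add: space)
    also have "\<dots> < \<epsilon>" using y(2) M(1) by (simp add: field_simps)
    finally show ?thesis .
  qed
  then show "\<exists>\<delta>>0. \<forall>y\<in>mspace m. mdist m x y < \<delta> \<longrightarrow> mdist m (act g x) (act g y) < \<epsilon>"
    using x(2) M(1) by (intro exI[of _ "\<epsilon> / M"]) simp
qed

lemma homeomorphic_act:
  assumes g: "g \<in> carrier G"
  shows "homeomorphic_map (mtopology_of m) (mtopology_of m) (act g)"
proof -
  have "act g (act (inv g) a) = a" if "a \<in> bd" for a using act_inv[of "inv g" a] g that by simp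
  then have "homeomorphic_maps (mtopology_of m) (mtopology_of m) (act g) (act (inv g))"
    unfolding homeomorphic_maps_def using continuous_act[OF g] continuous_act[OF inv_closed[OF g]] act_inv[OF g]
    by (simp add: space)
  then show ?thesis unfolding homeomorphic_map_maps by blast
qed

text \<open>The blow-up is the action of the inverse of the \<open>q\<close> from
  \<open>rescale\<close>: it moves \<open>q\<close> to the identity, so products at \<open>q\<close>
  become products at the identity.\<close>

lemma expansion:
  assumes \<Delta>: "0 < \<Delta>"
  shows "\<exists>L\<ge>1. \<forall>x\<in>mspace m. \<forall>r. 0 < r \<and> r \<le> \<Delta> \<longrightarrow>
    (\<exists>g. homeomorphic_map (mtopology_of m) (mtopology_of m) g \<and>
        (\<forall>y\<in>mspace m. \<forall>z\<in>mspace m. mdist m x y < r \<and> mdist m x z < r \<longrightarrow>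
           mdist m y z / (L * r) \<le> mdist m (g y) (g z) \<and> mdist m (g y) (g z) \<le> L * mdist m y z / r) \<and>
        (\<forall>y\<in>mspace m. r \<le> mdist m x y \<longrightarrow> 1 / L \<le> mdist m (g x) (g y)))"
proof -
  \<comment> \<open>Dominates every factor below: \<open>K ^ 3\<close> with exponent
    \<open>4 + 6 * \<delta>\<close> for the lower bound on the ball, and with
    \<open>3 + 7 * \<delta>\<close> for the points outside it. The summand \<open>\<Delta>\<close>
    serves the large radii.\<close>
  define L where "L = K ^ 3 * \<Lambda> powr (4 + 7 * \<delta>) + \<Delta>"
  have pw: "\<Lambda> powr s \<le> \<Lambda> powr t" if "s \<le> t" for s t using that \<Lambda> by (intro powr_mono) auto
  have Lbig: "K ^ i * \<Lambda> powr s \<le> L" if "i \<le> 3" "s \<le> 4 + 7 * \<delta>" for i :: nat and s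
  proof -
    have "K ^ i * \<Lambda> powr s \<le> K ^ 3 * \<Lambda> powr (4 + 7 * \<delta>)"
      using that K pw by (intro mult_mono power_increasing) auto
    then show ?thesis using \<Delta> by (simp add: L_def)
  qed
  have L1: "1 \<le> L" using Lbig[of 0 0] \<delta> \<Lambda> by simp
  have "\<exists>g. homeomorphic_map (mtopology_of m) (mtopology_of m) g \<and>
        (\<forall>y\<in>mspace m. \<forall>z\<in>mspace m. mdist m a y < r \<and> mdist m a z < r \<longrightarrow>
           mdist m y z / (L * r) \<le> mdist m (g y) (g z) \<and> mdist m (g y) (g z) \<le> L * mdist m y z / r) \<and>
        (\<forall>y\<in>mspace m. r \<le> mdist m a y \<longrightarrow> 1 / L \<le> mdist m (g a) (g y))"
    if a: "a \<in> mspace m" and r: "0 < r" "r \<le> \<Delta>" for a r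
  proof (cases "K * r * \<Lambda> powr (2 * \<delta>) \<le> 1")
    \<comment> \<open>Here \<open>r\<close> is bounded below and \<open>L * r\<close> is at least 1,
      so the identity map already has the required properties.\<close>
    case False
    have Lr: "1 \<le> L * r"
    proof -
      have "K * \<Lambda> powr (2 * \<delta>) * r \<le> L * r" using Lbig[of 1 "2 * \<delta>"] \<delta> r(1) by (intro mult_right_mono) auto
      then show ?thesis using False by (simp add: mult_ac)
    qed
    have rL: "r \<le> L" using r(2) K by (simp add: L_def add_increasing)
    show ?thesis
    proof (intro exI[of _ id] conjI ballI impI)
      fix y z
      show "mdist m y z / (L * r) \<le> mdist m (id y) (id z)"
        using Lr mdist_nonneg[of m y z] mult_left_mono[of 1 "L * r" "mdist m y z"] by (simp add: divide_le_eq)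
      show "mdist m (id y) (id z) \<le> L * mdist m y z / r"
        using rL r(1) mdist_nonneg[of m y z] mult_right_mono[of r L "mdist m y z"] by (simp add: le_divide_eq mult.commute)
    next
      fix y assume "r \<le> mdist m a y"
      moreover have "1 / L \<le> r" using Lr L1 by (simp add: divide_le_eq mult.commute)
      ultimately show "1 / L \<le> mdist m (id a) (id y)" by simp
    qed simp
  next
    case True
    let ?y = "K * r * \<Lambda> powr (2 * \<delta>)"
    have abd: "a \<in> bd" using a space by simp
    have "0 < ?y" using K r(1) \<Lambda> by simp
    \<comment> \<open>The factors in \<open>?y\<close> are fitted so that every point within
      \<open>r\<close> of \<open>a\<close> has product above \<open>t + 2 * \<delta>\<close> with
      \<open>a\<close>, as \<open>rescale\<close> demands.\<close>
    then obtain t :: nat where t: "?y \<le> \<Lambda> powr (- real t)" "\<Lambda> powr (- real t) \<le> \<Lambda> * ?y"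
      using powr_floor[OF \<Lambda> _ True] by blast
    obtain q where q: "q \<in> carrier G"
      and q1: "\<And>b c s. b \<in> bd \<Longrightarrow> c \<in> bd \<Longrightarrow> ereal (real t + 2 * \<delta>) < BP orig a b \<Longrightarrow> ereal (real t + 2 * \<delta>) < BP orig a c \<Longrightarrow>
        ereal s < BP orig b c \<Longrightarrow> ereal (s - real t) \<le> BP (vertex q) b c"
      and q2: "\<And>b c s. b \<in> bd \<Longrightarrow> c \<in> bd \<Longrightarrow> ereal (real t + 2 * \<delta>) < BP orig a b \<Longrightarrow> ereal (real t + 2 * \<delta>) < BP orig a c \<Longrightarrow>
        ereal s < BP (vertex q) b c \<Longrightarrow> ereal (s - (2 + 4 * \<delta> - real t)) \<le> BP orig b c"
      and q3: "\<And>b s. b \<in> bd \<Longrightarrow> ereal s < BP (vertex q) a b \<Longrightarrow> s \<le> 1 + 3 * \<delta> \<or> ereal (s + real t - 2 - 5 * \<delta>) \<le> BP orig a b"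
      apply (rule rescale[OF abd, where t = t])
      subgoal premises p for q by (rule that) (fact p)+
      done
    let ?q = "vertex q" and ?g = "act (inv q)"
    have qi: "inv q \<in> carrier G" and qP: "?q \<in> P" using q vertex_points[OF G A] by auto
    have "tr (inv q) ?q = orig" using transl_vertex[OF G A qi q] q by simp
    then have BPg: "BP orig (?g b) (?g c) = BP ?q b c" if "b \<in> bd" "c \<in> bd" for b c
      using BP_act[OF qi qP that] by simp
    have near: "ereal (real t + 2 * \<delta>) < BP orig a b" if b: "b \<in> bd" "mdist m a b < r" for b
    proof (rule exp_minus_less_imp[OF \<Lambda> BP_nonneg[OF orig_P abd b(1)]])
      have "exp_minus \<Lambda> (BP orig a b) \<le> K * mdist m a b" by (rule lower[OF abd b(1)])
      also have "\<dots> < K * r" using b(2) K by simp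
      also have "K * r = ?y * \<Lambda> powr (- 2 * \<delta>)" using \<Lambda> by (simp add: powr_minus)
      also have "\<dots> \<le> \<Lambda> powr (- real t) * \<Lambda> powr (- 2 * \<delta>)" using t(1) by (intro mult_right_mono) auto
      also have "\<dots> = \<Lambda> powr (- (real t + 2 * \<delta>))" by (simp add: powr_add[symmetric])
      finally show "exp_minus \<Lambda> (BP orig a b) < \<Lambda> powr (- (real t + 2 * \<delta>))" .
    qed
    have Lt: "\<Lambda> powr real t * \<Lambda> powr (- real t) = 1" using \<Lambda> by (simp add: powr_minus)
    have "1 \<le> \<Lambda> powr (2 * \<delta>)" using pw[of 0 "2 * \<delta>"] \<delta> \<Lambda> by simp
    then have "K * r * 1 \<le> ?y" using K r(1) by (intro mult_left_mono) auto
    then have "K * r \<le> \<Lambda> powr (- real t)" using t(1) by simp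
    then have tr: "\<Lambda> powr real t * (K * r) \<le> 1"
      using mult_left_mono[of "K * r" "\<Lambda> powr (- real t)" "\<Lambda> powr real t"] Lt by simp
    show ?thesis
    proof (intro exI[of _ ?g] conjI ballI impI)
      show "homeomorphic_map (mtopology_of m) (mtopology_of m) ?g" by (rule homeomorphic_act[OF qi])
    next
      fix b c assume "b \<in> mspace m" "c \<in> mspace m" and bc: "mdist m a b < r \<and> mdist m a c < r"
      then have bd: "b \<in> bd" "c \<in> bd" by (simp_all add: space)
      then have n: "ereal (real t + 2 * \<delta>) < BP orig a b" "ereal (real t + 2 * \<delta>) < BP orig a c" using near bc by blast+
      have gb: "?g b \<in> bd" "?g c \<in> bd" using act_boundary[OF qi] bd by blast+
      have "mdist m (?g b) (?g c) \<le> K * exp_minus \<Lambda> (BP ?q b c)" using upper[OF gb] BPg[OF bd] by simp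
      also have "\<dots> \<le> K * (\<Lambda> powr (real t + 1) * exp_minus \<Lambda> (BP orig b c))"
        using K \<Lambda> BP_nonneg[OF orig_P bd] q1[OF bd n] by (intro mult_left_mono exp_minus_compare) auto
      also have "\<dots> \<le> K * (\<Lambda> powr (real t + 1) * (K * mdist m b c))"
        using K lower[OF bd] by (intro mult_left_mono) auto
      also have "\<dots> = (\<Lambda> powr real t * (K * r)) * (K * \<Lambda> * mdist m b c / r)"
        using r(1) \<Lambda> by (simp add: powr_add field_simps)
      also have "\<dots> \<le> 1 * (K * \<Lambda> * mdist m b c / r)"
        using tr K \<Lambda> r(1) by (intro mult_right_mono) auto
      also have "\<dots> \<le> L * mdist m b c / r"
        using Lbig[of 1 1] \<delta> \<Lambda> r(1) by (simp add: divide_right_mono mult_right_mono)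
      finally show "mdist m (?g b) (?g c) \<le> L * mdist m b c / r" .
      have "mdist m b c \<le> K * exp_minus \<Lambda> (BP orig b c)" by (rule upper[OF bd])
      also have "\<dots> \<le> K * (\<Lambda> powr (2 + 4 * \<delta> - real t + 1) * exp_minus \<Lambda> (BP ?q b c))"
        using K \<Lambda> BP_nonneg[OF qP bd] q2[OF bd n] by (intro mult_left_mono exp_minus_compare) auto
      also have "\<dots> \<le> K * (\<Lambda> powr (2 + 4 * \<delta> - real t + 1) * (K * mdist m (?g b) (?g c)))"
        using K lower[OF gb] BPg[OF bd] by (intro mult_left_mono) auto
      also have "\<Lambda> powr (2 + 4 * \<delta> - real t + 1) = \<Lambda> powr (3 + 4 * \<delta>) * \<Lambda> powr (- real t)"
        by (simp add: powr_add[symmetric] add_diff_eq)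
      also have "K * (\<Lambda> powr (3 + 4 * \<delta>) * \<Lambda> powr (- real t) * (K * mdist m (?g b) (?g c)))
          \<le> K * (\<Lambda> powr (3 + 4 * \<delta>) * (\<Lambda> * ?y) * (K * mdist m (?g b) (?g c)))"
        using t(2) K by (intro mult_left_mono mult_right_mono) auto
      also have "\<dots> = K ^ 3 * (\<Lambda> powr (3 + 4 * \<delta>) * \<Lambda> powr 1 * \<Lambda> powr (2 * \<delta>)) * r * mdist m (?g b) (?g c)"
        using \<Lambda> by (simp add: power3_eq_cube mult_ac)
      also have "\<Lambda> powr (3 + 4 * \<delta>) * \<Lambda> powr 1 * \<Lambda> powr (2 * \<delta>) = \<Lambda> powr (4 + 6 * \<delta>)"
        by (simp only: powr_add[symmetric]) (simp add: algebra_simps)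
      also have "K ^ 3 * \<Lambda> powr (4 + 6 * \<delta>) * r * mdist m (?g b) (?g c) \<le> L * r * mdist m (?g b) (?g c)"
        using Lbig[of 3 "4 + 6 * \<delta>"] \<delta> r(1) by (intro mult_right_mono) auto
      finally show "mdist m b c / (L * r) \<le> mdist m (?g b) (?g c)"
        using L1 r(1) by (simp add: pos_divide_le_eq mult_ac)
    next
      fix b assume "b \<in> mspace m" and rb: "r \<le> mdist m a b"
      then have b: "b \<in> bd" by (simp add: space)
      \<comment> \<open>An upper bound for the product with \<open>a\<close>, taken at
        \<open>q\<close>, of points at distance at least \<open>r\<close> from \<open>a\<close>. One
        \<open>K\<close> comes from \<open>upper\<close> and one from \<open>?y\<close>;
        \<open>3 + 7 * \<delta>\<close> is the loss \<open>2 + 5 * \<delta>\<close> in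
        \<open>q3\<close>, plus 1 for the rounding of \<open>t\<close>, plus the
        \<open>2 * \<delta>\<close> in \<open>?y\<close>.\<close>
      define B where "B = log \<Lambda> (K ^ 2) + 3 + 7 * \<delta>"
      have LB: "\<Lambda> powr (- B) = inverse (K ^ 2 * \<Lambda> powr (3 + 7 * \<delta>))"
        unfolding B_def powr_minus using \<Lambda> K by (simp add: powr_add add.assoc)
      have B0: "1 + 3 * \<delta> \<le> B" unfolding B_def using \<Lambda> K \<delta> by (simp add: zero_le_log_cancel_iff add_increasing)
      have "s \<le> B" if s: "ereal s < BP ?q a b" for s
      proof (cases "s \<le> 1 + 3 * \<delta>")
        case True
        then show ?thesis using B0 by simp
      next
        case False
        then have "ereal (s + real t - 2 - 5 * \<delta>) \<le> BP orig a b" using q3[OF b s] by blast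
        then have "exp_minus \<Lambda> (BP orig a b) \<le> \<Lambda> powr (- (s + real t - 2 - 5 * \<delta>))" by (rule exp_minus_le[OF \<Lambda>])
        also have "\<dots> = \<Lambda> powr (2 + 5 * \<delta> - s) * \<Lambda> powr (- real t)" 
          by (simp only: powr_add[symmetric]) (simp add: algebra_simps)
        also have "\<dots> \<le> \<Lambda> powr (2 + 5 * \<delta> - s) * (\<Lambda> * ?y)" using t(2) by (intro mult_left_mono) auto
        also have "\<dots> = (\<Lambda> powr (2 + 5 * \<delta> - s) * \<Lambda> powr 1 * \<Lambda> powr (2 * \<delta>)) * (K * r)" using \<Lambda> by (simp add: mult_ac)
        also have "\<Lambda> powr (2 + 5 * \<delta> - s) * \<Lambda> powr 1 * \<Lambda> powr (2 * \<delta>) = \<Lambda> powr (3 + 7 * \<delta> - s)"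
          by (simp only: powr_add[symmetric]) (simp add: algebra_simps)
        finally have "K * exp_minus \<Lambda> (BP orig a b) \<le> K * (\<Lambda> powr (3 + 7 * \<delta> - s) * (K * r))"
          using K by (intro mult_left_mono) auto
        then have "r \<le> K ^ 2 * \<Lambda> powr (3 + 7 * \<delta> - s) * r"
          using upper[OF abd b] rb by (simp add: power2_eq_square mult_ac)
        then have "1 \<le> K ^ 2 * \<Lambda> powr (3 + 7 * \<delta> - s)" using r(1) by simp
        also have "K ^ 2 = \<Lambda> powr (log \<Lambda> (K ^ 2))" using \<Lambda> K by simp
        also have "\<Lambda> powr (log \<Lambda> (K ^ 2)) * \<Lambda> powr (3 + 7 * \<delta> - s) = \<Lambda> powr (B - s)"
          unfolding B_def by (simp only: powr_add[symmetric]) (simp add: algebra_simps)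
        finally have "\<Lambda> powr 0 \<le> \<Lambda> powr (B - s)" using \<Lambda> by simp
        then have "0 \<le> B - s" using powr_le_cancel_iff[OF \<Lambda>] by blast
        then show ?thesis by simp
      qed
      then have "\<Lambda> powr (- B) \<le> exp_minus \<Lambda> (BP ?q a b)" by (intro exp_minus_ge[OF \<Lambda> BP_nonneg[OF qP abd b]])
      also have "\<dots> \<le> K * mdist m (?g a) (?g b)"
        using lower[OF act_boundary[OF qi abd] act_boundary[OF qi b]] BPg[OF abd b] by simp
      finally have "inverse (K ^ 2 * \<Lambda> powr (3 + 7 * \<delta>)) \<le> K * mdist m (?g a) (?g b)" unfolding LB .
      moreover have "0 < K ^ 2 * \<Lambda> powr (3 + 7 * \<delta>)" using K \<Lambda> by simp
      ultimately have "1 \<le> (K * mdist m (?g a) (?g b)) * (K ^ 2 * \<Lambda> powr (3 + 7 * \<delta>))"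
        by (simp add: inverse_eq_divide pos_divide_le_eq)
      also have "\<dots> = K ^ 3 * \<Lambda> powr (3 + 7 * \<delta>) * mdist m (?g a) (?g b)" by (simp add: power2_eq_square power3_eq_cube mult_ac)
      also have "\<dots> \<le> L * mdist m (?g a) (?g b)"
        using Lbig[of 3 "3 + 7 * \<delta>"] by (intro mult_right_mono) auto
      finally show "1 / L \<le> mdist m (?g a) (?g b)" using L1 by (simp add: pos_divide_le_eq mult.commute)
    qed
  qed
  then show ?thesis using L1 by blast
qed

end

end

section \<open>Transfer from the standard carpet to the boundary\<close>

lemma peripheral_circles_disjoint_transfer:
  assumes h: "homeomorphic_map X Y h"
    and disj: "\<And>S S'. S \<in> peripheral_circles X \<Longrightarrow> S' \<in> peripheral_circles X \<Longrightarrow> S \<noteq> S' \<Longrightarrow> S \<inter> S' = {}"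
    and S: "S \<in> peripheral_circles Y" "S' \<in> peripheral_circles Y" "S \<noteq> S'"
  shows "S \<inter> S' = {}"
proof -
  obtain k where k: "homeomorphic_map Y X k" using homeomorphic_map_inverse[OF h] by blast
  have inj: "inj_on k (topspace Y)" by (rule homeomorphic_imp_injective_map[OF k])
  have sub: "S \<subseteq> topspace Y" "S' \<subseteq> topspace Y" using S(1,2) by (auto simp: peripheral_circles_def)
  have "k ` S \<noteq> k ` S'" using inj_on_image_eq_iff[OF inj sub] S(3) by simp
  then have "k ` S \<inter> k ` S' = {}"
    using disj[OF peripheral_circles_image[OF k S(1)] peripheral_circles_image[OF k S(2)]] by simp
  then show ?thesis by blast
qed

text \<open>By uniform continuity of \<open>h\<close> on the compact source, a circle with two
  points \<open>e\<close> apart comes from one with two points \<open>\<delta>\<close>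
  apart.\<close>

lemma peripheral_circles_null_transfer:
  assumes h: "homeomorphic_map (mtopology_of m1) (mtopology_of m2) h" and cpt: "compact_space (mtopology_of m1)"
    and null: "\<And>e. 0 < e \<Longrightarrow> finite {S \<in> peripheral_circles (mtopology_of m1). \<exists>x\<in>S. \<exists>y\<in>S. e \<le> mdist m1 x y}"
    and "0 < e"
  shows "finite {S \<in> peripheral_circles (mtopology_of m2). \<exists>x\<in>S. \<exists>y\<in>S. e \<le> mdist m2 x y}"
proof -
  obtain k where k: "homeomorphic_map (mtopology_of m2) (mtopology_of m1) k" "\<forall>y\<in>mspace m2. h (k y) = y"
    using homeomorphic_map_inverse[OF h] unfolding topspace_mtopology_of by blast
  have "uniformly_continuous_map m1 m2 h"
    using cpt homeomorphic_imp_continuous_map[OF h] by (blast intro: continuous_imp_uniformly_continuous_map)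
  then have "\<forall>e>0. \<exists>d>0. \<forall>x\<in>mspace m1. \<forall>y\<in>mspace m1. mdist m1 y x < d \<longrightarrow> mdist m2 (h y) (h x) < e"
    unfolding uniformly_continuous_map_def by (rule conjunct2)
  then obtain \<delta> where \<delta>: "0 < \<delta>" "\<forall>x\<in>mspace m1. \<forall>y\<in>mspace m1. mdist m1 y x < \<delta> \<longrightarrow> mdist m2 (h y) (h x) < e"
    using \<open>0 < e\<close> by blast
  let ?F = "{S \<in> peripheral_circles (mtopology_of m1). \<exists>x\<in>S. \<exists>y\<in>S. \<delta> \<le> mdist m1 x y}"
  have "{S \<in> peripheral_circles (mtopology_of m2). \<exists>x\<in>S. \<exists>y\<in>S. e \<le> mdist m2 x y} \<subseteq> (\<lambda>S. h ` S) ` ?F"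
  proof
    fix S assume "S \<in> {S \<in> peripheral_circles (mtopology_of m2). \<exists>x\<in>S. \<exists>y\<in>S. e \<le> mdist m2 x y}"
    then obtain x y where S: "S \<in> peripheral_circles (mtopology_of m2)" "x \<in> S" "y \<in> S" "e \<le> mdist m2 x y" by blast
    have sub: "S \<subseteq> mspace m2" using S(1) by (auto simp: peripheral_circles_def)
    have kS: "k ` S \<in> peripheral_circles (mtopology_of m1)" by (rule peripheral_circles_image[OF k(1) S(1)])
    then have "k x \<in> mspace m1" "k y \<in> mspace m1" using S(2,3) by (auto simp: peripheral_circles_def)
    moreover have "h (k x) = x" "h (k y) = y" using k(2) sub S(2,3) by blast+
    ultimately have "\<delta> \<le> mdist m1 (k x) (k y)" using \<delta>(2) S(4) by fastforce
    then have "k ` S \<in> ?F" using kS S(2,3) by blast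
    moreover have "h ` (k ` S) = S" using k(2) sub by force
    ultimately show "S \<in> (\<lambda>S. h ` S) ` ?F" by (metis (no_types, lifting) imageI)
  qed
  moreover have "finite ?F" using null[OF \<delta>(1)] .
  ultimately show ?thesis by (meson finite_imageI finite_subset)
qed

lemma peripheral_circles_dense_transfer:
  assumes h: "homeomorphic_map X Y h"
    and dense: "\<And>U. openin X U \<Longrightarrow> U \<noteq> {} \<Longrightarrow> \<exists>S\<in>peripheral_circles X. S \<subseteq> U"
    and U: "openin Y U" "U \<noteq> {}"
  shows "\<exists>S\<in>peripheral_circles Y. S \<subseteq> U"
proof -
  let ?V = "{x \<in> topspace X. h x \<in> U}"
  have "openin X ?V" using homeomorphic_imp_continuous_map[OF h] U(1) unfolding continuous_map by blast
  moreover have "?V \<noteq> {}"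
  proof -
    obtain u where u: "u \<in> U" using U(2) by (rule ex_in_conv[THEN iffD2, THEN exE])
    then have "u \<in> h ` topspace X"
      using openin_subset[OF U(1)] unfolding homeomorphic_imp_surjective_map[OF h] by (rule subsetD[rotated])
    then show ?thesis using u by blast
  qed
  ultimately obtain S where S: "S \<in> peripheral_circles X" "S \<subseteq> ?V" using dense by blast
  then have "h ` S \<subseteq> U" by blast
  then show ?thesis using peripheral_circles_image[OF h S(1)] by blast
qed

theorem proposition1p4:
  fixes G :: "('a, 'b) monoid_scheme" and A :: "'a set"
    and d :: "(nat \<Rightarrow> 'a \<Rightarrow> real) set metric"
  assumes "group G"
    and "finite A" and "symmetric_generating_set G A"
    and "gromov_hyperbolic (cayley_graph G A)"
    and "visual_metric (cayley_graph G A) d"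
    and "sierpinski_carpet (mtopology_of d)"
  defines "\<S> \<equiv> peripheral_circles (mtopology_of d)"
  shows "uniform_quasicircles d \<S>
    \<and> uniformly_relatively_separated d \<S>
    \<and> occur_on_all_locations_and_scales d \<S>"
proof -
  obtain \<delta> where \<delta>: "0 \<le> \<delta>" "\<forall>p\<in>cayley_points G A. \<forall>x\<in>cayley_points G A. \<forall>y\<in>cayley_points G A. \<forall>z\<in>cayley_points G A.
      min (gromov_product (cayley_graph G A) p x y) (gromov_product (cayley_graph G A) p y z) - \<delta>
        \<le> gromov_product (cayley_graph G A) p x z"
    using assms(4) unfolding gromov_hyperbolic_def mspace_cayley_graph[OF assms(1,3)] by blast
  interpret H: hyperbolic_cayley G A \<delta>
    by (intro hyperbolic_cayley.intro hyperbolic_cayley_axioms.intro assms(1,3) \<delta>(1)) (use \<delta>(2) in blast)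
  obtain K \<Lambda> where K: "1 \<le> K" "1 < \<Lambda>" "mspace d = H.bd"
    "\<And>a b. a \<in> H.bd \<Longrightarrow> b \<in> H.bd \<Longrightarrow> exp_minus \<Lambda> (H.BP H.orig a b) \<le> K * mdist d a b"
    "\<And>a b. a \<in> H.bd \<Longrightarrow> b \<in> H.bd \<Longrightarrow> mdist d a b \<le> K * exp_minus \<Lambda> (H.BP H.orig a b)"
    apply (rule H.visual_metric_normalized[OF assms(5)])
    subgoal premises p for K \<Lambda> by (rule that) (fact p)+
    done
  have K0: "0 < K" using K(1) by simp
  \<comment> \<open>Products at infinity are nonnegative, so the visual constant \<open>K\<close>
    bounds all distances; it is then used as the \<open>\<Delta>\<close> of the locale.\<close>
  have bounded: "mdist d x y \<le> K" if "x \<in> mspace d" "y \<in> mspace d" for x y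
  proof -
    have xy: "x \<in> H.bd" "y \<in> H.bd" using that K(3) by simp_all
    have "exp_minus \<Lambda> (H.BP H.orig x y) \<le> \<Lambda> powr (- 0)"
      using H.BP_nonneg[OF H.orig_P xy] by (intro exp_minus_le[OF K(2)]) (simp add: zero_ereal_def)
    then have "K * exp_minus \<Lambda> (H.BP H.orig x y) \<le> K * 1" using K by (intro mult_left_mono) auto
    then show ?thesis using K(5)[OF xy] by simp
  qed
  obtain L where L: "1 \<le> L" and E: "\<forall>x\<in>mspace d. \<forall>r. 0 < r \<and> r \<le> K \<longrightarrow>
    (\<exists>g. homeomorphic_map (mtopology_of d) (mtopology_of d) g \<and>
        (\<forall>y\<in>mspace d. \<forall>z\<in>mspace d. mdist d x y < r \<and> mdist d x z < r \<longrightarrow>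
           mdist d y z / (L * r) \<le> mdist d (g y) (g z) \<and> mdist d (g y) (g z) \<le> L * mdist d y z / r) \<and>
        (\<forall>y\<in>mspace d. r \<le> mdist d x y \<longrightarrow> 1 / L \<le> mdist d (g x) (g y)))"
    using H.expansion[OF K K0] by blast
  let ?T = "submetric euclidean_metric standard_carpet"
  have T: "mtopology_of ?T = top_of_set standard_carpet" by (simp add: mtopology_of_submetric)
  have "top_of_set standard_carpet homeomorphic_space mtopology_of d"
    using assms(6) homeomorphic_space_sym unfolding sierpinski_carpet_def by blast
  then obtain h where h: "homeomorphic_map (mtopology_of ?T) (mtopology_of d) h"
    unfolding homeomorphic_space T by blast
  have cT: "compact_space (mtopology_of ?T)" unfolding T using compact_carpet by (simp add: compact_space_subtopology)
  interpret C: self_similar_carpet d \<S> L K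
  proof
    show "compact_space (mtopology_of d)"
      using homeomorphic_compact_space[OF homeomorphic_map_imp_homeomorphic_space[OF h]] cT by blast
    show "\<S> = peripheral_circles (mtopology_of d)" by (simp add: \<S>_def)
    show "S \<inter> S' = {}" if "S \<in> \<S>" "S' \<in> \<S>" "S \<noteq> S'" for S S'
      using peripheral_circles_disjoint_transfer[OF h] carpet_circles_disjoint that unfolding T \<S>_def by blast
    show "finite {S \<in> \<S>. \<exists>x\<in>S. \<exists>y\<in>S. e \<le> mdist d x y}" if "0 < e" for e
      unfolding \<S>_def
    proof (rule peripheral_circles_null_transfer[OF h cT _ that])
      show "finite {S \<in> peripheral_circles (mtopology_of ?T). \<exists>x\<in>S. \<exists>y\<in>S. e \<le> mdist ?T x y}" if "0 < e" for e
        unfolding T mdist_submetric mdist_euclidean_metric using that by (rule carpet_circles_null)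
    qed
    show "\<exists>S\<in>\<S>. S \<subseteq> U" if "openin (mtopology_of d) U" "U \<noteq> {}" for U
      unfolding \<S>_def
    proof (rule peripheral_circles_dense_transfer[OF h _ that])
      fix V assume V: "openin (mtopology_of ?T) V" "V \<noteq> {}"
      then obtain p where p: "p \<in> V" by blast
      have VT: "V \<subseteq> standard_carpet" using openin_subset[OF V(1)] by (simp add: T)
      obtain e where e: "0 < e" "ball p e \<inter> standard_carpet \<subseteq> V"
        using V(1) p unfolding T openin_contains_ball by blast
      obtain S where S: "S \<in> peripheral_circles (top_of_set standard_carpet)" "S \<subseteq> ball p e"
        using carpet_circles_dense[OF _ e(1)] p VT by blast
      have "S \<subseteq> standard_carpet" using S(1) by (auto simp: peripheral_circles_def)
      then show "\<exists>S\<in>peripheral_circles (mtopology_of ?T). S \<subseteq> V" unfolding T using S e(2) by blast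
    qed
    show "1 \<le> L" "0 < K" by (fact L K0)+
    show "mdist d x y \<le> K" if "x \<in> mspace d" "y \<in> mspace d" for x y by (rule bounded[OF that])
  qed (use E in blast)
  have "mdiam d (mspace d) \<le> K"
  proof (cases "mspace d = {}")
    case False
    then show ?thesis using C.mdiam_le bounded by blast
  next
    case True
    \<comment> \<open>A supremum over the empty set carries no information, so the space is shown to
      be nonempty.\<close>
    have "(0, 0) \<in> standard_carpet" by simp
    then have "h (0, 0) \<in> mspace d" using homeomorphic_imp_surjective_map[OF h] by (auto simp: T)
    then show ?thesis using True by blast
  qed
  then show ?thesis
    using C.circles_uniform_quasicircles C.circles_relatively_separated C.circles_all_scales by blast
qed

end
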